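(* Let $m\in\mathbb{N}_0$, let $\alpha,\beta>-1$ be such that if $\alpha,\beta\in(-1,0)$ then $\alpha+\beta+1\neq 0$, and let $x,z\in\mathbb{C}$, with $z\in\mathbb{C}\setminus(-\infty,1]$ on any ellipse with foci at $\pm1$ and $x$ in the interior of that ellipse. Then $$\frac{(1+x)^{-\beta/2}}{(z-x)^{(\alpha+m+1)/2}}\,P_{\alpha+m}^{-\beta}\!\left(\frac{1+z-\sqrt{z^2-1}}{\sqrt{2(z-\sqrt{z^2-1})(z-x)}}\right)=\sum_{n=0}^\infty c_{n,m}^{(\alpha,\beta)}(z)\,P_n^{(\alpha,\beta)}(x),$$ where $c_{n,m}^{(\alpha,\beta)}:\mathbb{C}\setminus(-\infty,1]\to\mathbb{C}$ is defined by $$c_{n,m}^{(\alpha,\beta)}(z):=\frac{(2n+\alpha+\beta+1)\,\Gamma(\alpha+\beta+n+1)\,(\alpha+\beta+m+1)_{2n}}{2^{(\beta-\alpha-m-1)/2}\,\Gamma(\beta+n+1)}\cdot\frac{(z-\sqrt{z^2-1})^{m/2}}{(1-z+\sqrt{z^2-1})^m}\,P_{-m}^{-\alpha-\beta-2n-1}\!\left(\sqrt{\frac{z+1}{z-1}}\right).$$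
   Context: $\mathbb{N}_0=\{0,1,2,\dots\}$. $(z)_n=\prod_{i=1}^n(z+i-1)$ is the Pochhammer symbol. ${}_2F_1(a,b;c;z)=\sum_{n\ge0}\frac{(a)_n(b)_n}{(c)_n}\frac{z^n}{n!}$ is the Gauss hypergeometric function, analytically continued to $\mathbb{C}\setminus[1,\infty)$. The Jacobi polynomials are $P_n^{(\alpha,\beta)}(z)=\frac{(\alpha+1)_n}{n!}\,{}_2F_1(-n,n+\alpha+\beta+1;\alpha+1;\frac{1-z}{2})$. The associated Legendre function of the first kind $P_\nu^\mu:\mathbb{C}\setminus(-\infty,1]\to\mathbb{C}$ is $$P_\nu^\mu(z)=\frac{1}{\Gamma(1-\mu)}\left(\frac{z+1}{z-1}\right)^{\mu/2}{}_2F_1\!\left(-\nu,\nu+1;1-\mu;\frac{1-z}{2}\right).$$ The branch of $\sqrt{z^2-1}$ is the one with $|z-\sqrt{z^2-1}|<1$, i.e. $\sqrt{z^2-1}=\sqrt{z-1}\sqrt{z+1}$ with principal roots, so that $\rho=z-\sqrt{z^2-1}$ inverts the Szegő map $z=(1+\rho^2)/(2\rho)$ for $|\rho|<1$, $\rho\notin(-1,0]$. For $x\in(-1,1]$ all other powers and roots are principal; for fixed $z$, the left-hand side at other points $x$ in the interior of the ellipse is understood as the analytic continuation in $x$, over the interior of the ellipse, of its values on $(-1,1]$. *)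

theory Defs
  imports "HOL-Complex_Analysis.Complex_Analysis"
begin

definition gauss_series :: "complex \<Rightarrow> complex \<Rightarrow> complex \<Rightarrow> complex \<Rightarrow> complex" where
  "gauss_series a b c z = (\<Sum>n. pochhammer a n * pochhammer b n / pochhammer c n * (z ^ n / fact n))"

text \<open>
  The Gauss hypergeometric function, for \<open>c\<close> not a non-positive integer. If \<open>a\<close> or \<open>b\<close> is a
  non-positive integer, the series terminates and is taken at every point of the plane (it is
  needed on the cut as well, because Jacobi polynomials are evaluated there). Otherwise the value
  is that of the analytic continuation of the series to the plane cut along \<open>[1, \<infinity>)\<close>; it is
  unique on this connected domain, and nothing is intended on the cut.
\<close>

definition hyp2F1 :: "complex \<Rightarrow> complex \<Rightarrow> complex \<Rightarrow> complex \<Rightarrow> complex" where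
  "hyp2F1 a b c z =
     (if a \<in> \<int>\<^sub>\<le>\<^sub>0 \<or> b \<in> \<int>\<^sub>\<le>\<^sub>0 then gauss_series a b c z
      else (SOME f. f holomorphic_on (- (complex_of_real ` {1..})) \<and>
                    (\<forall>w\<in>ball 0 1. f w = gauss_series a b c w)) z)"

definition jacobi_P :: "nat \<Rightarrow> real \<Rightarrow> real \<Rightarrow> complex \<Rightarrow> complex" where
  "jacobi_P n \<alpha> \<beta> z =
     pochhammer (\<alpha> + 1) n / fact n *
     hyp2F1 (- of_nat n) (of_nat n + \<alpha> + \<beta> + 1) (\<alpha> + 1) ((1 - z) / 2)"

definition legendre_P :: "complex \<Rightarrow> complex \<Rightarrow> complex \<Rightarrow> complex" where
  "legendre_P \<nu> \<mu> z =
     1 / Gamma (1 - \<mu>) * ((z + 1) / (z - 1)) powr (\<mu> / 2) *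
     hyp2F1 (- \<nu>) (\<nu> + 1) (1 - \<mu>) ((1 - z) / 2)"

text \<open>
  With principal roots, this product is the branch of \<open>sqrt (z\<^sup>2 - 1)\<close> for which
  \<open>\<bar>z - sqrt (z\<^sup>2 - 1)\<bar> < 1\<close> off \<open>[-1, 1]\<close>; \<open>csqrt (z\<^sup>2 - 1)\<close> would be a different function.
\<close>

definition sqrt_sq_minus_one :: "complex \<Rightarrow> complex" where
  "sqrt_sq_minus_one z = csqrt (z - 1) * csqrt (z + 1)"

definition jacobi_gen_fun :: "nat \<Rightarrow> real \<Rightarrow> real \<Rightarrow> complex \<Rightarrow> complex \<Rightarrow> complex" where
  "jacobi_gen_fun m \<alpha> \<beta> z x =
     (1 + x) powr (- \<beta> / 2) / (z - x) powr ((\<alpha> + m + 1) / 2) *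
     legendre_P (\<alpha> + m) (- \<beta>)
       ((1 + z - sqrt_sq_minus_one z) / csqrt (2 * (z - sqrt_sq_minus_one z) * (z - x)))"

definition jacobi_coeff :: "nat \<Rightarrow> nat \<Rightarrow> real \<Rightarrow> real \<Rightarrow> complex \<Rightarrow> complex" where
  "jacobi_coeff n m \<alpha> \<beta> z =
     complex_of_real
       ((2 * real n + \<alpha> + \<beta> + 1) * Gamma (\<alpha> + \<beta> + real n + 1) *
        pochhammer (\<alpha> + \<beta> + real m + 1) (2 * n) /
        (2 powr ((\<beta> - \<alpha> - real m - 1) / 2) * Gamma (\<beta> + real n + 1))) *
     ((z - sqrt_sq_minus_one z) powr (of_nat m / 2) / (1 - z + sqrt_sq_minus_one z) ^ m) *
     legendre_P (- of_nat m) (- \<alpha> - \<beta> - 2 * of_nat n - 1) (csqrt ((z + 1) / (z - 1)))"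

definition focal_ellipse :: "real \<Rightarrow> complex set" where
  "focal_ellipse s = {w. norm (w - 1) + norm (w + 1) = s}"

definition focal_ellipse_interior :: "real \<Rightarrow> complex set" where
  "focal_ellipse_interior s = {w. norm (w - 1) + norm (w + 1) < s}"

end

theory Submission
  imports Defs
begin

text \<open>
  Put \<open>\<rho> = z - sqrt (z\<^sup>2 - 1)\<close>, so that \<open>z = (1 + \<rho>\<^sup>2) / (2 * \<rho>)\<close> with \<open>\<bar>\<rho>\<bar> < 1\<close>, and let
  \<open>\<gamma> = \<alpha> + \<beta> + 1\<close>, \<open>\<kappa> = \<gamma> + m\<close>, \<open>y = (1 + x) / 2\<close>. A quadratic transformation of the Gauss
  function (\<open>gauss_series_quadratic_transformation\<close>) shows that for real \<open>x\<close> and large real \<open>z\<close>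
  the left-hand side is, up to a factor \<open>K * \<rho> powr (\<kappa> / 2)\<close> with a constant \<open>K\<close>, the function
  \<open>(1 + \<rho>) powr (- \<kappa>) * \<^sub>2F\<^sub>1(\<kappa> / 2, (\<kappa> + 1) / 2; \<beta> + 1; 4 * y * \<rho> / (1 + \<rho>)\<^sup>2)\<close>. Its Taylor
  coefficients in \<open>\<rho>\<close> are explicit polynomials in \<open>y\<close>, called \<open>jacobi_gf_coeff\<close> below. For \<open>m = 0\<close>
  they are multiples of the Jacobi polynomials (\<open>jacobi_P_eq_jacobi_gf_coeff\<close>), and this is a
  classical generating function.

  For general \<open>m\<close> they are finite combinations of those for \<open>m = 0\<close>
  (\<open>jacobi_gf_coeff_connection\<close>, which rests on a terminating well-poised hypergeometric sum).
  When the terms are collected by Jacobi polynomials, \<open>P\<^sub>n\<close> acquires the factor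
  \<open>\<rho> ^ n * \<^sub>2F\<^sub>1(m, \<gamma> + 2 * n + m; \<gamma> + 2 * n + 1; \<rho>)\<close> up to constants. By Pfaff's transformation
  this is a polynomial in \<open>\<rho> / (1 - \<rho>)\<close> divided by \<open>(1 - \<rho>) ^ m\<close>, namely the Legendre function
  on the right-hand side of the theorem (\<open>legendre_P_szego\<close>).

  Convergence rests on the growth of the Jacobi polynomials. On \<open>[-1, 1]\<close> the generating
  function with \<open>m = 0\<close> is holomorphic in the whole unit disc, because \<open>4 * y * \<rho> / (1 + \<rho>)\<^sup>2\<close>
  avoids the cut of the Gauss function; so the polynomials grow more slowly than every geometric
  sequence with quotient greater than \<open>1\<close>. The Bernstein-Walsh inequality extends this to
  \<open>x = (e + 1 / e) / 2\<close> with an additional factor \<open>\<bar>e\<bar> powr (- n)\<close>, and \<open>x\<close> lies inside the ellipse of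
  \<open>z\<close> if and only if \<open>\<bar>e\<bar> > \<bar>\<rho>\<bar>\<close> for the solution with \<open>\<bar>e\<bar> \<le> 1\<close>. Hence the series converges locally
  uniformly in \<open>x\<close> to a holomorphic function. For a fixed \<open>x\<close> in \<open>(-1, 1]\<close> it converges locally
  uniformly in \<open>z\<close> as well, and the identity theorem in \<open>z\<close> extends the equality from large real
  \<open>z\<close> to the slit plane (\<open>jacobi_gen_fun_eq_sum\<close>).

  The Gauss function must be continued to the plane cut along \<open>[1, \<infinity>)\<close> before any of its values
  there can be used. \<open>gauss_series_cut_plane\<close> does this without integral representations, by a
  power series in a conformal coordinate of the cut plane.
\<close>

section \<open>The hypergeometric equation for power series\<close>

abbreviation hyp_fps :: "complex \<Rightarrow> complex \<Rightarrow> complex \<Rightarrow> complex fps" where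
  "hyp_fps a b c \<equiv> fps_hypergeo [a, b] [c] 1"

lemma gauss_series_eq_eval_fps: "gauss_series a b c z = eval_fps (hyp_fps a b c) z"
  by (simp add: gauss_series_def eval_fps_def field_simps)

lemma plus_of_nat_neq_0:
  fixes c :: complex
  assumes "c \<notin> \<int>\<^sub>\<le>\<^sub>0"
  shows "c + of_nat n \<noteq> 0"
  using assms plus_of_nat_eq_0_imp by blast

lemma pochhammer_nonpos_Int_neq_0:
  fixes c :: complex
  assumes "c \<notin> \<int>\<^sub>\<le>\<^sub>0"
  shows "pochhammer c n \<noteq> 0"
  using assms by (auto simp: pochhammer_eq_0_iff)

lemma of_real_plus_one_notin_nonpos_Ints:
  assumes "\<beta> > -1"
  shows "complex_of_real \<beta> + 1 \<notin> \<int>\<^sub>\<le>\<^sub>0"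
  using assms by (auto simp: complex_nonpos_Reals_iff dest!: nonpos_Ints_subset_nonpos_Reals[THEN subsetD])

lemma tendsto_linear_quotient_1:
  "(\<lambda>n. (a + of_nat n) / (c + of_nat n) :: complex) \<longlonglongrightarrow> 1"
proof -
  have "(\<lambda>n. (a / of_nat n + 1) / (c / of_nat n + 1)) \<longlonglongrightarrow> (0 + 1) / (0 + 1 :: complex)"
    by (intro tendsto_intros lim_const_over_n) auto
  moreover have "\<forall>\<^sub>F n in sequentially. (a / of_nat n + 1) / (c / of_nat n + 1) = (a + of_nat n) / (c + of_nat n)"
    using eventually_gt_at_top[of 0]
  proof eventually_elim
    case (elim n)
    have "a / of_nat n + 1 = (a + of_nat n) / of_nat n" "c / of_nat n + 1 = (c + of_nat n) / of_nat n"
      using elim by (auto simp: field_simps)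
    then show ?case using elim by simp
  qed
  ultimately show ?thesis
    by (simp add: tendsto_cong)
qed

lemma hyp_fps_nth_Suc:
  "fps_nth (hyp_fps a b c) (Suc n) =
     (a + of_nat n) * (b + of_nat n) / ((c + of_nat n) * of_nat (Suc n)) * fps_nth (hyp_fps a b c) n"
  by (simp add: fps_hypergeo_rec mult_ac del: fps_hypergeo_nth of_nat_Suc)

text \<open>
  The hypothesis is a recurrence and not a limit of quotients of terms, so that sequences
  with zero terms, such as those of terminating series, are included.
\<close>
lemma two_term_recurrence_conv_radius:
  fixes f :: "nat \<Rightarrow> complex"
  assumes rec: "\<And>n. f (Suc n) = u n * f n" and u: "u \<longlonglongrightarrow> 1"
  shows "conv_radius f \<ge> 1"
proof (rule conv_radius_geI_ex')
  fix r :: real assume "0 < r" "ereal r < 1"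
  then have r: "0 < r" "r < 1" by simp_all
  have "(\<lambda>n. norm (u n) * r) \<longlonglongrightarrow> norm (1 :: complex) * r"
    by (intro tendsto_intros u)
  then have "\<forall>\<^sub>F n in sequentially. norm (u n) * r < (1 + r) / 2"
    by (rule order_tendstoD) (use r in auto)
  then obtain N where N: "\<And>n. n \<ge> N \<Longrightarrow> norm (u n) * r < (1 + r) / 2"
    by (auto simp: eventually_sequentially)
  show "summable (\<lambda>n. f n * of_real r ^ n)"
  proof (rule summable_ratio_test)
    show "(1 + r) / 2 < 1" using r by simp
  next
    fix n assume n: "N \<le> n"
    have "norm (f (Suc n) * of_real r ^ Suc n) = (norm (u n) * r) * norm (f n * of_real r ^ n)"
      using r by (simp add: rec norm_mult norm_power mult_ac)
    also have "\<dots> \<le> (1 + r) / 2 * norm (f n * of_real r ^ n)"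
      by (intro mult_right_mono less_imp_le[OF N[OF n]]) auto
    finally show "norm (f (Suc n) * of_real r ^ Suc n) \<le> \<dots>" .
  qed
qed

lemma hyp_fps_conv_radius: "fps_conv_radius (hyp_fps a b c) \<ge> 1"
  unfolding fps_conv_radius_def
proof (rule two_term_recurrence_conv_radius)
  show "fps_nth (hyp_fps a b c) (Suc n) =
     (a + of_nat n) * (b + of_nat n) / ((c + of_nat n) * of_nat (Suc n)) * fps_nth (hyp_fps a b c) n" for n
    by (rule hyp_fps_nth_Suc)
  have "(\<lambda>n. (a + of_nat n) / (c + of_nat n) * ((b + of_nat n) / (1 + of_nat n))) \<longlonglongrightarrow> 1 * 1"
    by (intro tendsto_mult tendsto_linear_quotient_1)
  then show "(\<lambda>n. (a + of_nat n) * (b + of_nat n) / ((c + of_nat n) * of_nat (Suc n))) \<longlonglongrightarrow> 1"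
    by simp
qed

text \<open>
  In the limit the recurrence reads \<open>g (n + 2) = g n\<close>, and its solutions are bounded. A
  perturbation that tends to zero can therefore only produce growth slower than \<open>q ^ n\<close> for
  every \<open>q > 1\<close>: once \<open>\<bar>u n\<bar> * q + \<bar>v n\<bar> < q\<^sup>2\<close>, a bound \<open>C * q ^ n\<close> on two consecutive terms
  propagates.
\<close>
lemma three_term_recurrence_conv_radius:
  fixes g :: "nat \<Rightarrow> complex"
  assumes rec: "\<And>n. g (Suc (Suc n)) = u n * g (Suc n) + v n * g n"
    and u: "u \<longlonglongrightarrow> 0" and v: "v \<longlonglongrightarrow> 1"
  shows "conv_radius g \<ge> 1"
proof (rule conv_radius_geI_ex')
  fix r :: real assume "0 < r" "ereal r < 1"
  then have r: "0 < r" "r < 1" by simp_all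
  define q where "q = 2 / (1 + r)"
  have q: "q > 1" "q * r < 1" using r by (auto simp: q_def field_simps)
  have "(\<lambda>n. norm (u n) * q + norm (v n)) \<longlonglongrightarrow> norm (0::complex) * q + norm (1::complex)"
    by (intro tendsto_intros u v)
  then have "\<forall>\<^sub>F n in sequentially. norm (u n) * q + norm (v n) < q\<^sup>2"
    by (rule order_tendstoD) (use q in \<open>auto simp: power2_eq_square intro: less_1_mult\<close>)
  then obtain N where N: "\<And>n. n \<ge> N \<Longrightarrow> norm (u n) * q + norm (v n) < q\<^sup>2"
    by (auto simp: eventually_sequentially)
  define C where "C = norm (g N) + norm (g (Suc N))"
  have bound: "norm (g (N + n)) \<le> C * q ^ n \<and> norm (g (N + Suc n)) \<le> C * q ^ Suc n" for n
  proof (induction n)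
    case 0
    have "norm (g (Suc N)) \<le> C * 1" by (simp add: C_def)
    also have "\<dots> \<le> C * q" by (rule mult_left_mono) (use q in \<open>auto simp: C_def\<close>)
    finally show ?case by (simp add: C_def)
  next
    case (Suc n)
    have "norm (g (N + Suc (Suc n))) \<le> norm (u (N + n)) * norm (g (N + Suc n)) + norm (v (N + n)) * norm (g (N + n))"
      using rec[of "N + n"] norm_triangle_ineq[of "u (N + n) * g (N + Suc n)" "v (N + n) * g (N + n)"]
      by (simp add: norm_mult)
    also have "\<dots> \<le> norm (u (N + n)) * (C * q ^ Suc n) + norm (v (N + n)) * (C * q ^ n)"
      by (intro add_mono mult_left_mono) (use Suc in auto)
    also have "\<dots> = (norm (u (N + n)) * q + norm (v (N + n))) * (C * q ^ n)"
      by (simp add: algebra_simps)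
    also have "\<dots> \<le> q\<^sup>2 * (C * q ^ n)"
      by (intro mult_right_mono less_imp_le[OF N]) (use q in \<open>auto simp: C_def\<close>)
    finally show ?case using Suc by (simp add: power2_eq_square mult_ac)
  qed
  have "summable (\<lambda>n. norm (g (n + N) * of_real r ^ (n + N)))"
  proof (rule summable_comparison_test)
    have "norm (g (n + N) * of_real r ^ (n + N)) \<le> C * r ^ N * (q * r) ^ n" for n
    proof -
      have "norm (g (n + N) * of_real r ^ (n + N)) = norm (g (N + n)) * r ^ (n + N)"
        using r by (simp add: norm_mult norm_power add.commute)
      also have "\<dots> \<le> (C * q ^ n) * r ^ (n + N)"
        by (intro mult_right_mono) (use bound r in auto)
      finally show ?thesis by (simp add: power_add power_mult_distrib mult_ac)
    qed
    then show "\<exists>M. \<forall>n\<ge>M. norm (norm (g (n + N) * of_real r ^ (n + N))) \<le> C * r ^ N * (q * r) ^ n"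
      by auto
    show "summable (\<lambda>n. C * r ^ N * (q * r) ^ n)"
      by (intro summable_mult summable_geometric) (use q r in auto)
  qed
  then have "summable (\<lambda>n. g (n + N) * of_real r ^ (n + N))"
    by (rule summable_norm_cancel)
  then show "summable (\<lambda>n. g n * of_real r ^ n)"
    by (subst (asm) summable_iff_shift)
qed

lemma hyp_fps_ode:
  assumes "c \<notin> \<int>\<^sub>\<le>\<^sub>0"
  shows "fps_X * (1 - fps_X) * fps_deriv (fps_deriv (hyp_fps a b c)) +
    (fps_const c - fps_const (a + b + 1) * fps_X) * fps_deriv (hyp_fps a b c) +
    fps_const (- (a * b)) * hyp_fps a b c = 0"
proof -
  define F where "F = hyp_fps a b c"
  have rec: "of_nat (Suc n) * (c + of_nat n) * fps_nth F (Suc n) = (a + of_nat n) * (b + of_nat n) * fps_nth F n" for n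
    unfolding F_def hyp_fps_nth_Suc using plus_of_nat_neq_0[OF assms, of n] by (simp del: of_nat_Suc)
  have "fps_X * (fps_deriv (fps_deriv F) - fps_X * fps_deriv (fps_deriv F) - fps_const (a + b + 1) * fps_deriv F)
    + fps_const c * fps_deriv F + fps_const (- (a * b)) * F = 0" (is "?L = 0")
  proof (rule fps_ext)
    fix n show "fps_nth ?L n = fps_nth 0 n"
    proof (cases n)
      case 0
      then show ?thesis using rec[of 0] by (simp add: algebra_simps)
    next
      case (Suc k)
      show ?thesis using rec[of n] unfolding Suc
        by (cases k) (simp_all add: algebra_simps)
    qed
  qed
  then show ?thesis unfolding F_def[symmetric] by (simp add: algebra_simps)
qed

text \<open>
  The origin is a regular singular point with exponents \<open>0\<close> and \<open>1 - c\<close>, so a power series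
  solution of the hypergeometric equation is determined by its constant term. This reduces
  the transformation formulas below to the verification of a differential equation.
\<close>
lemma hyp_fps_unique:
  assumes "c \<notin> \<int>\<^sub>\<le>\<^sub>0"
    and ode: "fps_X * (1 - fps_X) * fps_deriv (fps_deriv F) +
    (fps_const c - fps_const (a + b + 1) * fps_X) * fps_deriv F + fps_const (- (a * b)) * F = 0"
  shows "F = fps_const (fps_nth F 0) * hyp_fps a b c"
proof -
  have "fps_X * (fps_deriv (fps_deriv F) - fps_X * fps_deriv (fps_deriv F) - fps_const (a + b + 1) * fps_deriv F)
    + fps_const c * fps_deriv F + fps_const (- (a * b)) * F = 0" (is "?L = 0")
    using ode by (simp add: algebra_simps)
  then have L: "fps_nth ?L n = 0" for n by simp
  have rec: "of_nat (Suc n) * (c + of_nat n) * fps_nth F (Suc n) = (a + of_nat n) * (b + of_nat n) * fps_nth F n" for n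
  proof (cases n)
    case 0
    then show ?thesis using L[of 0] by (simp add: algebra_simps)
  next
    case (Suc k)
    show ?thesis using L[of n] unfolding Suc
      by (cases k) (simp_all add: algebra_simps)
  qed
  have "fps_nth F n = fps_nth F 0 * fps_nth (hyp_fps a b c) n" for n
  proof (induction n)
    case (Suc n)
    have "(c + of_nat n) * of_nat (Suc n) \<noteq> 0"
      using plus_of_nat_neq_0[OF assms(1), of n] by (simp del: of_nat_Suc)
    then show ?case
      using rec[of n] unfolding hyp_fps_nth_Suc Suc.IH by (simp add: field_simps del: fps_hypergeo_nth of_nat_Suc)
  qed (simp)
  then have "fps_nth F n = fps_nth (fps_const (fps_nth F 0) * hyp_fps a b c) n" for n
    unfolding fps_mult_left_const_nth .
  then show ?thesis by (rule fps_ext)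
qed

text \<open>
  Here \<open>F0\<close>, \<open>F1\<close>, \<open>F2\<close> stand for the values at \<open>z\<close> of a function and its first two
  derivatives, and \<open>e\<close> for the logarithmic derivative of \<open>E\<close>. The last three hypotheses say
  that the coefficients of \<open>F2\<close>, \<open>F1\<close>, \<open>F0\<close> in the transformed operator are \<open>E * M\<close> times
  those of the hypergeometric operator.
\<close>
lemma hypergeometric_ode_transform:
  fixes z :: complex
  assumes "z * (1 - z) * F2 + (c - (a + b + 1) * z) * F1 + - (a * b) * F0 = 0"
    and "P * z1\<^sup>2 = M * (z * (1 - z))"
    and "P * (2 * e * z1 + z2) + Q * z1 = M * (c - (a + b + 1) * z)"
    and "P * (e\<^sup>2 + e1) + Q * e + R = - M * (a * b)"
  shows "P * (E * ((e\<^sup>2 + e1) * F0 + (2 * e * z1 + z2) * F1 + z1\<^sup>2 * F2)) +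
         Q * (E * (e * F0 + z1 * F1)) + R * (E * F0) = 0"
proof -
  have "P * (E * ((e\<^sup>2 + e1) * F0 + (2 * e * z1 + z2) * F1 + z1\<^sup>2 * F2)) +
         Q * (E * (e * F0 + z1 * F1)) + R * (E * F0) =
     E * ((P * (e\<^sup>2 + e1) + Q * e + R) * F0 + (P * (2 * e * z1 + z2) + Q * z1) * F1 + (P * z1\<^sup>2) * F2)"
    by (simp add: algebra_simps)
  also have "\<dots> = E * M * (z * (1 - z) * F2 + (c - (a + b + 1) * z) * F1 + - (a * b) * F0)"
    unfolding assms(2-4) by (simp add: algebra_simps)
  finally show ?thesis by (simp only: assms(1) mult_zero_right)
qed

lemma eval_hyp_fps_ode:
  assumes "c \<notin> \<int>\<^sub>\<le>\<^sub>0" "norm z < fps_conv_radius (hyp_fps a b c)"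
  shows "z * (1 - z) * eval_fps (fps_deriv (fps_deriv (hyp_fps a b c))) z +
    (c - (a + b + 1) * z) * eval_fps (fps_deriv (hyp_fps a b c)) z +
    - (a * b) * eval_fps (hyp_fps a b c) z = 0"
proof -
  define F where "F = hyp_fps a b c"
  have rad: "fps_conv_radius F \<le> fps_conv_radius (fps_deriv F)" "fps_conv_radius F \<le> fps_conv_radius (fps_deriv (fps_deriv F))"
    using fps_conv_radius_deriv order.trans by blast+
  let ?L = "\<lambda>z. z * (1 - z) * eval_fps (fps_deriv (fps_deriv F)) z + (c - (a + b + 1) * z) * eval_fps (fps_deriv F) z + - (a * b) * eval_fps F z"
  have pos: "fps_conv_radius F > 0" using hyp_fps_conv_radius[of a b c] by (simp add: F_def less_le_trans[of _ "1::ereal"])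
  show ?thesis unfolding F_def[symmetric]
  proof (rule has_fps_expansion_0_analytic_continuation[of ?L])
    have "?L has_fps_expansion (fps_X * (1 - fps_X) * fps_deriv (fps_deriv F) +
      (fps_const c - fps_const (a + b + 1) * fps_X) * fps_deriv F + fps_const (- (a * b)) * F)"
      by (intro fps_expansion_intros eval_fps_has_fps_expansion) (use pos rad in auto)
    then show "?L has_fps_expansion 0"
      unfolding F_def using hyp_fps_ode[OF assms(1)] by simp
    show "?L holomorphic_on eball 0 (fps_conv_radius F)"
      by (intro holomorphic_intros eball_mono rad order.refl)
  qed (use assms(2) pos in \<open>auto simp: F_def in_eball_iff zero_ereal_def\<close>)
qed

lemma has_fps_expansion_derivatives:
  fixes f f1 f2 :: "complex \<Rightarrow> complex"
  assumes "open S" "0 \<in> S"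
    and "\<And>x. x \<in> S \<Longrightarrow> (f has_field_derivative f1 x) (at x)"
    and "\<And>x. x \<in> S \<Longrightarrow> (f1 has_field_derivative f2 x) (at x)"
  obtains F where "f has_fps_expansion F" "f1 has_fps_expansion fps_deriv F" "f2 has_fps_expansion fps_deriv (fps_deriv F)"
proof -
  have ev: "eventually (\<lambda>x. x \<in> S) (nhds 0)"
    using assms by (intro eventually_nhds_in_open) auto
  have "f holomorphic_on S" using assms(3) assms(1)
    using holomorphic_on_open by blast
  then have f: "f has_fps_expansion fps_expansion f 0" (is "_ has_fps_expansion ?F")
    using assms by (intro has_fps_expansion_fps_expansion) auto
  have "deriv f has_fps_expansion fps_deriv ?F" by (rule has_fps_expansion_deriv[OF f])
  moreover have "eventually (\<lambda>x. deriv f x = f1 x) (nhds 0)"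
    using ev by eventually_elim (auto intro: DERIV_imp_deriv assms)
  ultimately have f1: "f1 has_fps_expansion fps_deriv ?F" by (simp add: has_fps_expansion_cong)
  have "deriv f1 has_fps_expansion fps_deriv (fps_deriv ?F)" by (rule has_fps_expansion_deriv[OF f1])
  moreover have "eventually (\<lambda>x. deriv f1 x = f2 x) (nhds 0)"
    using ev by eventually_elim (auto intro: DERIV_imp_deriv assms)
  ultimately have "f2 has_fps_expansion fps_deriv (fps_deriv ?F)" by (simp add: has_fps_expansion_cong)
  with f f1 show ?thesis using that by blast
qed

text \<open>
  A change of variable \<open>Z\<close> and a prefactor \<open>E\<close> turn the hypergeometric equation into
  \<open>P h'' + Q h' + R h = 0\<close>. The conclusion is about formal power series because it is used to
  read off recurrences of Taylor coefficients.
\<close>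
lemma hyp_substitution_ode:
  fixes E e e' Z Z' Z'' P Q R M :: "complex \<Rightarrow> complex"
  assumes c: "c \<notin> \<int>\<^sub>\<le>\<^sub>0" and S: "open S" "0 \<in> S"
    and E: "\<And>x. x \<in> S \<Longrightarrow> (E has_field_derivative E x * e x) (at x)"
    and e: "\<And>x. x \<in> S \<Longrightarrow> (e has_field_derivative e' x) (at x)"
    and Z: "\<And>x. x \<in> S \<Longrightarrow> (Z has_field_derivative Z' x) (at x)"
    and Z': "\<And>x. x \<in> S \<Longrightarrow> (Z' has_field_derivative Z'' x) (at x)"
    and norm_Z: "\<And>x. x \<in> S \<Longrightarrow> norm (Z x) < fps_conv_radius (hyp_fps a b c)"
    and PQR: "\<And>x. x \<in> S \<Longrightarrow> P x * (Z' x)\<^sup>2 = M x * (Z x * (1 - Z x))"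
      "\<And>x. x \<in> S \<Longrightarrow> P x * (2 * e x * Z' x + Z'' x) + Q x * Z' x = M x * (c - (a + b + 1) * Z x)"
      "\<And>x. x \<in> S \<Longrightarrow> P x * ((e x)\<^sup>2 + e' x) + Q x * e x + R x = - M x * (a * b)"
    and PF: "P has_fps_expansion PF" "Q has_fps_expansion QF" "R has_fps_expansion RF"
  obtains H where "(\<lambda>x. E x * gauss_series a b c (Z x)) has_fps_expansion H"
    "PF * fps_deriv (fps_deriv H) + QF * fps_deriv H + RF * H = 0"
proof -
  define F where "F = hyp_fps a b c"
  define F0 where "F0 = eval_fps F"
  define F1 where "F1 = eval_fps (fps_deriv F)"
  define F2 where "F2 = eval_fps (fps_deriv (fps_deriv F))"
  have rad: "norm (Z x) < fps_conv_radius F" "norm (Z x) < fps_conv_radius (fps_deriv F)" if "x \<in> S" for x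
    using norm_Z[OF that] fps_conv_radius_deriv less_le_trans unfolding F_def by blast+
  have F0: "((\<lambda>x. F0 (Z x)) has_field_derivative F1 (Z x) * Z' x) (at x)" if "x \<in> S" for x
    unfolding F0_def F1_def by (rule DERIV_chain2[OF has_field_derivative_eval_fps Z]) (use rad that in auto)
  have F1: "((\<lambda>x. F1 (Z x)) has_field_derivative F2 (Z x) * Z' x) (at x)" if "x \<in> S" for x
    unfolding F2_def F1_def by (rule DERIV_chain2[OF has_field_derivative_eval_fps Z]) (use rad that in auto)
  define h where "h = (\<lambda>x. E x * F0 (Z x))"
  define h1 where "h1 = (\<lambda>x. E x * (e x * F0 (Z x) + Z' x * F1 (Z x)))"
  define h2 where "h2 = (\<lambda>x. E x * (((e x)\<^sup>2 + e' x) * F0 (Z x) + (2 * e x * Z' x + Z'' x) * F1 (Z x) + (Z' x)\<^sup>2 * F2 (Z x)))"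
  have "(h has_field_derivative h1 x) (at x)" if "x \<in> S" for x
    unfolding h_def by (rule derivative_eq_intros E e F0 Z' F1 that refl)+ (simp add: h1_def algebra_simps)
  moreover have "(h1 has_field_derivative h2 x) (at x)" if "x \<in> S" for x
    unfolding h1_def
    by (rule derivative_eq_intros E e F0 Z' F1 that refl)+ (simp add: h2_def algebra_simps power2_eq_square)
  ultimately obtain H where H: "h has_fps_expansion H" "h1 has_fps_expansion fps_deriv H" "h2 has_fps_expansion fps_deriv (fps_deriv H)"
    using has_fps_expansion_derivatives[OF S] by blast
  have ode: "P x * h2 x + Q x * h1 x + R x * h x = 0" if "x \<in> S" for x
    unfolding h_def h1_def h2_def
  proof (rule hypergeometric_ode_transform[OF _ PQR[OF that]])
    show "Z x * (1 - Z x) * F2 (Z x) + (c - (a + b + 1) * Z x) * F1 (Z x) + - (a * b) * F0 (Z x) = 0"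
      unfolding F0_def F1_def F2_def F_def by (rule eval_hyp_fps_ode[OF c norm_Z[OF that]])
  qed
  have "eventually (\<lambda>x. x \<in> S) (nhds 0)"
    using S by (intro eventually_nhds_in_open) auto
  then have ev: "eventually (\<lambda>x. P x * h2 x + Q x * h1 x + R x * h x = 0) (nhds 0)"
    by eventually_elim (rule ode)
  have "(\<lambda>x. P x * h2 x + Q x * h1 x + R x * h x) has_fps_expansion PF * fps_deriv (fps_deriv H) + QF * fps_deriv H + RF * H"
    by (intro fps_expansion_intros H PF)
  moreover have "(\<lambda>x. P x * h2 x + Q x * h1 x + R x * h x) has_fps_expansion 0"
    using ev by (simp add: has_fps_expansion_0_iff)
  ultimately have "PF * fps_deriv (fps_deriv H) + QF * fps_deriv H + RF * H = 0"
    by (rule fps_expansion_unique_complex)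
  with H(1) show ?thesis
    using that unfolding h_def F0_def F_def gauss_series_eq_eval_fps by blast
qed

section \<open>Continuation of the Gauss series to the cut plane\<close>

lemma eventually_eq_imp_eq_on_ball:
  fixes f g :: "complex \<Rightarrow> complex"
  assumes "f holomorphic_on ball 0 r" "g holomorphic_on ball 0 r"
    and ev: "eventually (\<lambda>z. f z = g z) (nhds 0)" and z: "z \<in> ball 0 r"
  shows "f z = g z"
proof -
  from z have r: "r > 0" using ball_eq_empty[of 0 r] by (metis empty_iff not_le)
  obtain T where T: "open T" "0 \<in> T" "\<And>z. z \<in> T \<Longrightarrow> f z = g z"
    using ev unfolding eventually_nhds by blast
  show ?thesis
    by (rule analytic_continuation_open[of "T \<inter> ball 0 r" "ball 0 r"]) (use T r z assms in auto)
qed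

lemma gauss_series_holomorphic_on: "gauss_series a b c holomorphic_on ball 0 1"
proof -
  have "ball 0 1 \<subseteq> eball 0 (fps_conv_radius (hyp_fps a b c))"
    using ball_eball_mono[of 1 "fps_conv_radius (hyp_fps a b c)" 0] hyp_fps_conv_radius[of a b c] by (simp add: one_ereal_def)
  then have "eval_fps (hyp_fps a b c) holomorphic_on ball 0 1"
    by (intro holomorphic_intros)
  then show ?thesis by (simp add: gauss_series_eq_eval_fps[abs_def])
qed

lemma norm_less_hyp_fps_conv_radius:
  assumes "norm (z::complex) < 1"
  shows "norm z < fps_conv_radius (hyp_fps a b c)"
proof -
  have "ereal (norm z) < 1" using assms by simp
  also have "1 \<le> fps_conv_radius (hyp_fps a b c)" by (rule hyp_fps_conv_radius)
  finally show ?thesis .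
qed

lemma Re_csqrt_pos:
  assumes "w \<notin> \<real>\<^sub>\<le>\<^sub>0"
  shows "Re (csqrt w) > 0"
proof (rule ccontr)
  assume "\<not> ?thesis"
  moreover have "Re (csqrt w) \<ge> 0" using csqrt_principal[of w] by auto
  ultimately have "Re (csqrt w) = 0" by simp
  then have "Re ((csqrt w)\<^sup>2) \<le> 0" "Im ((csqrt w)\<^sup>2) = 0"
    by (simp_all add: power2_eq_square)
  with assms show False by (simp add: complex_nonpos_Reals_iff)
qed

lemma cut_plane_csqrt:
  assumes "z \<notin> complex_of_real ` {1..}"
  shows "1 - z \<notin> \<real>\<^sub>\<le>\<^sub>0" "Re (csqrt (1 - z)) > 0"
proof -
  show *: "1 - z \<notin> \<real>\<^sub>\<le>\<^sub>0"
  proof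
    assume "1 - z \<in> \<real>\<^sub>\<le>\<^sub>0"
    then obtain x where "1 - z = of_real x" "x \<le> 0" by (auto elim: nonpos_Reals_cases)
    then have "z = of_real (1 - x)" "1 - x \<in> {1..}" by (auto simp: algebra_simps)
    with assms show False by blast
  qed
  then show "Re (csqrt (1 - z)) > 0" by (rule Re_csqrt_pos)
qed

lemma norm_cayley_less_1:
  assumes "Re q > 0"
  shows "norm ((1 - q) / (1 + q)) < 1"
proof -
  have "(norm (1 - q))\<^sup>2 < (norm (1 + q))\<^sup>2"
    using assms unfolding cmod_power2 by (simp add: power2_eq_square algebra_simps)
  then have "norm (1 - q) < norm (1 + q)" by (rule power_less_imp_less_base) simp
  then show ?thesis
    by (simp add: norm_divide divide_less_eq)
qed

lemma one_plus_neq_0: "norm s < 1 \<Longrightarrow> 1 + s \<noteq> (0::complex)"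
  by (metis add.commute add_eq_0_iff norm_minus_cancel norm_one order.irrefl)

lemma one_plus_nonpos_Reals: "norm (s::complex) < 1 \<Longrightarrow> 1 + s \<notin> \<real>\<^sub>\<le>\<^sub>0"
  using abs_Re_le_cmod[of s] by (auto simp: complex_nonpos_Reals_iff)

text \<open>
  The map \<open>s \<mapsto> 4 * s / (1 + s)\<^sup>2\<close> sends the unit disc conformally onto the plane cut along
  \<open>[1, \<infinity>)\<close>, and the points \<open>0\<close>, \<open>1\<close>, \<open>\<infinity>\<close> correspond to \<open>s = 0\<close>, \<open>1\<close>, \<open>-1\<close>. Hence the
  Gauss series, written as a function of \<open>s\<close>, satisfies an equation without singularities
  in the open disc except at \<open>0\<close>. The factor \<open>(1 + s) powr (- 2 * a)\<close> removes the exponent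
  \<open>a\<close> at infinity; this lowers the recurrence of the Taylor coefficients to three terms of the
  kind covered by \<open>three_term_recurrence_conv_radius\<close>. So their series converges in the whole
  disc, and going back to \<open>z\<close> with \<open>s = (1 - sqrt (1 - z)) / (1 + sqrt (1 - z))\<close> gives the
  continuation.
\<close>
lemma gauss_series_cut_plane:
  assumes c: "c \<notin> \<int>\<^sub>\<le>\<^sub>0"
  shows "\<exists>f. f holomorphic_on (- (complex_of_real ` {1..})) \<and> (\<forall>w\<in>ball 0 1. f w = gauss_series a b c w)"
proof -
  define S where "S = ball (0::complex) (1/10)"
  have S: "open S" "0 \<in> S" by (auto simp: S_def)
  define h where "h = (\<lambda>s. (1 + s) powr (- 2 * a) * gauss_series a b c (4 * s * (inverse (1 + s) * inverse (1 + s))))"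
  define PF where "PF = fps_X * (1 - fps_X * fps_X :: complex fps)"
  define QF where "QF = fps_const c + fps_const (2*c - 4*b) * fps_X + fps_const (c - 2 - 4*a) * fps_X * fps_X"
  define RF where "RF = fps_const (2*a*(c - 2*b)) + fps_const (2*a*(c - 1 - 2*a)) * fps_X"
  obtain H where H: "h has_fps_expansion H" "PF * fps_deriv (fps_deriv H) + QF * fps_deriv H + RF * H = 0"
    unfolding h_def
  proof (rule hyp_substitution_ode[OF c S, where E = "\<lambda>s. (1 + s) powr (- 2 * a)" and e = "\<lambda>s. - 2 * a * inverse (1 + s)" and
        e' = "\<lambda>s. 2 * a * (inverse (1 + s) * inverse (1 + s))" and Z = "\<lambda>s. 4 * s * (inverse (1 + s) * inverse (1 + s))"
        and Z' = "\<lambda>s. 4 * (1 - s) * (inverse (1 + s) * inverse (1 + s) * inverse (1 + s))"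
        and Z'' = "\<lambda>s. 8 * (s - 2) * (inverse (1 + s) * inverse (1 + s) * inverse (1 + s) * inverse (1 + s))"
        and M = "\<lambda>s. 4 * (1 - s) * inverse (1 + s)"
        and P = "\<lambda>s. s * (1 - s * s)" and Q = "\<lambda>s. c + (2*c - 4*b) * s + (c - 2 - 4*a) * s * s"
        and R = "\<lambda>s. 2*a*(c - 2*b) + 2*a*(c - 1 - 2*a) * s"
        and PF = PF and QF = QF and RF = RF and a = a and b = b])
    fix s assume "s \<in> S"
    then have s: "norm s < 1/10" by (simp add: S_def)
    have nz: "1 + s \<noteq> 0" by (rule one_plus_neq_0) (use s in simp)
    have np: "1 + s \<notin> \<real>\<^sub>\<le>\<^sub>0" by (rule one_plus_nonpos_Reals) (use s in simp)
    define i where "i = inverse (1 + s)"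
    have i: "i * (1 + s) = 1" using nz by (simp add: i_def)
    have "((\<lambda>s. inverse (1 + s)) has_field_derivative - (inverse (1 + s) * (0 + 1) * inverse (1 + s))) (at s)"
      by (intro derivative_intros nz)
    then have di: "((\<lambda>s. inverse (1 + s)) has_field_derivative - (i * i)) (at s)"
      by (simp add: i_def)
    show "((\<lambda>s. (1 + s) powr (- 2 * a)) has_field_derivative (1 + s) powr (- 2 * a) * (- 2 * a * inverse (1 + s))) (at s)"
      using np nz by (auto intro!: derivative_eq_intros simp: powr_diff divide_inverse)
    show "((\<lambda>s. - 2 * a * inverse (1 + s)) has_field_derivative 2 * a * (inverse (1 + s) * inverse (1 + s))) (at s)"
      by (rule DERIV_cong, (rule derivative_intros di)+) (simp add: i_def)
    have "((\<lambda>s. 4 * s * (inverse (1 + s) * inverse (1 + s))) has_field_derivative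
        4 * 1 * (i * i) + (- (i * i) * i + - (i * i) * i) * (4 * s)) (at s)"
      by (rule DERIV_mult[OF DERIV_cmult[OF DERIV_ident] DERIV_mult[OF di di], folded i_def])
    moreover have "4 * 1 * (i * i) + (- (i * i) * i + - (i * i) * i) * (4 * s) = 4 * (1 - s) * (i * i * i)"
      using i by algebra
    ultimately show "((\<lambda>s. 4 * s * (inverse (1 + s) * inverse (1 + s))) has_field_derivative
        4 * (1 - s) * (inverse (1 + s) * inverse (1 + s) * inverse (1 + s))) (at s)"
      by (simp only: i_def)
    have "((\<lambda>s. 4 * (1 - s) * (inverse (1 + s) * inverse (1 + s) * inverse (1 + s))) has_field_derivative
        4 * (0 - 1) * (i * i * i) + ((- (i * i) * i + - (i * i) * i) * i + - (i * i) * (i * i)) * (4 * (1 - s))) (at s)"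
      by (rule DERIV_mult[OF DERIV_cmult[OF DERIV_diff[OF DERIV_const DERIV_ident]] DERIV_mult[OF DERIV_mult[OF di di] di], folded i_def])
    moreover have "4 * (0 - 1) * (i * i * i) + ((- (i * i) * i + - (i * i) * i) * i + - (i * i) * (i * i)) * (4 * (1 - s)) = 8 * (s - 2) * (i * i * i * i)"
      using i by algebra
    ultimately show "((\<lambda>s. 4 * (1 - s) * (inverse (1 + s) * inverse (1 + s) * inverse (1 + s))) has_field_derivative
        8 * (s - 2) * (inverse (1 + s) * inverse (1 + s) * inverse (1 + s) * inverse (1 + s))) (at s)"
      by (simp only: i_def)
    have "norm (4 * s * (inverse (1 + s) * inverse (1 + s))) \<le> (4/10) * (inverse (9/10) * inverse (9/10))"
    proof -
      have "9/10 \<le> norm (1 + s)" using norm_diff_ineq[of 1 s] s by simp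
      then have "inverse (norm (1 + s)) \<le> inverse (9/10)" by (rule le_imp_inverse_le) simp
      then show ?thesis unfolding norm_mult norm_inverse
        using s by (intro mult_mono) auto
    qed
    then show "norm (4 * s * (inverse (1 + s) * inverse (1 + s))) < fps_conv_radius (hyp_fps a b c)"
      by (intro norm_less_hyp_fps_conv_radius) simp
    show "s * (1 - s * s) * (4 * (1 - s) * (inverse (1 + s) * inverse (1 + s) * inverse (1 + s)))\<^sup>2 =
        4 * (1 - s) * inverse (1 + s) * (4 * s * (inverse (1 + s) * inverse (1 + s)) * (1 - 4 * s * (inverse (1 + s) * inverse (1 + s))))"
      using i unfolding i_def[symmetric] by algebra
    show "s * (1 - s * s) * (2 * (- 2 * a * inverse (1 + s)) * (4 * (1 - s) * (inverse (1 + s) * inverse (1 + s) * inverse (1 + s))) +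
            8 * (s - 2) * (inverse (1 + s) * inverse (1 + s) * inverse (1 + s) * inverse (1 + s))) +
         (c + (2*c - 4*b) * s + (c - 2 - 4*a) * s * s) * (4 * (1 - s) * (inverse (1 + s) * inverse (1 + s) * inverse (1 + s))) =
         4 * (1 - s) * inverse (1 + s) * (c - (a + b + 1) * (4 * s * (inverse (1 + s) * inverse (1 + s))))"
      using i unfolding i_def[symmetric] by algebra
    show "s * (1 - s * s) * ((- 2 * a * inverse (1 + s))\<^sup>2 + 2 * a * (inverse (1 + s) * inverse (1 + s))) +
         (c + (2*c - 4*b) * s + (c - 2 - 4*a) * s * s) * (- 2 * a * inverse (1 + s)) +
         (2*a*(c - 2*b) + 2*a*(c - 1 - 2*a) * s) = - (4 * (1 - s) * inverse (1 + s)) * (a * b)"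
      using i unfolding i_def[symmetric] by algebra
  next
    show "(\<lambda>s. s * (1 - s * s)) has_fps_expansion PF" unfolding PF_def by (intro fps_expansion_intros)
    show "(\<lambda>s. c + (2*c - 4*b) * s + (c - 2 - 4*a) * s * s) has_fps_expansion QF" unfolding QF_def by (intro fps_expansion_intros)
    show "(\<lambda>s. 2*a*(c - 2*b) + 2*a*(c - 1 - 2*a) * s) has_fps_expansion RF" unfolding RF_def by (intro fps_expansion_intros)
  qed blast
  define g where "g = fps_nth H"
  define u where "u n = - 2 * (c - 2 * b) * ((a + 1 + of_nat n) / (c + 1 + of_nat n)) * inverse (2 + of_nat n)" for n
  define v where "v n = ((2*a + of_nat n) / (c + 1 + of_nat n)) * ((2*a + 1 - c + of_nat n) / (2 + of_nat n))" for n
  have rec: "g (Suc (Suc n)) = u n * g (Suc n) + v n * g n" for n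
  proof -
    have X: "fps_X * (fps_deriv (fps_deriv H) - fps_X * (fps_X * fps_deriv (fps_deriv H)) + fps_const (2*c - 4*b) * fps_deriv H
        + fps_const (c - 2 - 4*a) * (fps_X * fps_deriv H) + fps_const (2*a*(c - 1 - 2*a)) * H) + fps_const c * fps_deriv H + fps_const (2*a*(c - 2*b)) * H = 0"
      (is "?L = 0")
      using H(2) unfolding PF_def QF_def RF_def by (simp add: algebra_simps)
    have "fps_nth ?L (Suc n) = 0" by (simp only: X fps_zero_nth)
    then have "(2 + of_nat n) * (c + 1 + of_nat n) * g (Suc (Suc n)) =
        - 2 * (c - 2 * b) * (a + 1 + of_nat n) * g (Suc n) + (2*a + of_nat n) * (2*a + 1 - c + of_nat n) * g n"
      (is "_ = ?X + ?Y")
      unfolding g_def by (cases n; cases "n - 1") (simp_all add: algebra_simps)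
    moreover have "c + 1 + of_nat n \<noteq> 0" using plus_of_nat_neq_0[OF c, of "Suc n"] by (simp add: algebra_simps)
    moreover have "2 + of_nat n \<noteq> (0::complex)" by (metis of_nat_numeral of_nat_add of_nat_eq_0_iff add_is_0 zero_neq_numeral)
    ultimately have "g (Suc (Suc n)) = (?X + ?Y) / ((c + 1 + of_nat n) * (2 + of_nat n))"
      by (simp add: eq_divide_eq mult_ac)
    also have "\<dots> = u n * g (Suc n) + v n * g n"
    proof -
      have "(x * x' * g' + y * y' * g'') / (p * q) = x * (x' / p) * inverse q * g' + (y / p) * (y' / q) * g''"
        for x x' y y' p q g' g'' :: complex by (simp add: divide_inverse ring_distribs mult_ac)
      then show ?thesis unfolding u_def v_def .
    qed
    finally show ?thesis .
  qed
  have "u \<longlonglongrightarrow> - 2 * (c - 2 * b) * 1 * 0"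
    unfolding u_def
  proof (intro tendsto_mult tendsto_const tendsto_linear_quotient_1)
    have "filterlim (\<lambda>n. 2 + of_nat n :: complex) at_infinity sequentially"
      by (rule tendsto_add_filterlim_at_infinity[OF tendsto_const tendsto_of_nat])
    then show "(\<lambda>n. inverse (2 + of_nat n) :: complex) \<longlonglongrightarrow> 0"
      by (rule filterlim_compose[OF tendsto_inverse_0])
  qed
  moreover have "v \<longlonglongrightarrow> 1 * 1"
    unfolding v_def by (intro tendsto_mult tendsto_linear_quotient_1)
  ultimately have "conv_radius g \<ge> 1"
    by (intro three_term_recurrence_conv_radius[of g u v, OF rec]) auto
  then have rad: "fps_conv_radius H \<ge> 1"
    by (simp add: fps_conv_radius_def g_def)
  have eball: "ball 0 1 \<subseteq> eball 0 (fps_conv_radius H)"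
    using ball_eball_mono[of 1 "fps_conv_radius H" 0] rad by (simp add: one_ereal_def)
  define s where "s z = (1 - csqrt (1 - z)) / (1 + csqrt (1 - z))" for z
  define f where "f z = (1 + s z) powr (2 * a) * eval_fps H (s z)" for z
  let ?D = "- (complex_of_real ` {1..})"
  have s1: "norm (s z) < 1" if "z \<in> ?D" for z
    unfolding s_def by (rule norm_cayley_less_1) (use cut_plane_csqrt that in auto)
  have q0: "1 + csqrt (1 - z) \<noteq> 0" if "z \<in> ?D" for z
  proof
    assume "1 + csqrt (1 - z) = 0"
    then have "csqrt (1 - z) = - 1" by (simp add: add_eq_0_iff)
    with cut_plane_csqrt(2)[of z] that show False by (simp del: csqrt.sel)
  qed
  have s_holo: "s holomorphic_on ?D"
    unfolding s_def by (intro holomorphic_intros) (use q0 cut_plane_csqrt in auto)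
  have "eval_fps H holomorphic_on ball 0 1"
    using eball by (intro holomorphic_intros)
  then have "(eval_fps H \<circ> s) holomorphic_on ?D"
    by (rule holomorphic_on_compose_gen[OF s_holo]) (use s1 in auto)
  then have f_holo: "f holomorphic_on ?D"
    unfolding f_def o_def
    by (intro holomorphic_intros s_holo) (use s1 one_plus_nonpos_Reals in auto)
  have sub: "ball 0 1 \<subseteq> ?D" by auto
  have sz: "4 * s z * (inverse (1 + s z) * inverse (1 + s z)) = z" if "z \<in> ?D" for z
  proof -
    define q where "q = csqrt (1 - z)"
    have q: "1 + q \<noteq> 0" "z = 1 - q\<^sup>2" using q0[OF that] by (auto simp: q_def)
    have "1 + s z = 2 / (1 + q)" using q(1) unfolding s_def q_def[symmetric] by (simp add: add_divide_eq_iff)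
    then have "4 * s z * (inverse (1 + s z) * inverse (1 + s z)) = s z * (1 + q)\<^sup>2"
      by (simp add: power2_eq_square)
    also have "\<dots> = (1 - q) * (1 + q)" using q(1) unfolding s_def q_def[symmetric] by (simp add: power2_eq_square)
    also have "\<dots> = z" unfolding q(2) by (simp add: power2_eq_square algebra_simps)
    finally show ?thesis .
  qed
  have "\<forall>w\<in>ball 0 1. f w = gauss_series a b c w"
  proof
    fix w :: complex assume "w \<in> ball 0 1"
    then show "f w = gauss_series a b c w"
    proof (rule eventually_eq_imp_eq_on_ball[rotated 3])
      show "f holomorphic_on ball 0 1" by (rule holomorphic_on_subset[OF f_holo sub])
      show "gauss_series a b c holomorphic_on ball 0 1" by (rule gauss_series_holomorphic_on)
      have "isCont s 0"
        using s_holo sub by (intro continuous_on_interior[OF holomorphic_on_imp_continuous_on[OF holomorphic_on_subset[OF s_holo sub]]]) auto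
      then have "(s \<longlongrightarrow> s 0) (nhds 0)" using continuous_at tendsto_at_iff_tendsto_nhds by blast
      then have lim: "filterlim s (nhds 0) (nhds 0)" by (simp add: s_def)
      have "eventually (\<lambda>s. eval_fps H s = h s) (nhds 0)" using H(1) by (simp add: has_fps_expansion_def)
      then have "eventually (\<lambda>z. eval_fps H (s z) = h (s z)) (nhds 0)"
        by (rule eventually_compose_filterlim[OF _ lim])
      moreover have "eventually (\<lambda>z::complex. z \<in> ball 0 1) (nhds 0)" by (intro eventually_nhds_in_open) auto
      ultimately show "eventually (\<lambda>z. f z = gauss_series a b c z) (nhds 0)"
      proof eventually_elim
        case (elim z)
        then have z: "z \<in> ?D" using sub by blast
        have "1 + s z \<noteq> 0" using one_plus_neq_0[OF s1[OF z]] .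
        then show ?case
          unfolding f_def elim(1) h_def sz[OF z] by (simp add: powr_minus)
      qed
    qed
  qed
  with f_holo show ?thesis by blast
qed

lemma hyp_fps_terminating:
  assumes "a \<in> \<int>\<^sub>\<le>\<^sub>0 \<or> b \<in> \<int>\<^sub>\<le>\<^sub>0"
  shows "fps_conv_radius (hyp_fps a b c) = \<infinity>"
proof -
  from assms obtain n where n: "a = - of_nat n \<or> b = - of_nat n"
    by (auto elim!: nonpos_Ints_cases')
  have "fps_conv_radius (hyp_fps a b c) = conv_radius (\<lambda>_. 0 :: complex)"
    unfolding fps_conv_radius_def
  proof (rule conv_radius_cong, use eventually_gt_at_top[of n] in eventually_elim)
    case (elim k)
    then have "pochhammer a k * pochhammer b k = 0"
      using n pochhammer_of_nat_eq_0_lemma[of n k, where ?'a = complex] by auto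
    then show ?case by auto
  qed
  then show ?thesis by simp
qed

lemma hyp2F1_cut_plane:
  assumes c: "c \<notin> \<int>\<^sub>\<le>\<^sub>0"
  shows "hyp2F1 a b c holomorphic_on (- (complex_of_real ` {1..}))"
    and "w \<in> ball 0 1 \<Longrightarrow> hyp2F1 a b c w = gauss_series a b c w"
proof -
  have "hyp2F1 a b c holomorphic_on (- (complex_of_real ` {1..})) \<and> (\<forall>w\<in>ball 0 1. hyp2F1 a b c w = gauss_series a b c w)"
  proof (cases "a \<in> \<int>\<^sub>\<le>\<^sub>0 \<or> b \<in> \<int>\<^sub>\<le>\<^sub>0")
    case True
    have "eval_fps (hyp_fps a b c) holomorphic_on (- (complex_of_real ` {1..}))"
      by (intro holomorphic_intros) (simp add: hyp_fps_terminating[OF True])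
    then show ?thesis
      using True by (simp add: hyp2F1_def[abs_def] gauss_series_eq_eval_fps)
  next
    case False
    define f where "f = (SOME f. f holomorphic_on (- (complex_of_real ` {1..})) \<and> (\<forall>w\<in>ball 0 1. f w = gauss_series a b c w))"
    have "f holomorphic_on (- (complex_of_real ` {1..})) \<and> (\<forall>w\<in>ball 0 1. f w = gauss_series a b c w)"
      unfolding f_def by (rule someI_ex[OF gauss_series_cut_plane[OF c]])
    moreover have "hyp2F1 a b c = f"
      using False by (simp add: hyp2F1_def f_def fun_eq_iff)
    ultimately show ?thesis by simp
  qed
  then show "hyp2F1 a b c holomorphic_on (- (complex_of_real ` {1..}))"
    and "w \<in> ball 0 1 \<Longrightarrow> hyp2F1 a b c w = gauss_series a b c w" by blast+
qed

section \<open>Quadratic transformation and reflection\<close>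

text \<open>
  Both sides solve the hypergeometric equation with parameters \<open>- \<nu>\<close>, \<open>\<nu> + 1\<close>, \<open>\<beta> + 1\<close> near
  the origin and equal \<open>1\<close> there. For the Legendre function of argument \<open>w = 1 - 2 * y\<close> this
  is the passage from the variable \<open>(1 - w) / 2\<close> to the variable \<open>1 - 1 / w\<^sup>2\<close>.
\<close>
lemma gauss_series_quadratic_transformation:
  fixes \<nu> \<beta> :: complex
  assumes c: "\<beta> + 1 \<notin> \<int>\<^sub>\<le>\<^sub>0"
  defines "l \<equiv> \<nu> + \<beta> + 1"
  shows "eventually (\<lambda>y. gauss_series (- \<nu>) (\<nu> + 1) (\<beta> + 1) y =
    (1 - y) powr \<beta> * (1 - 2 * y) powr (- l) *
    gauss_series (l / 2) ((l + 1) / 2) (\<beta> + 1) (4 * (y * (y - 1)) * (inverse (1 - 2 * y) * inverse (1 - 2 * y)))) (nhds 0)"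
proof -
  define S where "S = ball (0::complex) (1/20)"
  have S: "open S" "0 \<in> S" by (auto simp: S_def)
  define h where "h = (\<lambda>y. (1 - y) powr \<beta> * (1 - 2 * y) powr (- l) *
    gauss_series (l / 2) ((l + 1) / 2) (\<beta> + 1) (4 * (y * (y - 1)) * (inverse (1 - 2 * y) * inverse (1 - 2 * y))))"
  obtain H where H: "h has_fps_expansion H"
    "fps_X * (1 - fps_X) * fps_deriv (fps_deriv H) + (fps_const (\<beta> + 1) - fps_const (- \<nu> + (\<nu> + 1) + 1) * fps_X) * fps_deriv H
       + fps_const (- (- \<nu> * (\<nu> + 1))) * H = 0"
    unfolding h_def
  proof (rule hyp_substitution_ode[OF c S, where
        E = "\<lambda>y. (1 - y) powr \<beta> * (1 - 2 * y) powr (- l)" and e = "\<lambda>y. - \<beta> * inverse (1 - y) + 2 * l * inverse (1 - 2 * y)" and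
        e' = "\<lambda>y. - \<beta> * (inverse (1 - y) * inverse (1 - y)) + 2 * l * (2 * (inverse (1 - 2 * y) * inverse (1 - 2 * y)))"
        and Z = "\<lambda>y. 4 * (y * (y - 1)) * (inverse (1 - 2 * y) * inverse (1 - 2 * y))"
        and Z' = "\<lambda>y. - 4 * (inverse (1 - 2 * y) * inverse (1 - 2 * y) * inverse (1 - 2 * y))"
        and Z'' = "\<lambda>y. - 24 * (inverse (1 - 2 * y) * inverse (1 - 2 * y) * inverse (1 - 2 * y) * inverse (1 - 2 * y))"
        and M = "\<lambda>y. - 4 * (inverse (1 - 2 * y) * inverse (1 - 2 * y))"
        and P = "\<lambda>y. y * (1 - y)" and Q = "\<lambda>y. (\<beta> + 1) - (- \<nu> + (\<nu> + 1) + 1) * y"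
        and R = "\<lambda>y. - (- \<nu> * (\<nu> + 1))" and a = "l / 2" and b = "(l + 1) / 2"
        and PF = "fps_X * (1 - fps_X)" and QF = "fps_const (\<beta> + 1) - fps_const (- \<nu> + (\<nu> + 1) + 1) * fps_X"
        and RF = "fps_const (- (- \<nu> * (\<nu> + 1)))"])
    fix y assume "y \<in> S"
    then have y: "norm y < 1/20" by (simp add: S_def)
    have nz1: "1 - y \<noteq> 0" using one_plus_neq_0[of "- y"] y by simp
    have nz2: "1 - 2 * y \<noteq> 0" using one_plus_neq_0[of "- (2 * y)"] y by (simp add: norm_mult)
    have np1: "1 - y \<notin> \<real>\<^sub>\<le>\<^sub>0" using one_plus_nonpos_Reals[of "- y"] y by simp
    have np2: "1 - 2 * y \<notin> \<real>\<^sub>\<le>\<^sub>0" using one_plus_nonpos_Reals[of "- (2 * y)"] y by (simp add: norm_mult)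
    define i where "i = inverse (1 - 2 * y)"
    define j where "j = inverse (1 - y)"
    have i: "i * (1 - 2 * y) = 1" using nz2 by (simp add: i_def)
    have j: "j * (1 - y) = 1" using nz1 by (simp add: j_def)
    have di: "((\<lambda>y. inverse (1 - 2 * y)) has_field_derivative 2 * (i * i)) (at y)"
      by (rule DERIV_cong, (rule derivative_intros nz2)+) (simp add: i_def)
    have dj: "((\<lambda>y. inverse (1 - y)) has_field_derivative j * j) (at y)"
      by (rule DERIV_cong, (rule derivative_intros nz1)+) (simp add: j_def)
    have d1: "((\<lambda>y. (1 - y) powr \<beta>) has_field_derivative (1 - y) powr \<beta> * (- \<beta> * inverse (1 - y))) (at y)"
      using np1 nz1 by (auto intro!: derivative_eq_intros simp: powr_diff divide_inverse)
    have d2: "((\<lambda>y. (1 - 2 * y) powr (- l)) has_field_derivative (1 - 2 * y) powr (- l) * (2 * l * inverse (1 - 2 * y))) (at y)"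
      using np2 nz2 by (auto intro!: derivative_eq_intros simp: powr_diff divide_inverse)
    show "((\<lambda>y. (1 - y) powr \<beta> * (1 - 2 * y) powr (- l)) has_field_derivative
        (1 - y) powr \<beta> * (1 - 2 * y) powr (- l) * (- \<beta> * inverse (1 - y) + 2 * l * inverse (1 - 2 * y))) (at y)"
      by (rule DERIV_cong[OF DERIV_mult[OF d1 d2]]) (simp add: algebra_simps)
    show "((\<lambda>y. - \<beta> * inverse (1 - y) + 2 * l * inverse (1 - 2 * y)) has_field_derivative
        - \<beta> * (inverse (1 - y) * inverse (1 - y)) + 2 * l * (2 * (inverse (1 - 2 * y) * inverse (1 - 2 * y)))) (at y)"
      using DERIV_add[OF DERIV_cmult[OF dj, of "- \<beta>"] DERIV_cmult[OF di, of "2 * l"]] by (simp only: i_def j_def)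
    have "((\<lambda>y. 4 * (y * (y - 1)) * (inverse (1 - 2 * y) * inverse (1 - 2 * y))) has_field_derivative
        4 * (1 * (y - 1) + (1 - 0) * y) * (i * i) + (2 * (i * i) * i + 2 * (i * i) * i) * (4 * (y * (y - 1)))) (at y)"
      by (rule DERIV_mult[OF DERIV_cmult[OF DERIV_mult[OF DERIV_ident DERIV_diff[OF DERIV_ident DERIV_const]]] DERIV_mult[OF di di], folded i_def])
    moreover have "4 * (1 * (y - 1) + (1 - 0) * y) * (i * i) + (2 * (i * i) * i + 2 * (i * i) * i) * (4 * (y * (y - 1))) = - 4 * (i * i * i)"
      using i by algebra
    ultimately show "((\<lambda>y. 4 * (y * (y - 1)) * (inverse (1 - 2 * y) * inverse (1 - 2 * y))) has_field_derivative
        - 4 * (inverse (1 - 2 * y) * inverse (1 - 2 * y) * inverse (1 - 2 * y))) (at y)"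
      by (simp only: i_def)
    have "((\<lambda>y. - 4 * (inverse (1 - 2 * y) * inverse (1 - 2 * y) * inverse (1 - 2 * y))) has_field_derivative
        - 4 * ((2 * (i * i) * i + 2 * (i * i) * i) * i + 2 * (i * i) * (i * i))) (at y)"
      by (rule DERIV_cmult[OF DERIV_mult[OF DERIV_mult[OF di di] di], folded i_def])
    moreover have "- 4 * ((2 * (i * i) * i + 2 * (i * i) * i) * i + 2 * (i * i) * (i * i)) = - 24 * (i * i * i * i)"
      by algebra
    ultimately show "((\<lambda>y. - 4 * (inverse (1 - 2 * y) * inverse (1 - 2 * y) * inverse (1 - 2 * y))) has_field_derivative
        - 24 * (inverse (1 - 2 * y) * inverse (1 - 2 * y) * inverse (1 - 2 * y) * inverse (1 - 2 * y))) (at y)"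
      by (simp only: i_def)
    have "norm (4 * (y * (y - 1)) * (inverse (1 - 2 * y) * inverse (1 - 2 * y))) \<le> 4 * (1/20 * (21/20)) * (inverse (9/10) * inverse (9/10))"
    proof -
      have "9/10 \<le> norm (1 - 2 * y)" using norm_diff_ineq[of 1 "- (2 * y)"] y by (simp add: norm_mult)
      then have "inverse (norm (1 - 2 * y)) \<le> inverse (9/10)" by (rule le_imp_inverse_le) simp
      moreover have "norm (y - 1) \<le> 21/20" using norm_triangle_ineq4[of y 1] y by simp
      ultimately show ?thesis unfolding norm_mult norm_inverse
        using y by (intro mult_mono) auto
    qed
    then show "norm (4 * (y * (y - 1)) * (inverse (1 - 2 * y) * inverse (1 - 2 * y))) < fps_conv_radius (hyp_fps (l / 2) ((l + 1) / 2) (\<beta> + 1))"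
      by (intro norm_less_hyp_fps_conv_radius) simp
    show "y * (1 - y) * (- 4 * (inverse (1 - 2 * y) * inverse (1 - 2 * y) * inverse (1 - 2 * y)))\<^sup>2 =
      - 4 * (inverse (1 - 2 * y) * inverse (1 - 2 * y)) * (4 * (y * (y - 1)) * (inverse (1 - 2 * y) * inverse (1 - 2 * y)) *
        (1 - 4 * (y * (y - 1)) * (inverse (1 - 2 * y) * inverse (1 - 2 * y))))"
      using i unfolding i_def[symmetric] by algebra
    show "y * (1 - y) * (2 * (- \<beta> * inverse (1 - y) + 2 * l * inverse (1 - 2 * y)) *
        (- 4 * (inverse (1 - 2 * y) * inverse (1 - 2 * y) * inverse (1 - 2 * y))) +
        - 24 * (inverse (1 - 2 * y) * inverse (1 - 2 * y) * inverse (1 - 2 * y) * inverse (1 - 2 * y))) +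
      (\<beta> + 1 - (- \<nu> + (\<nu> + 1) + 1) * y) * (- 4 * (inverse (1 - 2 * y) * inverse (1 - 2 * y) * inverse (1 - 2 * y))) =
      - 4 * (inverse (1 - 2 * y) * inverse (1 - 2 * y)) *
        (\<beta> + 1 - (l / 2 + (l + 1) / 2 + 1) * (4 * (y * (y - 1)) * (inverse (1 - 2 * y) * inverse (1 - 2 * y))))"
      (is "?L = ?R")
    proof -
      have ab: "l / 2 + (l + 1) / 2 + 1 = l + 1 + inverse 2" by (simp add: field_simps)
      define k :: complex where "k = inverse 2"
      have "2 * k = 1" by (simp add: k_def)
      then show ?thesis using i j unfolding ab k_def[symmetric] i_def[symmetric] j_def[symmetric] by algebra
    qed
    show "y * (1 - y) * ((- \<beta> * inverse (1 - y) + 2 * l * inverse (1 - 2 * y))\<^sup>2 +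
         (- \<beta> * (inverse (1 - y) * inverse (1 - y)) + 2 * l * (2 * (inverse (1 - 2 * y) * inverse (1 - 2 * y))))) +
       (\<beta> + 1 - (- \<nu> + (\<nu> + 1) + 1) * y) * (- \<beta> * inverse (1 - y) + 2 * l * inverse (1 - 2 * y)) +
       - (- \<nu> * (\<nu> + 1)) = - (- 4 * (inverse (1 - 2 * y) * inverse (1 - 2 * y))) * (l / 2 * ((l + 1) / 2))"
    proof -
      define k :: complex where "k = inverse 2"
      have ab: "l / 2 * ((l + 1) / 2) = l * (l + 1) * (k * k)" by (simp add: k_def)
      have k: "2 * k = 1" by (simp add: k_def)
      have "\<nu> = l - \<beta> - 1" by (simp add: l_def)
      then show ?thesis using i j k unfolding ab i_def[symmetric] j_def[symmetric] by algebra
    qed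
  next
    show "(\<lambda>y::complex. y * (1 - y)) has_fps_expansion fps_X * (1 - fps_X)" by (intro fps_expansion_intros)
    show "(\<lambda>y. \<beta> + 1 - (- \<nu> + (\<nu> + 1) + 1) * y) has_fps_expansion fps_const (\<beta> + 1) - fps_const (- \<nu> + (\<nu> + 1) + 1) * fps_X"
      by (intro fps_expansion_intros)
    show "(\<lambda>y. - (- \<nu> * (\<nu> + 1))) has_fps_expansion fps_const (- (- \<nu> * (\<nu> + 1)))" by (rule has_fps_expansion_const)
  qed blast
  have "fps_nth H 0 = h 0" by (rule has_fps_expansion_imp_0_eq_fps_nth_0[OF H(1), symmetric])
  also have "h 0 = 1" by (simp add: h_def gauss_series_eq_eval_fps eval_fps_at_0)
  finally have "H = hyp_fps (- \<nu>) (\<nu> + 1) (\<beta> + 1)"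
    using hyp_fps_unique[OF c H(2)] by simp
  then have "eventually (\<lambda>y. eval_fps (hyp_fps (- \<nu>) (\<nu> + 1) (\<beta> + 1)) y = h y) (nhds 0)"
    using H(1) by (simp add: has_fps_expansion_def)
  then show ?thesis by (simp add: h_def gauss_series_eq_eval_fps)
qed

lemma gauss_series_terminating:
  "gauss_series (- of_nat n) b c z = (\<Sum>k\<le>n. pochhammer (- of_nat n) k * pochhammer b k / (pochhammer c k * fact k) * z ^ k)"
proof -
  have "gauss_series (- of_nat n) b c z = (\<Sum>k\<le>n. pochhammer (- of_nat n) k * pochhammer b k / pochhammer c k * (z ^ k / fact k))"
    unfolding gauss_series_def by (rule suminf_finite) (auto simp: pochhammer_of_nat_eq_0_lemma)
  then show ?thesis by (simp add: mult_ac)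
qed

text \<open>
  The substitution \<open>y \<mapsto> 1 - y\<close> preserves the hypergeometric equation and replaces \<open>c\<close> by
  \<open>a + b + 1 - c\<close>. The two polynomials are therefore proportional, and the Chu-Vandermonde sum
  gives the factor, as the value of the left-hand side at \<open>y = 0\<close>. For Jacobi polynomials this
  is the symmetry that exchanges \<open>\<alpha>\<close> and \<open>\<beta>\<close>.
\<close>
lemma gauss_series_reflection:
  fixes n :: nat and \<alpha> \<beta> :: complex
  assumes \<alpha>: "\<alpha> + 1 \<notin> \<int>\<^sub>\<le>\<^sub>0" and \<beta>: "\<beta> + 1 \<notin> \<int>\<^sub>\<le>\<^sub>0"
  defines "b \<equiv> of_nat n + \<alpha> + \<beta> + 1"
  shows "gauss_series (- of_nat n) b (\<alpha> + 1) (1 - y) =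
    (- 1) ^ n * pochhammer (\<beta> + 1) n / pochhammer (\<alpha> + 1) n * gauss_series (- of_nat n) b (\<beta> + 1) y"
proof -
  have inf: "fps_conv_radius (hyp_fps (- of_nat n) b c) = \<infinity>" for c
    by (rule hyp_fps_terminating) simp
  define a where "a = - complex_of_nat n"
  define h where "h = (\<lambda>y. 1 * gauss_series (- of_nat n) b (\<alpha> + 1) (1 - y))"
  obtain H where H: "h has_fps_expansion H"
    "fps_X * (1 - fps_X) * fps_deriv (fps_deriv H) + (fps_const (\<beta> + 1) - fps_const (a + b + 1) * fps_X) * fps_deriv H
       + fps_const (- (a * b)) * H = 0"
    unfolding h_def
  proof (rule hyp_substitution_ode[OF \<alpha>, where
        E = "\<lambda>y. 1" and e = "\<lambda>y. 0" and e' = "\<lambda>y. 0" and Z = "\<lambda>y. 1 - y" and Z' = "\<lambda>y. - 1" and Z'' = "\<lambda>y. 0"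
        and M = "\<lambda>y. 1" and P = "\<lambda>y. y * (1 - y)" and Q = "\<lambda>y. (\<beta> + 1) - (a + b + 1) * y"
        and R = "\<lambda>y. - (a * b)" and a = a and b = b and S = UNIV
        and PF = "fps_X * (1 - fps_X)" and QF = "fps_const (\<beta> + 1) - fps_const (a + b + 1) * fps_X"
        and RF = "fps_const (- (a * b))"])
    fix y :: complex
    show "norm (1 - y) < fps_conv_radius (hyp_fps a b (\<alpha> + 1))" by (simp add: inf a_def)
    show "y * (1 - y) * (2 * 0 * - 1 + 0) + (\<beta> + 1 - (a + b + 1) * y) * - 1 = 1 * (\<alpha> + 1 - (a + b + 1) * (1 - y))"
      by (simp add: a_def b_def algebra_simps)
    show "((\<lambda>y. 1 - y) has_field_derivative - 1) (at y)" by (auto intro!: derivative_eq_intros)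
  next
    show "(\<lambda>y::complex. y * (1 - y)) has_fps_expansion fps_X * (1 - fps_X)" by (intro fps_expansion_intros)
    show "(\<lambda>y. \<beta> + 1 - (a + b + 1) * y) has_fps_expansion fps_const (\<beta> + 1) - fps_const (a + b + 1) * fps_X"
      by (intro fps_expansion_intros)
    show "(\<lambda>y. - (a * b)) has_fps_expansion fps_const (- (a * b))" by (rule has_fps_expansion_const)
  qed (auto simp: a_def)
  have "fps_nth H 0 = h 0" by (rule has_fps_expansion_imp_0_eq_fps_nth_0[OF H(1), symmetric])
  also have "h 0 = (\<Sum>k=0..n. pochhammer b k * pochhammer (- of_nat n) k / (of_nat (fact k) * pochhammer (\<alpha> + 1) k))"
    by (simp add: h_def gauss_series_terminating mult_ac atMost_atLeast0)
  also have "\<dots> = pochhammer (\<alpha> + 1 - b) n / pochhammer (\<alpha> + 1) n"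
  proof (rule Vandermonde_pochhammer)
    show "\<forall>i\<in>{0..<n}. \<alpha> + 1 \<noteq> - of_nat i"
      using plus_of_nat_neq_0[OF \<alpha>] by (metis add.left_inverse)
  qed
  also have "\<alpha> + 1 - b = - (of_nat n + \<beta>)" by (simp add: b_def)
  also have "pochhammer \<dots> n = (- 1) ^ n * pochhammer (\<beta> + 1) n"
    by (subst pochhammer_minus) simp
  finally have H0: "fps_nth H 0 = (- 1) ^ n * pochhammer (\<beta> + 1) n / pochhammer (\<alpha> + 1) n" (is "_ = ?K") .
  have H': "H = fps_const ?K * hyp_fps a b (\<beta> + 1)"
    using hyp_fps_unique[OF \<beta> H(2)] H0 by simp
  have "eval_fps H y = h y"
  proof (rule has_fps_expansion_imp_eval_fps_eq[OF H(1)])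
    show "norm y < norm y + 1" by simp
    have "eval_fps (hyp_fps (- of_nat n) b (\<alpha> + 1)) holomorphic_on UNIV"
      by (intro holomorphic_intros) (simp add: inf)
    then have "(eval_fps (hyp_fps (- of_nat n) b (\<alpha> + 1)) \<circ> (\<lambda>y. 1 - y)) holomorphic_on ball 0 (norm y + 1)"
      by (intro holomorphic_on_compose_gen[where t = UNIV] holomorphic_intros) (auto simp: inf)
    then show "h holomorphic_on ball 0 (norm y + 1)"
      by (simp add: h_def o_def gauss_series_eq_eval_fps)
  qed
  moreover have "eval_fps H y = ?K * gauss_series a b (\<beta> + 1) y"
    unfolding H' by (subst eval_fps_mult) (simp_all add: inf a_def gauss_series_eq_eval_fps)
  ultimately show ?thesis by (simp add: h_def a_def)
qed

section \<open>A terminating well-poised sum\<close>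

text \<open>
  Up to normalisation the sum is a terminating well-poised \<open>\<^sub>4F\<^sub>3\<close> with argument \<open>-1\<close>. The proof is a
  Wilf-Zeilberger pair: \<open>F M i\<close> is the summand divided by the claimed value, and the partial
  sums of \<open>F (M + 1) i - F M i\<close> over \<open>i \<le> j\<close> have the closed form \<open>H M j\<close>. With \<open>j = M\<close>, the
  additional term \<open>F (M + 1) (M + 1)\<close> cancels \<open>H M M\<close>, so the total does not depend on \<open>M\<close>.
\<close>
lemma well_poised_sum:
  fixes g b :: complex
  assumes g: "\<And>i. g + of_nat i \<noteq> 0"
  shows "(\<Sum>i\<le>M. (- 1) ^ i * (g + 2 * of_nat i) * pochhammer (g + b + of_nat M) i * pochhammer b (M - i) /
           (pochhammer (g + of_nat i) (Suc M) * fact i * fact (M - i))) = (- 1) ^ M / fact M"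
proof -
  define F where "F M i = (- 1) ^ (M + i) * fact M * (g + 2 * of_nat i) * pochhammer (g + b + of_nat M) i * pochhammer b (M - i) /
           (pochhammer (g + of_nat i) (Suc M) * fact i * fact (M - i))" for M i
  define H where "H M j = - ((- 1) ^ (M + j) * fact M * (g + b + 2 * of_nat M + 1) * pochhammer (g + b + of_nat M + 1) j * pochhammer b (M - j) /
           (pochhammer (g + of_nat j + 1) (Suc M) * fact j * fact (M - j)))" for M j
  have nz: "pochhammer (g + of_nat i) k \<noteq> 0" for i k
    using g[of "i + _"] by (auto simp: pochhammer_eq_0_iff add_eq_0_iff2 algebra_simps)
  have partial_sum: "(\<Sum>i\<le>j. F (Suc M) i - F M i) = H M j" if "j \<le> M" for j M
    using that
  proof (induction j)
    case 0
    have "F (Suc M) 0 = (- 1) ^ Suc M * pochhammer b M * (b + of_nat M) / (pochhammer (g + 1) M * (g + 1 + of_nat M))"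
      using g[of 0] unfolding F_def pochhammer_rec[of "g + of_nat 0"]
      by (simp add: pochhammer_Suc mult_ac del: of_nat_Suc fact_Suc)
    moreover have "F M 0 = - ((- 1) ^ Suc M * pochhammer b M / pochhammer (g + 1) M)"
      using g[of 0] unfolding F_def pochhammer_rec[of "g + of_nat 0"] by simp
    moreover have nz0: "pochhammer (g + 1) M \<noteq> 0" "g + 1 + of_nat M \<noteq> 0"
      using nz[of 1 M] g[of "Suc M"] by (simp_all add: algebra_simps)
    moreover have "x * u / (p * q) - - (x / p) = x * (u + q) / (p * q)" if "p \<noteq> 0" "q \<noteq> 0" for x u p q :: complex
      using that by (simp add: field_simps)
    ultimately have "F (Suc M) 0 - F M 0 = (- 1) ^ Suc M * pochhammer b M * (b + of_nat M + (g + 1 + of_nat M)) / (pochhammer (g + 1) M * (g + 1 + of_nat M))"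
      by (simp only:) 
    moreover have "H M 0 = (- 1) ^ Suc M * pochhammer b M * (b + of_nat M + (g + 1 + of_nat M)) / (pochhammer (g + 1) M * (g + 1 + of_nat M))"
    proof -
      have "g + b + 2 * of_nat M + 1 = b + of_nat M + (g + 1 + of_nat M)" by simp
      then show ?thesis unfolding H_def by (simp only: pochhammer_Suc) (simp add: mult_ac)
    qed
    ultimately show ?case by simp
  next
    case (Suc j)
    define K where "K = M - Suc j"
    have M: "M = K + j + 1" using Suc.prems by (simp add: K_def)
    define X where "X = pochhammer (g + of_nat j + 2) M"
    define Y where "Y = pochhammer b K"
    define a where "a = g + b + of_nat M"
    define W where "W = pochhammer (a + 1) j"
    define p where "p = g + of_nat j + 1"
    define q where "q = g + of_nat j + of_nat M + 2"
    define k where "k = of_nat K + (1::complex)"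
    define l where "l = of_nat j + (1::complex)"
    have nz': "p \<noteq> 0" "q \<noteq> 0" "X \<noteq> 0" "k \<noteq> 0" "l \<noteq> 0"
    proof -
      show "p \<noteq> 0" "q \<noteq> 0" "X \<noteq> 0"
        using g[of "Suc j"] g[of "j + M + 2"] nz[of "j + 2" M] by (simp_all add: p_def q_def X_def algebra_simps)
      have "k = of_nat (Suc K)" "l = of_nat (Suc j)" by (simp_all add: k_def l_def)
      then show "k \<noteq> 0" "l \<noteq> 0" by (simp_all del: of_nat_Suc)
    qed
    \<comment> \<open>The common factor of the four terms; what remains is an identity of polynomials.\<close>
    define T where "T = (- 1) ^ (M + j) * fact M * W * Y / (p * q * X * (l * fact j) * (k * fact K))"
    have X1: "pochhammer (g + of_nat (Suc j)) (Suc M) = p * X"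
      unfolding pochhammer_rec[of "g + of_nat (Suc j)"] by (simp add: p_def X_def algebra_simps)
    have X3: "pochhammer (g + of_nat (Suc j) + 1) (Suc M) = X * q"
      unfolding pochhammer_Suc by (simp add: q_def X_def algebra_simps)
    have X2: "pochhammer (g + of_nat (Suc j)) (Suc (Suc M)) = p * (X * q)"
      unfolding pochhammer_rec[of "g + of_nat (Suc j)"] using X3 by (simp add: p_def algebra_simps)
    have X4: "pochhammer (g + of_nat j + 1) (Suc M) = p * X"
      using X1 by (simp add: algebra_simps)
    have facts: "fact (Suc j) = l * fact j" "fact (Suc K) = (k * fact K :: complex)"
      by (simp_all add: l_def k_def algebra_simps)
    have Ms: "Suc M - Suc j = Suc K" "M - Suc j = K" "M - j = Suc K" by (auto simp: M)
    have "F (Suc M) (Suc j) = T * ((of_nat M + 1) * (g + 2 * l) * (a + 1 + of_nat j) * (b + of_nat K))"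
    proof -
      have "F (Suc M) (Suc j) = (- 1) ^ (M + j) * ((of_nat M + 1) * fact M) * (g + 2 * l) * (W * (a + 1 + of_nat j)) * (Y * (b + of_nat K)) /
        (p * (X * q) * (l * fact j) * (k * fact K))"
        unfolding F_def Ms X2 facts by (simp add: pochhammer_Suc W_def Y_def a_def l_def add_ac)
      also have "\<dots> = T * ((of_nat M + 1) * (g + 2 * l) * (a + 1 + of_nat j) * (b + of_nat K))"
        unfolding T_def by (simp add: mult_ac)
      finally show ?thesis .
    qed
    moreover have "F M (Suc j) = - T * ((g + 2 * l) * a * q * k)"
    proof -
      have "F M (Suc j) = - ((- 1) ^ (M + j) * fact M * (g + 2 * l) * (a * W) * Y / (p * X * (l * fact j) * fact K))"
        unfolding F_def Ms X1 facts(1) by (simp add: pochhammer_rec W_def Y_def a_def l_def)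
      also have "\<dots> = - T * ((g + 2 * l) * a * q * k)"
        unfolding T_def using nz' by (simp add: mult_ac)
      finally show ?thesis .
    qed
    moreover have "H M (Suc j) = T * ((a + of_nat M + 1) * (a + 1 + of_nat j) * p * k)"
    proof -
      have "H M (Suc j) = (- 1) ^ (M + j) * fact M * (a + of_nat M + 1) * (W * (a + 1 + of_nat j)) * Y / (X * q * (l * fact j) * fact K)"
        unfolding H_def Ms X3 facts(1) by (simp add: pochhammer_Suc W_def Y_def a_def)
      also have "\<dots> = T * ((a + of_nat M + 1) * (a + 1 + of_nat j) * p * k)"
        unfolding T_def using nz' by (simp add: mult_ac)
      finally show ?thesis .
    qed
    moreover have "H M j = - T * ((a + of_nat M + 1) * (b + of_nat K) * q * l)"
    proof -
      have "H M j = - ((- 1) ^ (M + j) * fact M * (a + of_nat M + 1) * W * (Y * (b + of_nat K)) / (p * X * fact j * (k * fact K)))"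
        unfolding H_def Ms X4 facts(2) by (simp add: pochhammer_Suc W_def Y_def a_def)
      also have "\<dots> = - T * ((a + of_nat M + 1) * (b + of_nat K) * q * l)"
        unfolding T_def using nz' by (simp add: mult_ac)
      finally show ?thesis .
    qed
    moreover have "of_nat M = of_nat K + of_nat j + (1::complex)" by (simp add: M)
    ultimately have "H M j + (F (Suc M) (Suc j) - F M (Suc j)) = H M (Suc j)"
      unfolding a_def p_def q_def k_def l_def by algebra
    then show ?case using Suc by simp
  qed
  have F1: "(\<Sum>i\<le>M. F M i) = 1" for M
  proof (induction M)
    case 0
    then show ?case using g[of 0] by (simp add: F_def)
  next
    case (Suc M)
    have "(\<Sum>i\<le>M. F (Suc M) i) = 1 + H M M"
      using partial_sum[of M M] Suc by (simp add: sum_subtractf algebra_simps)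
    moreover have "F (Suc M) (Suc M) = - H M M"
    proof -
      have n: "g + 2 * of_nat (Suc M) \<noteq> 0" using g[of "2 * Suc M"] by simp
      have X: "pochhammer (g + of_nat (Suc M)) (Suc (Suc M)) = pochhammer (g + of_nat M + 1) (Suc M) * (g + 2 * of_nat (Suc M))"
        by (simp add: pochhammer_Suc[of _ "Suc M"] algebra_simps)
      have "F (Suc M) (Suc M) = (g + 2 * of_nat (Suc M)) * pochhammer (g + b + of_nat (Suc M)) (Suc M) /
         (pochhammer (g + of_nat M + 1) (Suc M) * (g + 2 * of_nat (Suc M)))"
        unfolding F_def X by (simp del: of_nat_Suc fact_Suc)
      also have "\<dots> = pochhammer (g + b + of_nat (Suc M)) (Suc M) / pochhammer (g + of_nat M + 1) (Suc M)"
        using n by (simp del: of_nat_Suc)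
      also have "\<dots> = - H M M"
      proof -
        have "pochhammer (g + b + of_nat (Suc M)) (Suc M) = (g + b + 2 * of_nat M + 1) * pochhammer (g + b + of_nat M + 1) M"
          by (simp add: pochhammer_Suc algebra_simps)
        then show ?thesis unfolding H_def by (simp del: of_nat_Suc)
      qed
      finally show ?thesis .
    qed
    ultimately show ?case by simp
  qed
  have "(\<Sum>i\<le>M. F M i) * ((- 1) ^ M / fact M) = (\<Sum>i\<le>M. (- 1) ^ i * (g + 2 * of_nat i) * pochhammer (g + b + of_nat M) i * pochhammer b (M - i) /
           (pochhammer (g + of_nat i) (Suc M) * fact i * fact (M - i)))"
    unfolding sum_distrib_right F_def
    by (intro sum.cong refl) (simp add: power_add mult_ac flip: power_mult_distrib)
  then show ?thesis by (simp add: F1)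
qed

section \<open>Jacobi polynomials as Taylor coefficients\<close>

text \<open>
  The Taylor coefficients in \<open>r\<close> of
  \<open>(1 + r) powr (- l) * \<^sub>2F\<^sub>1(l / 2, (l + 1) / 2; b; 4 * y * r / (1 + r)\<^sup>2)\<close>.
\<close>
definition jacobi_gf_coeff :: "complex \<Rightarrow> complex \<Rightarrow> nat \<Rightarrow> complex \<Rightarrow> complex" where
  "jacobi_gf_coeff l b N y =
     (\<Sum>k\<le>N. (- 1) ^ (N + k) * pochhammer l (N + k) / (pochhammer b k * fact k * fact (N - k)) * y ^ k)"

lemma pochhammer_minus_of_nat:
  assumes "k \<le> n"
  shows "pochhammer (- of_nat n :: complex) k = (- 1) ^ k * fact n / fact (n - k)"
  using assms
proof (induction k)
  case (Suc k)
  define j where "j = n - Suc k"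
  have j: "n - k = Suc j" "n = j + k + 1" using Suc.prems by (auto simp: j_def)
  have "pochhammer (- of_nat n :: complex) (Suc k) = (- 1) ^ k * fact n / fact (Suc j) * (- of_nat (Suc j))"
    using Suc by (simp add: pochhammer_Suc j)
  also have "\<dots> = (- 1) ^ Suc k * fact n / fact j"
    by (simp add: divide_simps del: of_nat_Suc)
  finally show ?case by (simp add: j_def)
qed simp

text \<open>
  For \<open>l = \<alpha> + \<beta> + 1\<close> the coefficients are multiples of the Jacobi polynomials. The reflection
  is used because \<open>jacobi_P\<close> is defined by powers of \<open>(1 - x) / 2\<close>, whereas the coefficients
  are polynomials in \<open>(1 + x) / 2\<close>.
\<close>
lemma jacobi_P_eq_jacobi_gf_coeff:
  fixes \<alpha> \<beta> :: real
  assumes "\<alpha> > -1" "\<beta> > -1"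
  defines "g \<equiv> complex_of_real \<alpha> + complex_of_real \<beta> + 1" and "b \<equiv> complex_of_real \<beta> + 1"
  shows "pochhammer g n / pochhammer b n * jacobi_P n \<alpha> \<beta> x = jacobi_gf_coeff g b n ((1 + x) / 2)"
proof -
  define a where "a = complex_of_real \<alpha> + 1"
  define y where "y = (1 + x) / 2"
  have ab: "a \<notin> \<int>\<^sub>\<le>\<^sub>0" "b \<notin> \<int>\<^sub>\<le>\<^sub>0"
    unfolding a_def b_def by (intro of_real_plus_one_notin_nonpos_Ints assms(1,2))+
  have nz: "pochhammer a n \<noteq> 0" "pochhammer b n \<noteq> 0"
    using ab by (simp_all add: pochhammer_nonpos_Int_neq_0)
  have y: "(1 - x) / 2 = 1 - y" by (simp add: y_def field_simps)
  have "jacobi_P n \<alpha> \<beta> x = pochhammer a n / fact n * gauss_series (- of_nat n) (of_nat n + complex_of_real \<alpha> + complex_of_real \<beta> + 1) a (1 - y)"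
    unfolding jacobi_P_def hyp2F1_def y by (simp add: a_def)
  also have "gauss_series (- of_nat n) (of_nat n + complex_of_real \<alpha> + complex_of_real \<beta> + 1) a (1 - y) =
    (- 1) ^ n * pochhammer b n / pochhammer a n * gauss_series (- of_nat n) (of_nat n + complex_of_real \<alpha> + complex_of_real \<beta> + 1) b y"
    using ab unfolding a_def b_def by (rule gauss_series_reflection)
  also have "of_nat n + complex_of_real \<alpha> + complex_of_real \<beta> + 1 = g + of_nat n" by (simp add: g_def)
  finally have "pochhammer g n / pochhammer b n * jacobi_P n \<alpha> \<beta> x =
    (- 1) ^ n * pochhammer g n / fact n * gauss_series (- of_nat n) (g + of_nat n) b y"
    using nz by simp
  also have "\<dots> = jacobi_gf_coeff g b n y"
    unfolding gauss_series_terminating jacobi_gf_coeff_def sum_distrib_left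
  proof (intro sum.cong refl)
    fix k assume "k \<in> {..n}"
    then show "(- 1) ^ n * pochhammer g n / fact n * (pochhammer (- of_nat n) k * pochhammer (g + of_nat n) k / (pochhammer b k * fact k) * y ^ k) =
        (- 1) ^ (n + k) * pochhammer g (n + k) / (pochhammer b k * fact k * fact (n - k)) * y ^ k"
      by (simp add: pochhammer_minus_of_nat pochhammer_product'[of g n k] power_add mult_ac)
  qed
  finally show ?thesis by (simp add: y_def)
qed

lemma sum_triangle_swap:
  fixes f :: "nat \<Rightarrow> nat \<Rightarrow> complex"
  shows "(\<Sum>n\<le>N. \<Sum>k\<le>n. f n k) = (\<Sum>k\<le>N. \<Sum>i\<le>N - k. f (k + i) k)"
  unfolding sum.Sigma[OF finite_atMost ballI[OF finite_atMost]]
  by (rule sum.reindex_bij_witness[of _ "\<lambda>(k, i). (k + i, k)" "\<lambda>(n, k). (k, n - k)"]) auto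

text \<open>
  This expands the coefficients for the parameter \<open>g + c\<close> in those for \<open>g\<close>. In the application
  \<open>c = m\<close>, so that for \<open>g = \<alpha> + \<beta> + 1\<close> it is an expansion in Jacobi polynomials. The coefficient of
  \<open>y ^ k\<close> on the left is, up to a factor, the sum of \<open>well_poised_sum\<close> with \<open>g + 2 * k\<close> for \<open>g\<close>
  and \<open>N - k\<close> for \<open>M\<close>.
\<close>
lemma jacobi_gf_coeff_connection:
  fixes g b c :: complex
  assumes g: "\<And>i. g + of_nat i \<noteq> 0"
  shows "(\<Sum>n\<le>N. pochhammer (g + c) (2 * n) / pochhammer g (2 * n) * jacobi_gf_coeff g b n y *
           (pochhammer c (N - n) * pochhammer (g + c + 2 * of_nat n) (N - n) / (pochhammer (g + 2 * of_nat n + 1) (N - n) * fact (N - n)))) =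
         jacobi_gf_coeff (g + c) b N y"
proof -
  define t where "t n k = pochhammer (g + c) (2 * n) / pochhammer g (2 * n) *
      ((- 1) ^ (n + k) * pochhammer g (n + k) / (pochhammer b k * fact k * fact (n - k)) * y ^ k) *
           (pochhammer c (N - n) * pochhammer (g + c + 2 * of_nat n) (N - n) / (pochhammer (g + 2 * of_nat n + 1) (N - n) * fact (N - n)))" for n k
  have nz: "pochhammer (g + of_nat i) k \<noteq> 0" for i k
    using g[of "i + _"] by (auto simp: pochhammer_eq_0_iff add_eq_0_iff2 algebra_simps)
  have "(\<Sum>n\<le>N. pochhammer (g + c) (2 * n) / pochhammer g (2 * n) * jacobi_gf_coeff g b n y *
           (pochhammer c (N - n) * pochhammer (g + c + 2 * of_nat n) (N - n) / (pochhammer (g + 2 * of_nat n + 1) (N - n) * fact (N - n)))) =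
        (\<Sum>n\<le>N. \<Sum>k\<le>n. t n k)"
    unfolding jacobi_gf_coeff_def sum_distrib_left sum_distrib_right t_def ..
  also have "\<dots> = (\<Sum>k\<le>N. \<Sum>i\<le>N - k. t (k + i) k)" by (rule sum_triangle_swap)
  also have "\<dots> = jacobi_gf_coeff (g + c) b N y"
    unfolding jacobi_gf_coeff_def
  proof (intro sum.cong refl)
    fix k assume "k \<in> {..N}"
    define M where "M = N - k"
    have N: "N = k + M" using \<open>k \<in> _\<close> by (simp add: M_def)
    define g' where "g' = g + 2 * of_nat k"
    have "t (k + i) k = pochhammer (g + c) (N + k) / (pochhammer b k * fact k) * y ^ k *
       ((- 1) ^ i * (g' + 2 * of_nat i) * pochhammer (g' + c + of_nat M) i * pochhammer c (M - i) /
           (pochhammer (g' + of_nat i) (Suc M) * fact i * fact (M - i)))" if "i \<le> M" for i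
    proof -
      define K where "K = M - i"
      have M: "M = i + K" using that by (simp add: K_def)
      have s1: "N - (k + i) = K" "k + i - k = i" "M - i = K" by (auto simp: N M)
      have "pochhammer (g + c) (2 * (k + i)) * pochhammer (g + c + 2 * of_nat (k + i)) K = pochhammer (g + c) ((N + k) + i)"
      proof -
        have *: "(N + k) + i = 2 * (k + i) + K" by (simp add: N M)
        show ?thesis unfolding * pochhammer_product'[of "g + c" "2 * (k + i)" K] by simp
      qed
      also have "\<dots> = pochhammer (g + c) (N + k) * pochhammer (g' + c + of_nat M) i"
        unfolding pochhammer_product' by (simp add: g'_def N add_ac)
      finally have e1: "pochhammer (g + c) (2 * (k + i)) * pochhammer (g + c + 2 * of_nat (k + i)) K = pochhammer (g + c) (N + k) * pochhammer (g' + c + of_nat M) i" .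
      have "pochhammer g (2 * (k + i)) * ((g' + 2 * of_nat i) * pochhammer (g + 2 * of_nat (k + i) + 1) K) = pochhammer g (2 * (k + i) + Suc K)"
        unfolding pochhammer_product' pochhammer_rec by (simp add: g'_def algebra_simps)
      also have "2 * (k + i) + Suc K = (k + i + k) + Suc M" by (simp add: M)
      also have "pochhammer g \<dots> = pochhammer g (k + i + k) * pochhammer (g' + of_nat i) (Suc M)"
        unfolding pochhammer_product' by (simp add: g'_def algebra_simps)
      finally have e2: "pochhammer g (2 * (k + i)) * ((g' + 2 * of_nat i) * pochhammer (g + 2 * of_nat (k + i) + 1) K) = pochhammer g (k + i + k) * pochhammer (g' + of_nat i) (Suc M)" .
      define p where "p = pochhammer (g' + of_nat i) (Suc M)"
      define q where "q = pochhammer g (2 * (k + i))"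
      define r where "r = pochhammer (g + 2 * of_nat (k + i) + 1) K"
      have nz': "p \<noteq> 0" "q \<noteq> 0" "r \<noteq> 0"
        using nz[of "2 * k + i" "Suc M"] nz[of 0 "2 * (k + i)"] nz[of "2 * (k + i) + 1" K]
        by (simp_all add: p_def q_def r_def g'_def algebra_simps)
      have e2': "pochhammer g (k + i + k) / (q * r) = (g' + 2 * of_nat i) / p"
        using e2 nz' unfolding p_def[symmetric] q_def[symmetric] r_def[symmetric] by (simp add: field_simps)
      have "t (k + i) k = (pochhammer (g + c) (2 * (k + i)) * pochhammer (g + c + 2 * of_nat (k + i)) K) * (pochhammer g (k + i + k) / (q * r)) *
          ((- 1) ^ (k + i + k) / (pochhammer b k * fact k * fact i) * y ^ k * (pochhammer c K / fact K))"
        unfolding t_def s1 q_def[symmetric] r_def[symmetric] by (simp add: mult_ac)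
      also have "\<dots> = pochhammer (g + c) (N + k) / (pochhammer b k * fact k) * y ^ k *
       ((- 1) ^ i * (g' + 2 * of_nat i) * pochhammer (g' + c + of_nat M) i * pochhammer c K / (p * fact i * fact K))"
        unfolding e1 e2' by (simp add: power_add mult_ac flip: power_mult_distrib)
      finally show ?thesis by (simp only: p_def s1)
    qed
    then have "(\<Sum>i\<le>M. t (k + i) k) = pochhammer (g + c) (N + k) / (pochhammer b k * fact k) * y ^ k *
       (\<Sum>i\<le>M. (- 1) ^ i * (g' + 2 * of_nat i) * pochhammer (g' + c + of_nat M) i * pochhammer c (M - i) /
           (pochhammer (g' + of_nat i) (Suc M) * fact i * fact (M - i)))"
      unfolding sum_distrib_left by (intro sum.cong refl) auto
    also have "(\<Sum>i\<le>M. (- 1) ^ i * (g' + 2 * of_nat i) * pochhammer (g' + c + of_nat M) i * pochhammer c (M - i) /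
           (pochhammer (g' + of_nat i) (Suc M) * fact i * fact (M - i))) = (- 1) ^ M / fact M"
    proof (rule well_poised_sum)
      show "g' + of_nat i \<noteq> 0" for i using g[of "2 * k + i"] by (simp add: g'_def algebra_simps)
    qed
    finally have "(\<Sum>i\<le>N - k. t (k + i) k) = pochhammer (g + c) (N + k) / (pochhammer b k * fact k) * y ^ k * ((- 1) ^ M / fact M)"
      by (simp only: M_def)
    also have "\<dots> = (- 1) ^ (N + k) * pochhammer (g + c) (N + k) / (pochhammer b k * fact k * fact (N - k)) * y ^ k"
      by (simp add: N power_add mult_ac flip: power_mult_distrib)
    finally show "(\<Sum>i\<le>N - k. t (k + i) k) = (- 1) ^ (N + k) * pochhammer (g + c) (N + k) / (pochhammer b k * fact k * fact (N - k)) * y ^ k" .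
  qed
  finally show ?thesis .
qed

lemma fps_nth_mult_compose:
  fixes B F G :: "complex fps"
  assumes "fps_nth G 0 = 0"
  shows "fps_nth (B * fps_compose F G) N = (\<Sum>i\<le>N. fps_nth F i * fps_nth (B * G ^ i) N)"
proof -
  have "fps_nth (fps_compose F G) k = (\<Sum>i\<le>N. fps_nth F i * fps_nth (G ^ i) k)" if "k \<le> N" for k
    unfolding fps_compose_nth
    by (rule sum.mono_neutral_left) (use that startsby_zero_power_prefix[OF assms] in auto)
  then have "fps_nth (B * fps_compose F G) N = (\<Sum>j=0..N. \<Sum>i\<le>N. fps_nth B j * (fps_nth F i * fps_nth (G ^ i) (N - j)))"
    unfolding fps_mult_nth sum_distrib_left[symmetric] by (intro sum.cong) auto
  also have "\<dots> = (\<Sum>i\<le>N. \<Sum>j=0..N. fps_nth B j * (fps_nth F i * fps_nth (G ^ i) (N - j)))"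
    by (rule sum.swap)
  finally show ?thesis
    by (simp add: fps_mult_nth sum_distrib_left mult_ac)
qed

text \<open>
  The \<open>i\<close>-th term of the hypergeometric series contributes a multiple of
  \<open>r ^ i * (1 + r) powr (- l - 2 * i)\<close>, which the binomial series expands; the duplication
  formula merges the Pochhammer symbols of \<open>l / 2\<close> and \<open>(l + 1) / 2\<close>. Only the germ of \<open>f\<close> at
  \<open>0\<close> matters, so \<open>f\<close> can be the series or a continuation of it.
\<close>
lemma jacobi_gf_has_fps_expansion:
  fixes f :: "complex \<Rightarrow> complex"
  assumes f: "f has_fps_expansion hyp_fps (l / 2) ((l + 1) / 2) b"
  shows "(\<lambda>r. (1 + r) powr (- l) * f (4 * y * (r * (1 + r) powr (- 2)))) has_fps_expansion Abs_fps (\<lambda>N. jacobi_gf_coeff l b N y)"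
proof -
  define G where "G = fps_const (4 * y) * (fps_X * fps_binomial (- 2))"
  have G: "(\<lambda>r. 4 * y * (r * (1 + r) powr (- 2))) has_fps_expansion G"
    unfolding G_def by (intro fps_expansion_intros)
  have G0: "fps_nth G 0 = 0" by (simp add: G_def)
  have "(\<lambda>r. (1 + r) powr (- l) * (f \<circ> (\<lambda>r. 4 * y * (r * (1 + r) powr (- 2)))) r) has_fps_expansion
      fps_binomial (- l) * fps_compose (hyp_fps (l / 2) ((l + 1) / 2) b) G"
    by (intro has_fps_expansion_mult has_fps_expansion_binomial_complex has_fps_expansion_compose f G G0)
  also have "fps_binomial (- l) * fps_compose (hyp_fps (l / 2) ((l + 1) / 2) b) G = Abs_fps (\<lambda>N. jacobi_gf_coeff l b N y)"
  proof (rule fps_ext)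
    fix N
    have "fps_nth (hyp_fps (l / 2) ((l + 1) / 2) b) i * fps_nth (fps_binomial (- l) * G ^ i) N =
        (- 1) ^ (N + i) * pochhammer l (N + i) / (pochhammer b i * fact i * fact (N - i)) * y ^ i" if "i \<le> N" for i
    proof -
      define K where "K = N - i"
      have N: "N = i + K" using that by (simp add: K_def)
      have "fps_binomial (- l) * G ^ i = fps_const ((4 * y) ^ i) * (fps_X ^ i * fps_binomial (- l - 2 * of_nat i))"
        unfolding G_def power_mult_distrib fps_binomial_power fps_const_power
        using fps_binomial_add_mult[of "- l" "of_nat i * (- 2)"] by (simp add: mult_ac)
      then have "fps_nth (fps_binomial (- l) * G ^ i) N = (4 * y) ^ i * ((- l - 2 * of_nat i) gchoose K)"
        by (simp add: fps_X_power_mult_nth N)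
      also have "\<dots> = (4 * y) ^ i * ((- 1) ^ K * pochhammer (l + 2 * of_nat i) K / fact K)"
        by (simp add: gbinomial_pochhammer add.commute)
      finally have 1: "fps_nth (fps_binomial (- l) * G ^ i) N = (4 * y) ^ i * ((- 1) ^ K * pochhammer (l + 2 * of_nat i) K / fact K)" .
      have "pochhammer l (2 * i) = 4 ^ i * (pochhammer (l / 2) i * pochhammer ((l + 1) / 2) i)"
        using pochhammer_double[of "l / 2" i] by (simp add: power_mult add_divide_distrib)
      moreover have "pochhammer l (N + i) = pochhammer l (2 * i) * pochhammer (l + 2 * of_nat i) K"
      proof -
        have *: "N + i = 2 * i + K" by (simp add: N)
        show ?thesis unfolding * pochhammer_product'[of l "2 * i" K] by simp
      qed
      ultimately have 2: "pochhammer l (N + i) = 4 ^ i * (pochhammer (l / 2) i * pochhammer ((l + 1) / 2) i) * pochhammer (l + 2 * of_nat i) K"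
        by simp
      show ?thesis unfolding 1 2
        by (simp add: N power_mult_distrib power_add mult_ac flip: power_mult_distrib[of "- 1" "- 1"])
    qed
    then show "fps_nth (fps_binomial (- l) * fps_compose (hyp_fps (l / 2) ((l + 1) / 2) b) G) N = fps_nth (Abs_fps (\<lambda>N. jacobi_gf_coeff l b N y)) N"
      unfolding fps_nth_mult_compose[OF G0] fps_nth_Abs_fps jacobi_gf_coeff_def by (intro sum.cong) auto
  qed
  finally show ?thesis by (simp add: o_def)
qed

section \<open>Summation of the Legendre factors\<close>

text \<open>
  Derivatives at \<open>0\<close> commute with the uniform limit. The \<open>n\<close>-th summand vanishes to order \<open>n\<close>,
  so each coefficient of the limit is a finite sum, and no rearrangement of a double series
  is necessary.
\<close>
lemma has_fps_expansion_uniform_sums: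
  fixes f :: "nat \<Rightarrow> complex \<Rightarrow> complex"
  assumes r: "r > 0"
    and holo: "\<And>n. f n holomorphic_on ball 0 r"
    and fps: "\<And>n. f n has_fps_expansion \<Phi> n"
    and vanish: "\<And>n N. N < n \<Longrightarrow> fps_nth (\<Phi> n) N = 0"
    and lim: "uniform_limit (ball 0 r) (\<lambda>n x. \<Sum>i<n. f i x) F sequentially"
  shows "F has_fps_expansion Abs_fps (\<lambda>N. \<Sum>n\<le>N. fps_nth (\<Phi> n) N)"
proof -
  have holo': "(\<lambda>x. \<Sum>i<n. f i x) holomorphic_on ball 0 r" for n
    by (intro holomorphic_intros holo)
  have "F holomorphic_on ball 0 r"
  proof (rule holomorphic_uniform_sequence[OF open_ball holo'])
    fix x assume "x \<in> ball (0::complex) r"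
    then obtain d where d: "d > 0" "cball x d \<subseteq> ball 0 r"
      using open_contains_cball by blast
    then show "\<exists>d. 0 < d \<and> cball x d \<subseteq> ball 0 r \<and> uniform_limit (cball x d) (\<lambda>n x. \<Sum>i<n. f i x) F sequentially"
      using uniform_limit_on_subset[OF lim] by blast
  qed
  then have F: "F has_fps_expansion fps_expansion F 0"
    using r by (intro has_fps_expansion_fps_expansion[of "ball 0 r"]) auto
  have "fps_expansion F 0 = Abs_fps (\<lambda>N. \<Sum>n\<le>N. fps_nth (\<Phi> n) N)"
  proof (rule fps_ext)
    fix N
    have "(\<lambda>n. (deriv ^^ N) (\<lambda>x. \<Sum>i<n. f i x) 0 / fact N) \<longlonglongrightarrow> (deriv ^^ N) F 0 / fact N"
      using r by (intro tendsto_divide tendsto_const higher_deriv_complex_uniform_limit[OF lim] always_eventually allI holo') auto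
    moreover have "(deriv ^^ N) (\<lambda>x. \<Sum>i<n. f i x) 0 / fact N = (\<Sum>i<n. fps_nth (\<Phi> i) N)" for n
    proof -
      have "(\<lambda>x. \<Sum>i<n. f i x) has_fps_expansion (\<Sum>i<n. \<Phi> i)"
        by (intro has_fps_expansion_sum fps)
      from fps_nth_fps_expansion[OF this, of N] show ?thesis by (simp add: fps_sum_nth)
    qed
    moreover have "eventually (\<lambda>n. (\<Sum>i<n. fps_nth (\<Phi> i) N) = (\<Sum>n\<le>N. fps_nth (\<Phi> n) N)) sequentially"
      using eventually_gt_at_top[of N]
    proof eventually_elim
      case (elim n)
      then show ?case by (intro sum.mono_neutral_right) (auto simp: vanish)
    qed
    ultimately have "(deriv ^^ N) F 0 / fact N = (\<Sum>n\<le>N. fps_nth (\<Phi> n) N)"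
      by (simp add: tendsto_cong LIMSEQ_const_iff)
    then show "fps_nth (fps_expansion F 0) N = fps_nth (Abs_fps (\<lambda>N. \<Sum>n\<le>N. fps_nth (\<Phi> n) N)) N"
      by (simp add: fps_expansion_def)
  qed
  with F show ?thesis by simp
qed

lemma has_fps_expansion_inverse_one_minus_power:
  "(\<lambda>x::complex. inverse (1 - x) ^ p) has_fps_expansion Abs_fps (\<lambda>k. pochhammer (of_nat p) k / fact k)"
proof -
  have "((\<lambda>x::complex. (1 + x) powr (- of_nat p)) \<circ> (\<lambda>x. - x)) has_fps_expansion fps_compose (fps_binomial (- of_nat p)) (fps_const (- 1) * fps_X)"
  proof (intro has_fps_expansion_compose has_fps_expansion_binomial_complex)
    show "(\<lambda>x::complex. - x) has_fps_expansion fps_const (- 1) * fps_X"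
      using has_fps_expansion_cmult_left[OF has_fps_expansion_fps_X, of "-1::complex"] by simp
  qed simp
  also have "fps_compose (fps_binomial (- of_nat p)) (fps_const (- 1) * fps_X) = Abs_fps (\<lambda>k. pochhammer (of_nat p) k / fact k :: complex)"
    by (rule fps_ext) (simp add: fps_nth_compose_linear gbinomial_pochhammer flip: power_mult_distrib mult.assoc)
  finally have 1: "((\<lambda>x. (1 + x) powr (- of_nat p)) \<circ> (\<lambda>x. - x)) has_fps_expansion Abs_fps (\<lambda>k. pochhammer (of_nat p) k / fact k :: complex)" .
  have "eventually (\<lambda>x::complex. x \<in> ball 0 1) (nhds 0)" by (intro eventually_nhds_in_open) auto
  then have "eventually (\<lambda>x. ((\<lambda>x. (1 + x) powr (- of_nat p)) \<circ> (\<lambda>x. - x)) x = inverse (1 - x) ^ p) (nhds (0::complex))"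
  proof eventually_elim
    case (elim x)
    then have "1 - x \<noteq> 0" using one_plus_neq_0[of "- x"] by simp
    then show ?case by (simp add: powr_minus powr_nat' power_inverse)
  qed
  from 1 has_fps_expansion_cong[OF this refl] show ?thesis by blast
qed

text \<open>
  The function \<open>(1 - r) powr (- m) * \<^sub>2F\<^sub>1(m, 1 - m; c; - r / (1 - r))\<close>, whose series stops because \<open>m\<close>
  or \<open>1 - m\<close> is a nonpositive integer.
\<close>
definition legendre_factor :: "nat \<Rightarrow> complex \<Rightarrow> complex \<Rightarrow> complex" where
  "legendre_factor m c r = (\<Sum>l\<le>m. pochhammer (of_nat m) l * pochhammer (1 - of_nat m) l / (pochhammer c l * fact l) *
     ((- r) ^ l * inverse (1 - r) ^ (m + l)))"

lemma pochhammer_mult_one_minus_eq_0: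
  assumes "l > m"
  shows "pochhammer (of_nat m) l * pochhammer (1 - of_nat m :: complex) l = 0"
proof (cases m)
  case (Suc k)
  then show ?thesis using pochhammer_of_nat_eq_0_lemma[of k l, where ?'a = complex] assms by simp
qed (use assms in \<open>simp add: pochhammer_0_left\<close>)

lemma hyp2F1_eq_legendre_factor:
  assumes "r \<noteq> 1"
  shows "hyp2F1 (of_nat m) (1 - of_nat m) c (- r / (1 - r)) / (1 - r) ^ m = legendre_factor m c r"
proof -
  have np: "complex_of_nat m \<in> \<int>\<^sub>\<le>\<^sub>0 \<or> 1 - complex_of_nat m \<in> \<int>\<^sub>\<le>\<^sub>0"
  proof (cases m)
    case (Suc k)
    then have "1 - complex_of_nat m = - of_nat k" by simp
    then show ?thesis by (metis minus_of_nat_in_nonpos_Ints)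
  qed simp
  have "hyp2F1 (of_nat m) (1 - of_nat m) c (- r / (1 - r)) = gauss_series (of_nat m) (1 - of_nat m) c (- r / (1 - r))"
    using np by (simp add: hyp2F1_def)
  also have "\<dots> = (\<Sum>l\<le>m. pochhammer (of_nat m) l * pochhammer (1 - of_nat m) l / pochhammer c l * ((- r / (1 - r)) ^ l / fact l))"
    unfolding gauss_series_def by (rule suminf_finite) (use pochhammer_mult_one_minus_eq_0[of m] in \<open>auto simp: not_le\<close>)
  finally have F: "hyp2F1 (of_nat m) (1 - of_nat m) c (- r / (1 - r)) =
    (\<Sum>l\<le>m. pochhammer (of_nat m) l * pochhammer (1 - of_nat m) l / pochhammer c l * ((- r / (1 - r)) ^ l / fact l))" .
  show ?thesis
    unfolding legendre_factor_def F sum_divide_distrib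
  proof (intro sum.cong refl)
    fix l
    have "(- r / (1 - r)) ^ l / (1 - r) ^ m = (- r) ^ l * inverse (1 - r) ^ (m + l)"
      unfolding power_divide power_add power_inverse by (simp add: divide_inverse mult_ac)
    then show "pochhammer (of_nat m) l * pochhammer (1 - of_nat m) l / pochhammer c l * ((- r / (1 - r)) ^ l / fact l) / (1 - r) ^ m =
      pochhammer (of_nat m) l * pochhammer (1 - of_nat m) l / (pochhammer c l * fact l) * ((- r) ^ l * inverse (1 - r) ^ (m + l))"
      by (metis (no_types, lifting) divide_divide_eq_left mult.commute times_divide_eq_right)
  qed
qed

text \<open>
  By Pfaff's transformation the function is \<open>\<^sub>2F\<^sub>1(m, c + m - 1; c; r)\<close>. On the level of Taylor
  coefficients this is the Chu-Vandermonde sum.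
\<close>
lemma legendre_factor_has_fps_expansion:
  assumes c: "c \<notin> \<int>\<^sub>\<le>\<^sub>0"
  shows "legendre_factor m c has_fps_expansion
    Abs_fps (\<lambda>N. pochhammer (of_nat m) N * pochhammer (c + of_nat m - 1) N / (pochhammer c N * fact N))"
proof -
  define a where "a l = pochhammer (of_nat m) l * pochhammer (1 - of_nat m) l / (pochhammer c l * fact l) * (- 1) ^ l" for l
  define \<Phi> where "\<Phi> l = fps_const (a l) * (fps_X ^ l * Abs_fps (\<lambda>k. pochhammer (of_nat (m + l)) k / fact k))" for l
  have "(\<lambda>r. a l * (r ^ l * inverse (1 - r) ^ (m + l))) has_fps_expansion \<Phi> l" for l
    unfolding \<Phi>_def by (intro fps_expansion_intros has_fps_expansion_inverse_one_minus_power)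
  then have "(\<lambda>r. \<Sum>l\<le>m. a l * (r ^ l * inverse (1 - r) ^ (m + l))) has_fps_expansion (\<Sum>l\<le>m. \<Phi> l)"
    by (intro has_fps_expansion_sum)
  also have "(\<lambda>r. \<Sum>l\<le>m. a l * (r ^ l * inverse (1 - r) ^ (m + l))) = legendre_factor m c"
  proof (intro ext)
    fix r show "(\<Sum>l\<le>m. a l * (r ^ l * inverse (1 - r) ^ (m + l))) = legendre_factor m c r"
      unfolding legendre_factor_def a_def by (intro sum.cong refl) (simp add: power_minus[of r] mult_ac)
  qed
  also have "(\<Sum>l\<le>m. \<Phi> l) = Abs_fps (\<lambda>N. pochhammer (of_nat m) N * pochhammer (c + of_nat m - 1) N / (pochhammer c N * fact N))"
  proof (rule fps_ext)
    fix N
    have a0: "a l = 0" if "l > m" for l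
      unfolding a_def using pochhammer_mult_one_minus_eq_0[OF that] by simp
    have nth: "fps_nth (\<Phi> l) N = (if l \<le> N then a l * (pochhammer (of_nat (m + l)) (N - l) / fact (N - l)) else 0)" for l
      by (simp add: \<Phi>_def fps_X_power_mult_nth)
    have "fps_nth (\<Sum>l\<le>m. \<Phi> l) N = (\<Sum>l\<le>m. fps_nth (\<Phi> l) N)" by (simp add: fps_sum_nth)
    also have "\<dots> = (\<Sum>l\<le>max m N. fps_nth (\<Phi> l) N)"
      by (rule sum.mono_neutral_left) (auto simp: nth a0)
    also have "\<dots> = (\<Sum>l\<le>N. fps_nth (\<Phi> l) N)"
      by (rule sum.mono_neutral_right) (auto simp: nth)
    also have "\<dots> = (\<Sum>l\<le>N. pochhammer (of_nat m) N / fact N * (pochhammer (1 - of_nat m) l * pochhammer (- of_nat N) l / (of_nat (fact l) * pochhammer c l)))"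
    proof (intro sum.cong refl)
      fix l assume l: "l \<in> {..N}"
      have "pochhammer (of_nat m) N = pochhammer (of_nat m) l * pochhammer (of_nat (m + l) :: complex) (N - l)"
        using pochhammer_product[of l N "of_nat m :: complex"] l by simp
      then show "fps_nth (\<Phi> l) N = pochhammer (of_nat m) N / fact N * (pochhammer (1 - of_nat m) l * pochhammer (- of_nat N) l / (of_nat (fact l) * pochhammer c l))"
        using l by (simp add: nth a_def pochhammer_minus_of_nat mult_ac)
    qed
    also have "\<dots> = pochhammer (of_nat m) N / fact N * (pochhammer (c - (1 - of_nat m)) N / pochhammer c N)"
      unfolding sum_distrib_left[symmetric] atMost_atLeast0
    proof (subst Vandermonde_pochhammer)
      show "\<forall>i\<in>{0..<N}. c \<noteq> - of_nat i"
        using plus_of_nat_neq_0[OF c] by (metis add.left_inverse)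
    qed simp
    also have "\<dots> = pochhammer (of_nat m) N * pochhammer (c + of_nat m - 1) N / (pochhammer c N * fact N)"
      by (simp add: algebra_simps)
    finally show "fps_nth (\<Sum>l\<le>m. \<Phi> l) N = fps_nth (Abs_fps (\<lambda>N. pochhammer (of_nat m) N * pochhammer (c + of_nat m - 1) N / (pochhammer c N * fact N))) N"
      by simp
  qed
  finally show ?thesis .
qed

lemma norm_pochhammer_ge:
  fixes c d :: real
  assumes "0 < d" "d \<le> c"
  shows "d ^ l \<le> norm (pochhammer (complex_of_real c) l)"
proof (induction l)
  case (Suc l)
  have "norm (complex_of_real c + of_nat l) = c + real l"
    using assms by (metis add_nonneg_nonneg less_eq_real_def norm_of_real of_nat_0_le_iff of_real_add of_real_of_nat_eq abs_of_nonneg order_trans)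
  then have "d \<le> norm (complex_of_real c + of_nat l)" using assms by simp
  then show ?case
    using Suc assms unfolding pochhammer_Suc norm_mult power_Suc2 by (intro mult_mono) auto
qed simp

text \<open>
  The bound is uniform in \<open>c\<close> because \<open>c\<close> grows with the summation index of the expansion.
\<close>
lemma legendre_factor_bound:
  assumes "0 < d" "0 \<le> q" "q < 1"
  obtains K where "K \<ge> 0" "\<And>c (r::complex). d \<le> c \<Longrightarrow> norm r \<le> q \<Longrightarrow> norm (legendre_factor m (complex_of_real c) r) \<le> K"
proof
  let ?K = "\<Sum>l\<le>m. norm (pochhammer (of_nat m) l * pochhammer (1 - of_nat m :: complex) l) / (d ^ l * fact l) * (1 ^ l * inverse (1 - q) ^ (m + l))"
  show "?K \<ge> 0" using assms by (intro sum_nonneg) auto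
  fix c :: real and r :: complex assume c: "d \<le> c" and r: "norm r \<le> q"
  have "1 - q \<le> norm (1 - r)" using norm_triangle_ineq2[of 1 r] r by simp
  then have i: "inverse (norm (1 - r)) \<le> inverse (1 - q)" using assms by (intro le_imp_inverse_le) auto
  show "norm (legendre_factor m (complex_of_real c) r) \<le> ?K"
    unfolding legendre_factor_def
  proof (rule sum_norm_le)
    fix l
    show "norm (pochhammer (of_nat m) l * pochhammer (1 - of_nat m) l / (pochhammer (complex_of_real c) l * fact l) * ((- r) ^ l * inverse (1 - r) ^ (m + l)))
      \<le> norm (pochhammer (of_nat m) l * pochhammer (1 - of_nat m :: complex) l) / (d ^ l * fact l) * (1 ^ l * inverse (1 - q) ^ (m + l))"
      unfolding norm_mult[of "_ / _"] norm_divide norm_mult[of "pochhammer (complex_of_real c) l"] norm_mult[of "(- r) ^ l"] norm_power norm_inverse norm_fact norm_minus_cancel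
      using assms r i norm_pochhammer_ge[OF assms(1) c]
      by (intro mult_mono frac_le mult_right_mono power_mono mult_nonneg_nonneg mult_pos_pos divide_nonneg_nonneg) auto
  qed
qed

section \<open>Growth of the Jacobi polynomials\<close>

lemma power2_notin_nonpos_Reals:
  assumes "Re q > 0"
  shows "q\<^sup>2 \<notin> \<real>\<^sub>\<le>\<^sub>0"
proof
  assume "q\<^sup>2 \<in> \<real>\<^sub>\<le>\<^sub>0"
  then have "Im (q\<^sup>2) = 0" "Re (q\<^sup>2) \<le> 0" by (simp_all add: complex_nonpos_Reals_iff)
  moreover from this have "Im q = 0" using assms by (simp add: power2_eq_square)
  ultimately have "Re q * Re q \<le> 0" by (simp add: power2_eq_square)
  moreover have "Re q * Re q > 0" using assms by (intro mult_pos_pos)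
  ultimately show False by simp
qed

lemma Re_cayley_pos:
  assumes "norm r < 1"
  shows "Re ((1 - r) / (1 + r)) > 0"
proof -
  have "(norm r)\<^sup>2 < 1" using assms by (simp add: abs_square_less_1)
  then have "0 < (1 - Re r) * (1 + Re r) + - Im r * Im r"
    unfolding cmod_power2 by (simp add: power2_eq_square algebra_simps)
  moreover have "0 < (1 + Re r)\<^sup>2 + (Im r)\<^sup>2"
    using one_plus_neq_0[OF assms] by (auto simp: complex_eq_iff sum_power2_gt_zero_iff)
  ultimately show ?thesis by (simp add: Re_divide)
qed

text \<open>
  For \<open>t = 1\<close> this holds because \<open>1 - 4 * r / (1 + r)\<^sup>2\<close> is the square of \<open>(1 - r) / (1 + r)\<close>, a
  number with positive real part. The cut plane is star-shaped with respect to \<open>0\<close>, so factors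
  \<open>t \<le> 1\<close> do no harm.
\<close>
lemma unit_disc_into_cut_plane:
  assumes r: "norm r < 1" and t: "0 \<le> t" "t \<le> 1"
  shows "4 * of_real t * (r * (1 + r) powr (- 2)) \<notin> complex_of_real ` {1..}"
proof
  assume "4 * of_real t * (r * (1 + r) powr (- 2)) \<in> complex_of_real ` {1..}"
  then obtain v where v: "4 * of_real t * (r * (1 + r) powr (- 2)) = of_real v" "v \<ge> 1" by auto
  have nz: "1 + r \<noteq> 0" by (rule one_plus_neq_0[OF r])
  then have pw: "(1 + r) powr (- 2) = inverse ((1 + r)\<^sup>2)"
    using powr_nat'[of "1 + r" 2] by (simp add: powr_minus)
  have "t \<noteq> 0" using v by auto
  then have t0: "t > 0" using t by simp
  have "4 * (r * inverse ((1 + r)\<^sup>2)) = of_real (v / t)"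
    using v(1) \<open>t \<noteq> 0\<close> unfolding pw by (simp add: field_simps)
  moreover have "((1 - r) / (1 + r))\<^sup>2 = 1 - 4 * (r * inverse ((1 + r)\<^sup>2))"
  proof -
    define i where "i = inverse (1 + r)"
    have "i * (1 + r) = 1" using nz by (simp add: i_def)
    then have "((1 - r) * i)\<^sup>2 = 1 - 4 * (r * i\<^sup>2)" by algebra
    then show ?thesis by (simp add: i_def divide_inverse power_inverse)
  qed
  ultimately have "((1 - r) / (1 + r))\<^sup>2 = of_real (1 - v / t)" by simp
  moreover have "1 - v / t \<le> 0" using v(2) t t0 by (simp add: field_simps)
  ultimately have "((1 - r) / (1 + r))\<^sup>2 \<in> \<real>\<^sub>\<le>\<^sub>0" by (simp only: nonpos_Reals_of_real_iff)
  with power2_notin_nonpos_Reals[OF Re_cayley_pos[OF r]] show False by simp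
qed

lemma hyp2F1_has_fps_expansion:
  assumes "c \<notin> \<int>\<^sub>\<le>\<^sub>0"
  shows "hyp2F1 a b c has_fps_expansion hyp_fps a b c"
proof -
  have pos: "fps_conv_radius (hyp_fps a b c) > 0"
    using hyp_fps_conv_radius[of a b c] by (simp add: less_le_trans[of _ "1::ereal"])
  have "eventually (\<lambda>z::complex. z \<in> ball 0 1) (nhds 0)" by (intro eventually_nhds_in_open) auto
  then have "eventually (\<lambda>z. eval_fps (hyp_fps a b c) z = hyp2F1 a b c z) (nhds 0)"
    by eventually_elim (simp add: hyp2F1_cut_plane(2)[OF assms] gauss_series_eq_eval_fps)
  with pos show ?thesis by (simp add: has_fps_expansion_def)
qed

text \<open>
  For \<open>y\<close> in \<open>[0, 1]\<close> the generating function is holomorphic in the whole unit disc, by the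
  continuation of the Gauss series, and it is bounded on \<open>\<bar>r\<bar> \<le> r\<^sub>0 < 1\<close> uniformly in \<open>y\<close> by
  compactness. Cauchy's inequality then bounds its Taylor coefficients.
\<close>
lemma jacobi_gf_coeff_bound_unit_interval:
  assumes b: "b \<notin> \<int>\<^sub>\<le>\<^sub>0" and r: "0 < r" "r < 1"
  obtains M where "M \<ge> 0" "\<And>n t. 0 \<le> t \<Longrightarrow> t \<le> 1 \<Longrightarrow> norm (jacobi_gf_coeff l b n (of_real t)) \<le> M / r ^ n"
proof -
  define f where "f = hyp2F1 (l / 2) ((l + 1) / 2) b"
  have holo: "f holomorphic_on - (complex_of_real ` {1..})"
    unfolding f_def by (rule hyp2F1_cut_plane(1)[OF b])
  define A where "A t \<rho> = (1 + \<rho>) powr (- l) * f (4 * of_real t * (\<rho> * (1 + \<rho>) powr (- 2)))" for t :: real and \<rho>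
  have holo_A: "A t holomorphic_on ball 0 1" if t: "0 \<le> t" "t \<le> 1" for t
  proof -
    have "(f \<circ> (\<lambda>\<rho>. 4 * of_real t * (\<rho> * (1 + \<rho>) powr (- 2)))) holomorphic_on ball 0 1"
    proof (rule holomorphic_on_compose_gen[OF _ holo])
      show "(\<lambda>\<rho>. 4 * of_real t * (\<rho> * (1 + \<rho>) powr (- 2))) holomorphic_on ball 0 1"
        using one_plus_nonpos_Reals by (intro holomorphic_intros) auto
      show "(\<lambda>\<rho>. 4 * of_real t * (\<rho> * (1 + \<rho>) powr (- 2))) ` ball 0 1 \<subseteq> - (complex_of_real ` {1..})"
        by (rule image_subsetI, rule ComplI, rule notE[OF unit_disc_into_cut_plane[OF _ t]]) auto
    qed
    then show ?thesis
      unfolding A_def o_def using one_plus_nonpos_Reals by (intro holomorphic_intros) auto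
  qed
  have cont1: "continuous_on (cball 0 r \<times> {0..1}) (\<lambda>p. (1 + fst p) powr c)" for c :: complex
  proof -
    have "continuous_on (cball 0 r) (\<lambda>\<rho>. (1 + \<rho>) powr c)"
      using one_plus_nonpos_Reals r by (intro holomorphic_on_imp_continuous_on holomorphic_intros) auto
    then show ?thesis by (rule continuous_on_compose2) (auto intro!: continuous_intros)
  qed
  have cont: "continuous_on (cball 0 r \<times> {0..1}) (\<lambda>p. A (snd p) (fst p))"
    unfolding A_def
  proof (intro continuous_on_mult cont1)
    show "continuous_on (cball 0 r \<times> {0..1}) (\<lambda>p. f (4 * complex_of_real (snd p) * (fst p * (1 + fst p) powr (- 2))))"
    proof (rule continuous_on_compose2[OF holomorphic_on_imp_continuous_on[OF holo]])
      show "continuous_on (cball 0 r \<times> {0..1}) (\<lambda>p. 4 * complex_of_real (snd p) * (fst p * (1 + fst p) powr (- 2)))"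
        by (intro continuous_intros cont1)
      show "(\<lambda>p. 4 * complex_of_real (snd p) * (fst p * (1 + fst p) powr (- 2))) ` (cball 0 r \<times> {0..1}) \<subseteq> - (complex_of_real ` {1..})"
        by (rule image_subsetI, rule ComplI, rule notE[OF unit_disc_into_cut_plane]) (use r in auto)
    qed
  qed
  have "compact ((\<lambda>p. A (snd p) (fst p)) ` (cball 0 r \<times> {0..1}))"
    by (intro compact_continuous_image cont compact_Times) auto
  then obtain M where M: "\<And>p. p \<in> cball 0 r \<times> {0..1} \<Longrightarrow> norm (A (snd p) (fst p)) \<le> M"
    using compact_imp_bounded bounded_iff by (metis (no_types, lifting) image_eqI)
  have bound: "norm (jacobi_gf_coeff l b n (of_real t)) \<le> M / r ^ n" if t: "0 \<le> t" "t \<le> 1" for n t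
  proof -
    have "A t has_fps_expansion Abs_fps (\<lambda>N. jacobi_gf_coeff l b N (of_real t))"
      unfolding A_def f_def by (rule jacobi_gf_has_fps_expansion[OF hyp2F1_has_fps_expansion[OF b]])
    from fps_nth_fps_expansion[OF this, of n]
    have "jacobi_gf_coeff l b n (of_real t) = (deriv ^^ n) (A t) 0 / fact n" by simp
    moreover have "norm ((deriv ^^ n) (A t) 0) \<le> fact n * M / r ^ n"
    proof (rule Cauchy_inequality)
      show "A t holomorphic_on ball 0 r"
        by (rule holomorphic_on_subset[OF holo_A[OF t]]) (use r in auto)
      show "continuous_on (cball 0 r) (A t)"
        by (rule holomorphic_on_imp_continuous_on, rule holomorphic_on_subset[OF holo_A[OF t]]) (use r in auto)
      show "norm (A t x) \<le> M" if "norm (0 - x) = r" for x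
        using M[of "(x, t)"] that t by simp
    qed (use r in auto)
    ultimately have "norm (jacobi_gf_coeff l b n (of_real t)) \<le> (fact n * M / r ^ n) / fact n"
      by (simp only: norm_divide norm_fact) (rule divide_right_mono, auto)
    then show ?thesis by simp
  qed
  have "0 \<le> M" using M[of "(0, 0)"] r norm_ge_zero order.trans by (metis (mono_tags, lifting) SigmaI atLeastAtMost_iff centre_in_cball less_eq_real_def order_refl zero_le_one)
  with bound show ?thesis using that by blast
qed

text \<open>
  The Bernstein-Walsh inequality for the interval \<open>[0, 1]\<close>. With \<open>y = (1 + e)\<^sup>2 / (4 * e)\<close> the
  product of \<open>e ^ n\<close> and the polynomial in \<open>y\<close> is a polynomial in \<open>e\<close>. On the unit circle \<open>y\<close>
  runs through \<open>[0, 1]\<close>, and the maximum principle carries the bound into the disc.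
\<close>
lemma bernstein_walsh_unit_interval:
  fixes c :: "nat \<Rightarrow> complex" and e :: complex
  assumes B: "\<And>t. 0 \<le> t \<Longrightarrow> t \<le> 1 \<Longrightarrow> norm (\<Sum>k\<le>n. c k * of_real t ^ k) \<le> B"
    and e: "e \<noteq> 0" "norm e \<le> 1"
  shows "norm (\<Sum>k\<le>n. c k * ((1 + e)\<^sup>2 / (4 * e)) ^ k) \<le> B / norm e ^ n"
proof -
  define q where "q e = (\<Sum>k\<le>n. c k * ((1 + e)\<^sup>2 / 4) ^ k * e ^ (n - k))" for e
  have q: "q e = e ^ n * (\<Sum>k\<le>n. c k * ((1 + e)\<^sup>2 / (4 * e)) ^ k)" if "e \<noteq> 0" for e
    unfolding q_def sum_distrib_left
  proof (intro sum.cong refl)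
    fix k assume "k \<in> {..n}"
    then have n: "e ^ n = e ^ (n - k) * e ^ k" by (simp flip: power_add)
    have pw: "((1 + e)\<^sup>2 / (4 * e)) ^ k * e ^ k = ((1 + e)\<^sup>2 / 4) ^ k"
      using that by (simp flip: power_mult_distrib)
    show "c k * ((1 + e)\<^sup>2 / 4) ^ k * e ^ (n - k) = e ^ n * (c k * ((1 + e)\<^sup>2 / (4 * e)) ^ k)"
      unfolding n pw[symmetric] by (simp only: mult_ac)
  qed
  have "norm (q e) \<le> B"
  proof (rule maximum_modulus_frontier[of q "cball 0 1"])
    show "q holomorphic_on interior (cball 0 1)" unfolding q_def by (intro holomorphic_intros) auto
    show "continuous_on (closure (cball 0 1)) q" unfolding q_def by (intro continuous_intros) auto
    show "e \<in> cball 0 1" using e by simp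
  next
    fix u :: complex assume "u \<in> frontier (cball 0 1)"
    then have u: "norm u = 1" by simp
    then have u0: "u \<noteq> 0" by auto
    have "u * cnj u = 1" using u by (simp add: complex_norm_square[symmetric])
    then have "(1 + u)\<^sup>2 = u * (2 + (u + cnj u))" by (simp add: power2_eq_square algebra_simps)
    then have eq: "(1 + u)\<^sup>2 / (4 * u) = of_real ((1 + Re u) / 2)"
      using u0 by (simp add: complex_add_cnj field_simps)
    have "norm (\<Sum>k\<le>n. c k * of_real ((1 + Re u) / 2) ^ k) \<le> B"
      by (rule B) (use abs_Re_le_cmod[of u] u in auto)
    then show "norm (q u) \<le> B" unfolding q[OF u0] eq norm_mult norm_power u by simp
  qed auto
  then show ?thesis using q[OF e(1)] e by (simp add: norm_mult norm_power field_simps)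
qed

text \<open>
  A term of the expansion to be proved, as a function of \<open>y = (1 + x) / 2\<close> and of
  \<open>r = z - sqrt (z\<^sup>2 - 1)\<close>, without the common factor that does not depend on \<open>n\<close> and \<open>x\<close>.
\<close>
definition jacobi_gf_term :: "nat \<Rightarrow> real \<Rightarrow> complex \<Rightarrow> nat \<Rightarrow> complex \<Rightarrow> complex \<Rightarrow> complex" where
  "jacobi_gf_term m g b n y r = pochhammer (of_real g + of_nat m) (2 * n) / pochhammer (of_real g) (2 * n) *
     jacobi_gf_coeff (of_real g) b n y * (r ^ n * legendre_factor m (of_real (g + 2 * real n + 1)) r)"

lemma pochhammer_quotient_conv_radius:
  "conv_radius (\<lambda>n. pochhammer a (2 * n) / pochhammer c (2 * n) :: complex) \<ge> 1"
proof (rule two_term_recurrence_conv_radius)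
  fix n
  have d: "pochhammer z (2 * Suc n) = pochhammer z (2 * n) * (4 * (z / 2 + of_nat n) * ((z + 1) / 2 + of_nat n))" for z :: complex
    by (simp add: pochhammer_Suc field_simps)
  show "pochhammer a (2 * Suc n) / pochhammer c (2 * Suc n) =
    ((a / 2 + of_nat n) / (c / 2 + of_nat n) * (((a + 1) / 2 + of_nat n) / ((c + 1) / 2 + of_nat n))) * (pochhammer a (2 * n) / pochhammer c (2 * n))"
  proof -
    have "(u * (4 * x * y)) / (u' * (4 * x' * y')) = x / x' * (y / y') * (u / u')" for u u' x y x' y' :: complex
      by (simp add: mult_ac)
    then show ?thesis unfolding d .
  qed
next
  have "(\<lambda>n. (a / 2 + of_nat n) / (c / 2 + of_nat n) * (((a + 1) / 2 + of_nat n) / ((c + 1) / 2 + of_nat n))) \<longlonglongrightarrow> 1 * 1"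
    by (intro tendsto_mult tendsto_linear_quotient_1)
  then show "(\<lambda>n. (a / 2 + of_nat n) / (c / 2 + of_nat n) * (((a + 1) / 2 + of_nat n) / ((c + 1) / 2 + of_nat n))) \<longlonglongrightarrow> 1" by simp
qed

text \<open>
  If \<open>e\<close> is the Joukowski variable of \<open>x\<close> and \<open>\<bar>r\<bar> = q\<close>, the condition \<open>\<bar>e\<bar> \<ge> e0 > q\<close> says that
  \<open>x\<close> stays inside an ellipse that is smaller than that of \<open>z\<close>. The polynomial grows at most like
  \<open>(r1 * \<bar>e\<bar>) powr (- n)\<close> with \<open>r1\<close> arbitrarily close to \<open>1\<close>, so the terms decay geometrically
  up to the quotient of Pochhammer symbols, whose power series has radius of convergence at
  least \<open>1\<close>.
\<close>
lemma jacobi_gf_term_bound: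
  assumes g: "g > -1" and b: "b \<notin> \<int>\<^sub>\<le>\<^sub>0" and q: "0 \<le> q" "q < e0" "e0 \<le> 1"
  obtains T where "summable T"
    "\<And>n e r. norm r \<le> q \<Longrightarrow> e0 \<le> norm e \<Longrightarrow> norm e \<le> 1 \<Longrightarrow> norm (jacobi_gf_term m g b n ((1 + e)\<^sup>2 / (4 * e)) r) \<le> T n"
proof -
  have e0: "e0 > 0" using q by simp
  then have "q / e0 < 1" using q by simp
  then obtain r1 where r1: "q / e0 < r1" "r1 < 1" using dense by blast
  have "0 \<le> q / e0" using q e0 by simp
  then have r1_pos: "r1 > 0" using r1 by linarith
  obtain M where M: "M \<ge> 0" "\<And>n t. 0 \<le> t \<Longrightarrow> t \<le> 1 \<Longrightarrow> norm (jacobi_gf_coeff (of_real g) b n (of_real t)) \<le> M / r1 ^ n"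
    using jacobi_gf_coeff_bound_unit_interval[OF b r1_pos r1(2)] by blast
  obtain K where K: "K \<ge> 0" "\<And>c r. g + 1 \<le> c \<Longrightarrow> norm r \<le> q \<Longrightarrow> norm (legendre_factor m (complex_of_real c) r) \<le> K"
    using legendre_factor_bound[of "g + 1" q m] g q by (metis add.commute less_le_trans neg_less_iff_less real_0_less_add_iff)
  define E where "E n = pochhammer (of_real g + of_nat m) (2 * n) / pochhammer (of_real g :: complex) (2 * n)" for n
  define \<theta> where "\<theta> = q / (r1 * e0)"
  have \<theta>: "0 \<le> \<theta>" "\<theta> < 1" using r1 r1_pos e0 q by (auto simp: \<theta>_def field_simps)
  define T where "T n = M * K * norm (E n * of_real \<theta> ^ n)" for n
  have "summable T"
    unfolding T_def
  proof (intro summable_mult abs_summable_in_conv_radius)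
    have "ereal (norm (complex_of_real \<theta>)) < 1" using \<theta> by simp
    also have "1 \<le> conv_radius E" unfolding E_def by (rule pochhammer_quotient_conv_radius)
    finally show "ereal (norm (complex_of_real \<theta>)) < conv_radius E" .
  qed
  moreover have "norm (jacobi_gf_term m g b n ((1 + e)\<^sup>2 / (4 * e)) r) \<le> T n"
    if r: "norm r \<le> q" and e: "e0 \<le> norm e" "norm e \<le> 1" for n e r
  proof -
    have "e \<noteq> 0" using e e0 by auto
    have "norm (jacobi_gf_coeff (of_real g) b n ((1 + e)\<^sup>2 / (4 * e))) \<le> M / r1 ^ n / norm e ^ n"
      unfolding jacobi_gf_coeff_def
      by (rule bernstein_walsh_unit_interval[OF _ \<open>e \<noteq> 0\<close> e(2)]) (use M(2) in \<open>auto simp: jacobi_gf_coeff_def\<close>)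
    also have "\<dots> \<le> M / r1 ^ n / e0 ^ n"
      by (intro divide_left_mono power_mono mult_pos_pos) (use e e0 r1_pos M(1) \<open>e \<noteq> 0\<close> in auto)
    finally have 1: "norm (jacobi_gf_coeff (of_real g) b n ((1 + e)\<^sup>2 / (4 * e))) \<le> M / r1 ^ n / e0 ^ n" .
    have 2: "norm (legendre_factor m (of_real (g + 2 * real n + 1)) r) \<le> K"
      by (rule K(2)) (use r in auto)
    have "norm (jacobi_gf_term m g b n ((1 + e)\<^sup>2 / (4 * e)) r) =
       norm (E n) * norm (jacobi_gf_coeff (of_real g) b n ((1 + e)\<^sup>2 / (4 * e))) * (norm r ^ n * norm (legendre_factor m (of_real (g + 2 * real n + 1)) r))"
      unfolding jacobi_gf_term_def E_def[symmetric] by (simp add: norm_mult norm_power)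
    also have "\<dots> \<le> norm (E n) * (M / r1 ^ n / e0 ^ n) * (q ^ n * K)"
      using 1 2 r q M(1) K(1) r1_pos e0 by (intro mult_mono power_mono mult_nonneg_nonneg) auto
    also have "\<dots> = T n"
    proof -
      have "norm (E n * of_real \<theta> ^ n) = norm (E n) * \<theta> ^ n"
        using \<theta>(1) by (simp add: norm_mult norm_power)
      moreover have "\<theta> ^ n = q ^ n / (r1 ^ n * e0 ^ n)"
        by (simp add: \<theta>_def power_divide power_mult_distrib)
      ultimately show ?thesis by (simp add: T_def)
    qed
    finally show ?thesis .
  qed
  ultimately show ?thesis using that by blast
qed

section \<open>The Joukowski map and the sum for real arguments\<close>

text \<open>
  The Joukowski map \<open>e \<mapsto> (e + 1 / e) / 2\<close> sends circles around \<open>0\<close> to ellipses with foci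
  \<open>1\<close> and \<open>-1\<close>.
\<close>
lemma joukowski_foci:
  fixes e :: complex
  assumes "e \<noteq> 0" "2 * x * e = 1 + e\<^sup>2"
  shows "norm (x - 1) + norm (x + 1) = norm e + 1 / norm e"
proof -
  have "x - 1 = (e - 1)\<^sup>2 / (2 * e)" "x + 1 = (e + 1)\<^sup>2 / (2 * e)"
    using assms by (simp_all add: field_simps power2_eq_square)
  then have "norm (x - 1) + norm (x + 1) = ((norm (e - 1))\<^sup>2 + (norm (e + 1))\<^sup>2) / (2 * norm e)"
    by (simp add: norm_divide norm_power norm_mult add_divide_distrib)
  also have "(norm (e - 1))\<^sup>2 + (norm (e + 1))\<^sup>2 = 2 * (norm e)\<^sup>2 + 2"
    unfolding cmod_power2 by (simp add: power2_eq_square algebra_simps)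
  finally show ?thesis using assms(1) by (simp add: field_simps power2_eq_square)
qed

lemma joukowski_surj:
  fixes x :: complex
  obtains e where "e \<noteq> 0" "norm e \<le> 1" "2 * x * e = 1 + e\<^sup>2" "(1 + x) / 2 = (1 + e)\<^sup>2 / (4 * e)"
proof -
  define u where "u = x + csqrt (x\<^sup>2 - 1)"
  have u: "2 * x * u = 1 + u\<^sup>2"
    unfolding u_def using power2_csqrt[of "x\<^sup>2 - 1"] by algebra
  then have u0: "u \<noteq> 0" by auto
  define e where "e = (if norm u \<le> 1 then u else inverse u)"
  have e0: "e \<noteq> 0" using u0 by (simp add: e_def)
  moreover have "norm e \<le> 1"
    by (auto simp: e_def norm_inverse intro!: inverse_le_1_iff[THEN iffD2])
  moreover have e: "2 * x * e = 1 + e\<^sup>2"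
    using u u0 by (auto simp: e_def field_simps power2_eq_square)
  moreover have "(1 + x) / 2 = (1 + e)\<^sup>2 / (4 * e)"
  proof -
    have "(1 + x) * (4 * e) = (1 + e)\<^sup>2 * 2" using e by algebra
    then show ?thesis by (subst frac_eq_eq) (use e0 in auto)
  qed
  ultimately show ?thesis using that by blast
qed

text \<open>
  For \<open>t\<close> in \<open>[-1, 1]\<close> the Joukowski variable lies on the unit circle, so the terms are summable
  for every \<open>r\<close> in the unit disc. The Taylor coefficients of the sum are finite sums, which the
  connection formula evaluates.
\<close>
lemma jacobi_gf_sum:
  fixes g t :: real and m :: nat and b :: complex
  assumes g: "g > -1" "g \<noteq> 0" and b: "b \<notin> \<int>\<^sub>\<le>\<^sub>0" and t: "-1 \<le> t" "t \<le> 1"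
  defines "y \<equiv> (1 + complex_of_real t) / 2"
  defines "B \<equiv> (\<lambda>r. \<Sum>n. jacobi_gf_term m g b n y r)"
  shows "B holomorphic_on ball 0 1"
    and "B has_fps_expansion Abs_fps (\<lambda>N. jacobi_gf_coeff (of_real g + of_nat m) b N y)"
    and "norm r < 1 \<Longrightarrow> (\<lambda>n. jacobi_gf_term m g b n y r) sums B r"
proof -
  obtain e where e: "e \<noteq> 0" "norm e \<le> 1" "2 * complex_of_real t * e = 1 + e\<^sup>2" "y = (1 + e)\<^sup>2 / (4 * e)"
    unfolding y_def by (rule joukowski_surj)
  have "norm (complex_of_real t - 1) + norm (complex_of_real t + 1) = 2"
  proof -
    have "norm (complex_of_real t - 1) = \<bar>t - 1\<bar>" "norm (complex_of_real t + 1) = \<bar>t + 1\<bar>"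
      by (metis norm_of_real of_real_1 of_real_diff, metis norm_of_real of_real_1 of_real_add)
    then show ?thesis using t by simp
  qed
  then have "norm e + 1 / norm e = 2" using joukowski_foci[OF e(1,3)] by simp
  then have "(norm e - 1)\<^sup>2 = 0" using e(1) by (simp add: field_simps power2_eq_square)
  then have e1: "norm e = 1" by simp
  have bound: "\<exists>T. summable T \<and> (\<forall>n r. norm r \<le> q \<longrightarrow> norm (jacobi_gf_term m g b n y r) \<le> T n)" if "0 \<le> q" "q < 1" for q
    using jacobi_gf_term_bound[OF g(1) b that order.refl, of m] e1 unfolding e(4) by (metis order.refl)
  have lim: "uniform_limit (ball 0 q) (\<lambda>n r. \<Sum>i<n. jacobi_gf_term m g b i y r) B sequentially" if q: "0 \<le> q" "q < 1" for q
  proof -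
    obtain T where "summable T" "\<And>n r. norm r \<le> q \<Longrightarrow> norm (jacobi_gf_term m g b n y r) \<le> T n"
      using bound[OF q] by blast
    then show ?thesis unfolding B_def by (intro Weierstrass_m_test[where M = T]) auto
  qed
  have lf_fps: "legendre_factor m (of_real (g + 2 * real n + 1)) has_fps_expansion
      Abs_fps (\<lambda>N. pochhammer (of_nat m) N * pochhammer (of_real (g + 2 * real n + 1) + of_nat m - 1) N /
        (pochhammer (of_real (g + 2 * real n + 1)) N * fact N))" for n
  proof (rule legendre_factor_has_fps_expansion)
    show "complex_of_real (g + 2 * real n + 1) \<notin> \<int>\<^sub>\<le>\<^sub>0"
      using of_real_plus_one_notin_nonpos_Ints[of "g + 2 * real n"] g by simp
  qed
  have holo: "jacobi_gf_term m g b n y holomorphic_on ball 0 1" for n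
    unfolding jacobi_gf_term_def legendre_factor_def
    by (intro holomorphic_intros) auto
  have holo': "(\<lambda>r. \<Sum>i<n. jacobi_gf_term m g b i y r) holomorphic_on ball 0 1" for n
    by (intro holomorphic_intros holo)
  show "B holomorphic_on ball 0 1"
  proof (rule holomorphic_uniform_sequence[OF open_ball holo'])
    fix x :: complex assume "x \<in> ball 0 1"
    then have x: "norm x < 1" by simp
    define d where "d = (1 - norm x) / 3"
    have d: "d > 0" "norm x + 2 * d < 1" using x by (auto simp: d_def field_simps)
    have "cball x d \<subseteq> ball 0 (norm x + 2 * d)"
    proof
      fix u assume "u \<in> cball x d"
      then have "norm (u - x) \<le> d" by (simp add: dist_norm norm_minus_commute)
      then show "u \<in> ball 0 (norm x + 2 * d)" using norm_triangle_sub[of u x] d by simp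
    qed
    moreover have "ball 0 (norm x + 2 * d) \<subseteq> ball (0::complex) 1" using d by auto
    moreover have "uniform_limit (ball 0 (norm x + 2 * d)) (\<lambda>n r. \<Sum>i<n. jacobi_gf_term m g b i y r) B sequentially"
      by (rule lim) (use d x in auto)
    ultimately show "\<exists>d>0. cball x d \<subseteq> ball 0 1 \<and> uniform_limit (cball x d) (\<lambda>n r. \<Sum>i<n. jacobi_gf_term m g b i y r) B sequentially"
      using d(1) uniform_limit_on_subset by (intro exI[of _ d]) blast
  qed
  show "(\<lambda>n. jacobi_gf_term m g b n y r) sums B r" if r: "norm r < 1" for r
  proof -
    obtain T where T: "summable T" "\<forall>n u. norm u \<le> norm r \<longrightarrow> norm (jacobi_gf_term m g b n y u) \<le> T n"
      using bound[OF norm_ge_zero r] by blast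
    have "norm (jacobi_gf_term m g b n y r) \<le> T n" for n using T(2) by blast
    then have "summable (\<lambda>n. jacobi_gf_term m g b n y r)"
      by (rule summable_comparison_test'[OF T(1)])
    then show ?thesis unfolding B_def by (rule summable_sums)
  qed
  define \<Phi> where "\<Phi> n = fps_const (pochhammer (of_real g + of_nat m) (2 * n) / pochhammer (of_real g) (2 * n) * jacobi_gf_coeff (of_real g) b n y) *
    (fps_X ^ n * Abs_fps (\<lambda>N. pochhammer (of_nat m) N * pochhammer (of_real (g + 2 * real n + 1) + of_nat m - 1) N /
        (pochhammer (of_real (g + 2 * real n + 1)) N * fact N)))" for n
  have "B has_fps_expansion Abs_fps (\<lambda>N. \<Sum>n\<le>N. fps_nth (\<Phi> n) N)"
  proof (rule has_fps_expansion_uniform_sums[of "1/2" "\<lambda>n. jacobi_gf_term m g b n y"])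
    show "jacobi_gf_term m g b n y holomorphic_on ball 0 (1/2)" for n
      by (rule holomorphic_on_subset[OF holo]) auto
    show "jacobi_gf_term m g b n y has_fps_expansion \<Phi> n" for n
      unfolding \<Phi>_def jacobi_gf_term_def[abs_def] by (intro fps_expansion_intros lf_fps)
    show "fps_nth (\<Phi> n) N = 0" if "N < n" for n N
      using that by (simp add: \<Phi>_def fps_X_power_mult_nth)
    show "uniform_limit (ball 0 (1/2)) (\<lambda>n r. \<Sum>i<n. jacobi_gf_term m g b i y r) B sequentially"
      by (rule lim) auto
  qed simp
  also have "(\<lambda>N. \<Sum>n\<le>N. fps_nth (\<Phi> n) N) = (\<lambda>N. jacobi_gf_coeff (of_real g + of_nat m) b N y)"
  proof
    fix N
    have "g \<noteq> - real i" for i using g by (cases i) auto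
    then have gi: "of_real g + of_nat i \<noteq> (0::complex)" for i
      by (metis add_eq_0_iff2 of_real_add of_real_eq_0_iff of_real_of_nat_eq)
    show "(\<Sum>n\<le>N. fps_nth (\<Phi> n) N) = jacobi_gf_coeff (of_real g + of_nat m) b N y"
      unfolding jacobi_gf_coeff_connection[OF gi, of "of_nat m" b, symmetric]
      by (intro sum.cong refl) (simp add: \<Phi>_def fps_X_power_mult_nth add_ac)
  qed
  finally show "B has_fps_expansion Abs_fps (\<lambda>N. jacobi_gf_coeff (of_real g + of_nat m) b N y)" .
qed

section \<open>The Szego variable\<close>

lemma slit_plane_minus_notin_nonpos_Reals:
  assumes "z \<notin> complex_of_real ` {..1}" "c \<le> 1"
  shows "z - of_real c \<notin> \<real>\<^sub>\<le>\<^sub>0"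
proof
  assume "z - of_real c \<in> \<real>\<^sub>\<le>\<^sub>0"
  then obtain x where "z - of_real c = of_real x" "x \<le> 0" by (auto elim: nonpos_Reals_cases)
  then have "z = of_real (x + c)" "x + c \<in> {..1}" using assms(2) by (auto simp: algebra_simps)
  with assms(1) show False by blast
qed

definition szego :: "complex \<Rightarrow> complex" where
  "szego z = z - sqrt_sq_minus_one z"

text \<open>
  Put \<open>p = sqrt (z - 1)\<close> and \<open>q = sqrt (z + 1)\<close>. Then \<open>szego z\<close> is \<open>(q - p) / (q + p)\<close>, which is
  also \<open>2 / (p + q)\<^sup>2\<close>. The principal roots \<open>p\<close> and \<open>q\<close> have positive real parts and imaginary
  parts of the same sign, so \<open>Re (q * cnj p) > 0\<close>; this gives the first claim, and
  \<open>Re (p + q) > 0\<close> gives the second.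
\<close>
lemma szego_slit_plane:
  assumes z: "z \<notin> complex_of_real ` {..1}"
  shows "norm (szego z) < 1" "szego z \<notin> \<real>\<^sub>\<le>\<^sub>0" "2 * z * szego z = 1 + (szego z)\<^sup>2"
    "csqrt ((z + 1) / (z - 1)) = (1 + szego z) / (1 - szego z)"
proof -
  define p q where "p = csqrt (z - 1)" and "q = csqrt (z + 1)"
  note np = slit_plane_minus_notin_nonpos_Reals[OF z]
  have Re: "Re p > 0" "Re q > 0"
    using Re_csqrt_pos[OF np[of 1]] Re_csqrt_pos[OF np[of "-1"]] by (simp_all add: p_def q_def del: csqrt.sel)
  have sq: "p\<^sup>2 = z - 1" "q\<^sup>2 = z + 1" by (simp_all add: p_def q_def)
  have "Im (p\<^sup>2) = Im z" "Im (q\<^sup>2) = Im z" by (simp_all add: sq)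
  then have "2 * (Im p * Re p) = Im z" "2 * (Im q * Re q) = Im z" by (simp_all add: power2_eq_square)
  moreover have "(4 * (Re p * Re q)) * (Im p * Im q) = (2 * (Im p * Re p)) * (2 * (Im q * Re q))" by simp
  ultimately have "(4 * (Re p * Re q)) * (Im p * Im q) = Im z * Im z" by (simp only:)
  moreover have "Re p * Re q > 0" using Re by simp
  ultimately have "Im p * Im q \<ge> 0"
    by (metis mult_pos_pos zero_le_mult_iff zero_less_numeral not_less zero_le_square)
  then have pos: "Re p * Re q + Im p * Im q > 0" using \<open>Re p * Re q > 0\<close> by simp
  have Re_pq: "Re (p + q) > 0" using Re by simp
  then have pq: "p + q \<noteq> 0" by (metis less_irrefl zero_complex.sel(1))
  have r: "szego z = z - p * q" by (simp add: szego_def sqrt_sq_minus_one_def p_def q_def)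
  have r1: "szego z * (p + q) = q - p" unfolding r using sq by algebra
  have "(norm (q - p))\<^sup>2 < (norm (p + q))\<^sup>2"
    unfolding cmod_power2 using pos by (simp add: power2_eq_square algebra_simps)
  then have "norm (q - p) < norm (p + q)" by (rule power_less_imp_less_base) simp
  then have "norm (szego z) * norm (p + q) < 1 * norm (p + q)" unfolding norm_mult[symmetric] r1 by simp
  then show n: "norm (szego z) < 1" by (rule mult_right_less_imp_less) simp
  have r2: "szego z * (p + q)\<^sup>2 = 2" using r1 sq by algebra
  show "szego z \<notin> \<real>\<^sub>\<le>\<^sub>0"
  proof
    assume "szego z \<in> \<real>\<^sub>\<le>\<^sub>0"
    then obtain x where x: "szego z = of_real x" "x \<le> 0" by (auto elim: nonpos_Reals_cases)
    have "x \<noteq> 0" using r2 x by auto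
    then have "(p + q)\<^sup>2 = of_real (2 / x)" using r2 x by (simp add: field_simps)
    moreover have "2 / x \<le> 0" using x by (simp add: divide_nonneg_nonpos)
    ultimately have "(p + q)\<^sup>2 \<in> \<real>\<^sub>\<le>\<^sub>0" by (simp only: nonpos_Reals_of_real_iff)
    with power2_notin_nonpos_Reals[OF Re_pq] show False by simp
  qed
  show "2 * z * szego z = 1 + (szego z)\<^sup>2" unfolding r using sq by algebra
  have nz: "1 - szego z \<noteq> 0" using one_plus_neq_0[of "- szego z"] n by simp
  have z1: "z - 1 \<noteq> 0" using z by auto
  show "csqrt ((z + 1) / (z - 1)) = (1 + szego z) / (1 - szego z)"
  proof (rule csqrt_unique)
    have "(1 + szego z)\<^sup>2 * (z - 1) = (z + 1) * (1 - szego z)\<^sup>2" unfolding r using sq by algebra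
    then show "((1 + szego z) / (1 - szego z))\<^sup>2 = (z + 1) / (z - 1)"
      using nz z1 by (simp add: power_divide frac_eq_eq)
    show "0 < Re ((1 + szego z) / (1 - szego z)) \<or> Re ((1 + szego z) / (1 - szego z)) = 0 \<and> 0 \<le> Im ((1 + szego z) / (1 - szego z))"
      using Re_cayley_pos[of "- szego z"] n by simp
  qed
qed

lemma gt_minus_one_notin_nonpos_Ints:
  fixes g :: real
  assumes "g > -1" "g \<noteq> 0"
  shows "g \<notin> \<int>\<^sub>\<le>\<^sub>0"
  using assms by (auto elim!: nonpos_Ints_cases)

text \<open>
  For \<open>w = (1 + r) / (1 - r)\<close> one has \<open>(w + 1) / (w - 1) = 1 / r\<close> and
  \<open>(1 - w) / 2 = - r / (1 - r)\<close>.
\<close>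
lemma legendre_P_szego:
  assumes r: "norm r < 1" "r \<notin> \<real>\<^sub>\<le>\<^sub>0"
  shows "legendre_P (- of_nat m) (- of_real a) ((1 + r) / (1 - r)) / (1 - r) ^ m =
    r powr (of_real a / 2) / of_real (Gamma (1 + a)) * legendre_factor m (of_real (1 + a)) r"
proof -
  have r0: "r \<noteq> 0" using r by auto
  have nz: "1 - r \<noteq> 0" using one_plus_neq_0[of "- r"] r by simp
  have f1: "((1 + r) / (1 - r) + 1) / ((1 + r) / (1 - r) - 1) = inverse r"
  proof -
    have "(1 + r) / (1 - r) + 1 = 2 / (1 - r)" "(1 + r) / (1 - r) - 1 = 2 * r / (1 - r)"
      using nz by (simp_all add: field_simps)
    moreover have "(2 / u) / (2 * r / u) = inverse r" if "u \<noteq> 0" for u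
      using that r0 by (simp add: field_simps)
    ultimately show ?thesis using nz by (simp only: not_False_eq_True)
  qed
  have f2: "(1 - (1 + r) / (1 - r)) / 2 = - r / (1 - r)" using nz by (simp add: field_simps)
  have f3: "inverse r powr (- of_real a / 2) = r powr (of_real a / 2)"
    using r0 r(2) by (simp add: powr_def Ln_inverse)
  have "legendre_P (- of_nat m) (- of_real a) ((1 + r) / (1 - r)) =
     1 / Gamma (of_real (1 + a)) * r powr (of_real a / 2) * hyp2F1 (of_nat m) (1 - of_nat m) (of_real (1 + a)) (- r / (1 - r))"
    unfolding legendre_P_def f1 f2 f3 by simp
  moreover have "legendre_factor m (of_real (1 + a)) r = hyp2F1 (of_nat m) (1 - of_nat m) (of_real (1 + a)) (- r / (1 - r)) / (1 - r) ^ m"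
    by (rule hyp2F1_eq_legendre_factor[symmetric]) (use nz in auto)
  ultimately show ?thesis
    by (simp add: Gamma_complex_of_real del: of_real_add)
qed

text \<open>
  With the Gamma functions written as Pochhammer symbols times \<open>Gamma g\<close> and \<open>Gamma (\<beta> + 1)\<close>, the
  factor \<open>2 * n + g\<close> cancels and there remains the quotient \<open>(g + m)\<^sub>2\<^sub>n / (g)\<^sub>2\<^sub>n\<close> times the factor
  \<open>(g)\<^sub>n / (\<beta> + 1)\<^sub>n\<close> that turns the Jacobi polynomial into \<open>jacobi_gf_coeff\<close>.
\<close>
lemma jacobi_coeff_mult_jacobi_P:
  fixes \<alpha> \<beta> :: real
  assumes \<alpha>: "\<alpha> > -1" and \<beta>: "\<beta> > -1" and g0: "\<alpha> + \<beta> + 1 > -1" "\<alpha> + \<beta> + 1 \<noteq> 0" and z: "z \<notin> complex_of_real ` {..1}"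
  defines "g \<equiv> \<alpha> + \<beta> + 1"
  shows "jacobi_coeff n m \<alpha> \<beta> z * jacobi_P n \<alpha> \<beta> x =
    of_real (2 powr ((\<alpha> + m + 1 - \<beta>) / 2) / Gamma (\<beta> + 1)) * szego z powr of_real ((g + m) / 2) *
    jacobi_gf_term m g (of_real \<beta> + 1) n ((1 + x) / 2) (szego z)"
proof -
  define r where "r = szego z"
  have r: "norm r < 1" "r \<notin> \<real>\<^sub>\<le>\<^sub>0" using szego_slit_plane[OF z] by (auto simp: r_def)
  have r0: "r \<noteq> 0" using r by auto
  define R where "R = (2 * real n + \<alpha> + \<beta> + 1) * Gamma (\<alpha> + \<beta> + real n + 1) * pochhammer (\<alpha> + \<beta> + real m + 1) (2 * n) /
        (2 powr ((\<beta> - \<alpha> - real m - 1) / 2) * Gamma (\<beta> + real n + 1))"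
  define K where "K = 2 powr ((\<alpha> + m + 1 - \<beta>) / 2) / Gamma (\<beta> + 1)"
  have R: "R / Gamma (1 + (g + 2 * real n)) = K * (pochhammer (g + m) (2 * n) / pochhammer g (2 * n) * (pochhammer g n / pochhammer (\<beta> + 1) n))"
  proof -
    have g_np: "g \<notin> \<int>\<^sub>\<le>\<^sub>0" using g0 unfolding g_def by (intro gt_minus_one_notin_nonpos_Ints)
    have b_np: "\<beta> + 1 \<notin> \<int>\<^sub>\<le>\<^sub>0" using \<beta> by (auto dest: nonpos_Ints_nonpos)
    have Gg: "Gamma g \<noteq> 0" using g_np by (simp add: Gamma_eq_zero_iff)
    have Gb: "Gamma (\<beta> + 1) \<noteq> 0" using b_np by (simp add: Gamma_eq_zero_iff)
    have 1: "Gamma (\<alpha> + \<beta> + real n + 1) = pochhammer g n * Gamma g"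
      using pochhammer_Gamma[OF g_np, of n] Gg by (simp add: g_def field_simps)
    have 2: "Gamma (\<beta> + real n + 1) = pochhammer (\<beta> + 1) n * Gamma (\<beta> + 1)"
      using pochhammer_Gamma[OF b_np, of n] Gb by (simp add: field_simps)
    have 3: "Gamma (1 + (g + 2 * real n)) = pochhammer g (2 * n) * (g + 2 * real n) * Gamma g"
      using pochhammer_Gamma[OF g_np, of "Suc (2 * n)"] Gg by (simp add: pochhammer_Suc field_simps)
    have "g + 2 * real n \<noteq> 0" using g0 by (cases n) (auto simp: g_def)
    have 4: "2 * real n + \<alpha> + \<beta> + 1 = g + 2 * real n" "\<alpha> + \<beta> + real m + 1 = g + m" by (simp_all add: g_def)
    have "(\<beta> - \<alpha> - real m - 1) / 2 = - ((\<alpha> + m + 1 - \<beta>) / 2)" by (simp add: field_simps)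
    then have 5: "2 powr ((\<beta> - \<alpha> - real m - 1) / 2) = inverse (2 powr ((\<alpha> + m + 1 - \<beta>) / 2))"
      by (simp only: powr_minus)
    show ?thesis unfolding R_def K_def 1 2 3 4 5 using Gg \<open>g + 2 * real n \<noteq> 0\<close> by (simp add: divide_simps)
  qed
  have L: "legendre_P (- of_nat m) (- of_real (g + 2 * real n)) ((1 + r) / (1 - r)) / (1 - r) ^ m =
     r powr (of_real (g + 2 * real n) / 2) / of_real (Gamma (1 + (g + 2 * real n))) * legendre_factor m (of_real (1 + (g + 2 * real n))) r"
    by (rule legendre_P_szego[OF r])
  have pw: "r powr (of_nat m / 2) * r powr (of_real (g + 2 * real n) / 2) = r powr of_real ((g + m) / 2) * r ^ n"
  proof -
    have "of_nat m / 2 + of_real (g + 2 * real n) / 2 = of_real ((g + m) / 2) + (of_nat n :: complex)"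
      by (simp add: field_simps)
    then have "r powr (of_nat m / 2) * r powr (of_real (g + 2 * real n) / 2) = r powr of_real ((g + m) / 2) * r powr of_nat n"
      by (simp only: powr_add[symmetric])
    also have "r powr of_nat n = r ^ n" using r0 by (simp add: powr_nat')
    finally show ?thesis .
  qed
  have r': "1 - z + sqrt_sq_minus_one z = 1 - r" "z - sqrt_sq_minus_one z = r" by (simp_all add: r_def szego_def)
  have mu: "complex_of_real (- \<alpha> - \<beta> - 2 * real n - 1) = - of_real (g + 2 * real n)" by (simp add: g_def)
  have "jacobi_coeff n m \<alpha> \<beta> z = of_real R * (r powr (of_nat m / 2)) * (legendre_P (- of_nat m) (- of_real (g + 2 * real n)) ((1 + r) / (1 - r)) / (1 - r) ^ m)"
    unfolding jacobi_coeff_def R_def[symmetric] r' szego_slit_plane(4)[OF z] r_def[symmetric] mu[symmetric] by simp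
  also have "\<dots> = of_real (R / Gamma (1 + (g + 2 * real n))) * (r powr (of_nat m / 2) * r powr (of_real (g + 2 * real n) / 2)) * legendre_factor m (of_real (1 + (g + 2 * real n))) r"
    unfolding L by simp
  finally have J: "jacobi_coeff n m \<alpha> \<beta> z = of_real K * (pochhammer (of_real g + of_nat m) (2 * n) / pochhammer (of_real g) (2 * n) * (pochhammer (of_real g) n / pochhammer (of_real \<beta> + 1) n)) *
     (r powr of_real ((g + m) / 2) * r ^ n) * legendre_factor m (of_real (1 + (g + 2 * real n))) r"
    unfolding R pw by (simp add: pochhammer_of_real[symmetric])
  have P: "pochhammer (of_real g) n / pochhammer (of_real \<beta> + 1) n * jacobi_P n \<alpha> \<beta> x = jacobi_gf_coeff (of_real g) (of_real \<beta> + 1) n ((1 + x) / 2)"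
    using jacobi_P_eq_jacobi_gf_coeff[OF \<alpha> \<beta>, of n x] by (simp add: g_def)
  show ?thesis
    unfolding J jacobi_gf_term_def P[symmetric] r_def[symmetric] K_def[symmetric] by (simp add: add_ac mult_ac)
qed

section \<open>The generating function as a function of z\<close>

text \<open>
  Off the slit neither the power nor the hypergeometric function meets its branch cut:
  \<open>(w + 1) / (w - 1) \<le> 0\<close> and \<open>(1 - w) / 2 \<ge> 1\<close> both force \<open>w\<close> to be real with \<open>w \<le> 1\<close>.
\<close>
lemma legendre_P_holomorphic_on:
  assumes "1 - \<mu> \<notin> \<int>\<^sub>\<le>\<^sub>0"
  shows "legendre_P \<nu> \<mu> holomorphic_on - (complex_of_real ` {..1})"
proof -
  let ?D = "- (complex_of_real ` {..1})"
  have "(w + 1) / (w - 1) \<notin> \<real>\<^sub>\<le>\<^sub>0 \<and> w - 1 \<noteq> 0" if "w \<in> ?D" for w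
  proof
    show "w - 1 \<noteq> 0" using that by auto
    show "(w + 1) / (w - 1) \<notin> \<real>\<^sub>\<le>\<^sub>0"
    proof
      assume "(w + 1) / (w - 1) \<in> \<real>\<^sub>\<le>\<^sub>0"
      then obtain k where k: "(w + 1) / (w - 1) = of_real k" "k \<le> 0" by (auto elim: nonpos_Reals_cases)
      then have "w + 1 = of_real k * (w - 1)" using \<open>w - 1 \<noteq> 0\<close> by (simp add: field_simps)
      then have "w * of_real (1 - k) = of_real (- (1 + k))" by (simp add: algebra_simps)
      moreover have "complex_of_real (1 - k) \<noteq> 0" using k(2) by (simp del: of_real_diff)
      ultimately have "w = of_real (- (1 + k) / (1 - k))"
        by (simp only: of_real_divide eq_divide_eq) simp
      moreover have "- (1 + k) / (1 - k) \<le> 1" using k(2) by (simp add: field_simps)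
      ultimately show False using that by blast
    qed
  qed
  moreover have "(\<lambda>w. hyp2F1 (- \<nu>) (\<nu> + 1) (1 - \<mu>) ((1 - w) / 2)) holomorphic_on ?D"
  proof -
    have "(hyp2F1 (- \<nu>) (\<nu> + 1) (1 - \<mu>) \<circ> (\<lambda>w. (1 - w) / 2)) holomorphic_on ?D"
    proof (rule holomorphic_on_compose_gen[OF _ hyp2F1_cut_plane(1)[OF assms]])
      show "(\<lambda>w. (1 - w) / 2) ` ?D \<subseteq> - (complex_of_real ` {1..})"
      proof (rule image_subsetI, rule ComplI)
        fix w assume w: "w \<in> ?D" and "(1 - w) / 2 \<in> complex_of_real ` {1..}"
        then obtain v where "(1 - w) / 2 = of_real v" "v \<ge> 1" by auto
        then have "w = of_real (1 - 2 * v)" "1 - 2 * v \<le> 1" by (auto simp: field_simps)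
        with w show False by blast
      qed
    qed (intro holomorphic_intros, auto)
    then show ?thesis by (simp add: o_def)
  qed
  ultimately show ?thesis
    unfolding legendre_P_def by (intro holomorphic_intros) auto
qed

lemma szego_of_real:
  assumes "x > 1"
  obtains \<rho> where "szego (of_real x) = of_real \<rho>" "0 < \<rho>" "\<rho> < 1" "(1 + \<rho>)\<^sup>2 = 2 * \<rho> * (x + 1)"
proof -
  define \<rho> where "\<rho> = x - sqrt (x - 1) * sqrt (x + 1)"
  have "csqrt (of_real (x - 1)) = of_real (sqrt (x - 1))"
    by (rule of_real_sqrt[symmetric]) (use assms in simp)
  moreover have "csqrt (of_real (x + 1)) = of_real (sqrt (x + 1))"
    by (rule of_real_sqrt[symmetric]) (use assms in simp)
  ultimately have r: "szego (of_real x) = of_real \<rho>"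
    by (simp add: szego_def sqrt_sq_minus_one_def \<rho>_def)
  have x: "complex_of_real x \<notin> complex_of_real ` {..1}" using assms by auto
  note s = szego_slit_plane[OF x, unfolded r]
  have "\<rho> > 0" using s(2) by simp
  moreover have "\<rho> < 1" using s(1) by simp
  moreover have "(1 + \<rho>)\<^sup>2 = 2 * \<rho> * (x + 1)"
  proof -
    have "complex_of_real (2 * x * \<rho>) = of_real (1 + \<rho>\<^sup>2)" using s(3) by simp
    then have "2 * x * \<rho> = 1 + \<rho>\<^sup>2" by (simp only: of_real_eq_iff)
    then show ?thesis by algebra
  qed
  ultimately show ?thesis using that r by blast
qed

lemma one_plus_square_minus_notin_nonpos_Reals:
  fixes r :: complex
  assumes "norm r < 1" "-1 \<le> t" "t \<le> 1"
  shows "1 + r\<^sup>2 - 2 * r * of_real t \<notin> \<real>\<^sub>\<le>\<^sub>0"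
proof
  assume "1 + r\<^sup>2 - 2 * r * of_real t \<in> \<real>\<^sub>\<le>\<^sub>0"
  then have Im: "Im r * (Re r - t) = 0" and Re: "1 + (Re r)\<^sup>2 - (Im r)\<^sup>2 - 2 * Re r * t \<le> 0"
    by (simp_all add: complex_nonpos_Reals_iff power2_eq_square algebra_simps)
  have n: "(Re r)\<^sup>2 + (Im r)\<^sup>2 < 1" using assms(1) by (simp add: cmod_def)
  show False
  proof (cases "Im r = 0")
    case True
    have "\<bar>Re r\<bar> < 1" using abs_Re_le_cmod[of r] assms(1) by simp
    then have "(1 - \<bar>Re r\<bar>)\<^sup>2 > 0" by simp
    moreover have "Re r * t \<le> \<bar>Re r\<bar>"
    proof -
      have "\<bar>Re r * t\<bar> \<le> \<bar>Re r\<bar> * 1" unfolding abs_mult by (rule mult_left_mono) (use assms in auto)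
      then show ?thesis by simp
    qed
    moreover have "(1 - \<bar>Re r\<bar>)\<^sup>2 = 1 + (Re r)\<^sup>2 - 2 * \<bar>Re r\<bar>" by (simp add: power2_eq_square algebra_simps)
    ultimately show False using Re True by simp
  next
    case False
    with Im have "t = Re r" by simp
    with Re n show False by (simp add: power2_eq_square)
  qed
qed

text \<open>
  The point is that the argument \<open>W\<close> of the Legendre function avoids the slit. Its square is
  \<open>(z + 1) / (z - t)\<close>. If \<open>W\<close> is real then this square is real, which for \<open>t > -1\<close> happens only
  for real \<open>z\<close>; and for real \<open>z > 1\<close> all quantities are positive and \<open>W > 1\<close>.
\<close>
lemma jacobi_gen_fun_holomorphic_on:
  fixes t \<alpha> \<beta> :: real
  assumes \<beta>: "\<beta> > -1" and t: "-1 < t" "t \<le> 1"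
  shows "(\<lambda>z. jacobi_gen_fun m \<alpha> \<beta> z (of_real t)) holomorphic_on - (complex_of_real ` {..1})"
proof -
  let ?D = "- (complex_of_real ` {..1})"
  define D where "D z = 2 * (z - sqrt_sq_minus_one z) * (z - of_real t)" for z
  define W where "W z = (1 + z - sqrt_sq_minus_one z) / csqrt (D z)" for z
  have np: "z - of_real c \<notin> \<real>\<^sub>\<le>\<^sub>0" if "c \<le> 1" "z \<in> ?D" for c z
    by (rule slit_plane_minus_notin_nonpos_Reals) (use that in auto)
  have S: "sqrt_sq_minus_one holomorphic_on ?D"
    unfolding sqrt_sq_minus_one_def using np[of 1] np[of "-1"] by (intro holomorphic_intros) auto
  have D: "D z \<notin> \<real>\<^sub>\<le>\<^sub>0" if "z \<in> ?D" for z
  proof -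
    have "D z = 1 + (szego z)\<^sup>2 - 2 * szego z * of_real t"
      using szego_slit_plane(3)[of z] that unfolding D_def szego_def[symmetric] by (simp add: algebra_simps)
    then show ?thesis using one_plus_square_minus_notin_nonpos_Reals[of "szego z" t] szego_slit_plane(1)[of z] that t by simp
  qed
  have D0: "csqrt (D z) \<noteq> 0" if "z \<in> ?D" for z using D[OF that] by auto
  have D_holo: "D holomorphic_on ?D" unfolding D_def by (intro holomorphic_intros S)
  have W_holo: "W holomorphic_on ?D" unfolding W_def using D D0 by (intro holomorphic_intros S D_holo) auto
  have W: "W z \<in> ?D" if z: "z \<in> ?D" for z
  proof
    assume "W z \<in> complex_of_real ` {..1}"
    then obtain v where v: "W z = of_real v" "v \<le> 1" by auto
    have zt: "z - of_real t \<noteq> 0" using np[of t z] t z by auto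
    have sz: "szego z \<noteq> 0" using szego_slit_plane(2)[of z] z by auto
    have "(1 + szego z)\<^sup>2 = 2 * szego z * (z + 1)" using szego_slit_plane(3)[of z] z by (simp add: power2_eq_square algebra_simps)
    then have "(W z)\<^sup>2 * (2 * szego z * (z - of_real t)) = 2 * szego z * (z + 1)"
      using D0[OF z] unfolding W_def D_def by (simp add: power_divide szego_def add_diff_eq)
    then have eq: "of_real (v\<^sup>2) * (z - of_real t) = z + 1" using sz by (simp add: v)
    show False
    proof (cases "Im z = 0")
      case False
      from eq have "Im (of_real (v\<^sup>2) * (z - of_real t)) = Im (z + 1)" by simp
      then have "v\<^sup>2 * Im z = Im z" by (simp del: of_real_power)
      then have "v\<^sup>2 = 1" using False by simp
      with eq have "complex_of_real (- t) = of_real 1" by simp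
      then have "- t = 1" by (simp only: of_real_eq_iff)
      with t show False by simp
    next
      case True
      then obtain x where x: "z = of_real x" by (metis complex_is_Real_iff Reals_cases)
      have x1: "x > 1" using z x by (auto simp: not_le[symmetric])
      obtain \<rho> where \<rho>: "szego (of_real x) = of_real \<rho>" "0 < \<rho>" "\<rho> < 1" "(1 + \<rho>)\<^sup>2 = 2 * \<rho> * (x + 1)"
        using szego_of_real[OF x1] by blast
      have "D z = of_real (2 * \<rho> * (x - t))" unfolding D_def szego_def[symmetric] x \<rho>(1) by simp
      moreover have pos: "2 * \<rho> * (x - t) > 0" using \<rho> x1 t by simp
      ultimately have "csqrt (D z) = of_real (sqrt (2 * \<rho> * (x - t)))"
        by (simp only: of_real_sqrt[OF less_imp_le[OF pos], symmetric])
      then have "W z = of_real ((1 + \<rho>) / sqrt (2 * \<rho> * (x - t)))"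
        using \<rho>(1) unfolding W_def x szego_def by (simp add: add_diff_eq[symmetric])
      then have "v = (1 + \<rho>) / sqrt (2 * \<rho> * (x - t))" using v(1) by (simp only: of_real_eq_iff)
      then have "v > 0" using \<rho> pos by simp
      then have "v\<^sup>2 \<le> 1" using v(2) by (simp add: power_le_one)
      moreover have "v\<^sup>2 * (x - t) = x + 1"
      proof -
        have "complex_of_real (v\<^sup>2 * (x - t)) = of_real (x + 1)" using eq x by simp
        then show ?thesis by (simp only: of_real_eq_iff)
      qed
      ultimately have "x + 1 \<le> 1 * (x - t)" using mult_right_mono[of "v\<^sup>2" 1 "x - t"] x1 t by simp
      with t show False by simp
    qed
  qed
  have "1 - complex_of_real (- \<beta>) \<notin> \<int>\<^sub>\<le>\<^sub>0"
    using of_real_plus_one_notin_nonpos_Ints[OF \<beta>] by (simp add: add.commute)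
  from legendre_P_holomorphic_on[OF this] have "(legendre_P (of_real (\<alpha> + m)) (of_real (- \<beta>)) \<circ> W) holomorphic_on ?D"
    by (rule holomorphic_on_compose_gen[OF W_holo]) (rule image_subsetI, rule W)
  moreover have "z - of_real t \<noteq> 0" if "z \<in> ?D" for z using np[of t z] t that by auto
  moreover have "z - of_real t \<notin> \<real>\<^sub>\<le>\<^sub>0" if "z \<in> ?D" for z using np[of t z] t that by auto
  ultimately show ?thesis
    unfolding jacobi_gen_fun_def W_def[symmetric] D_def[symmetric] o_def
    by (intro holomorphic_intros) auto
qed

text \<open>
  Comparison of logarithms: \<open>ln w\<close>, \<open>ln (1 + \<rho>)\<close> and \<open>ln (w + 1) + ln (w - 1)\<close> are linear in
  the logarithms of \<open>2\<close>, \<open>\<rho>\<close>, \<open>1 + t\<close>, \<open>x - t\<close> and \<open>x + 1\<close>.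
\<close>
lemma jacobi_gen_fun_real_powers:
  fixes \<alpha> \<beta> t x w \<rho> :: real
  assumes "-1 < t" "t < x" "1 < x" "1 < w" "0 < \<rho>"
    and w: "w\<^sup>2 = (x + 1) / (x - t)" and \<rho>: "(1 + \<rho>)\<^sup>2 = 2 * \<rho> * (x + 1)"
  shows "(1 + t) powr (- \<beta> / 2) / (x - t) powr ((\<alpha> + m + 1) / 2) *
      (((w + 1) / (w - 1)) powr (- \<beta> / 2) * (((1 + w) / 2) powr \<beta> * w powr (- (\<alpha> + m + \<beta> + 1)))) =
    2 powr ((\<alpha> + m + 1 - \<beta>) / 2) * (\<rho> powr ((\<alpha> + \<beta> + 1 + m) / 2) * (1 + \<rho>) powr (- (\<alpha> + m + \<beta> + 1)))"
proof -
  have 1: "2 * ln w = ln (x + 1) - ln (x - t)"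
  proof -
    have "2 * ln w = ln (w\<^sup>2)" using ln_realpow[of w 2] assms(4) by simp
    also have "\<dots> = ln (x + 1) - ln (x - t)" unfolding w using assms(1-3) by (simp add: ln_div)
    finally show ?thesis .
  qed
  have 2: "2 * ln (1 + \<rho>) = ln 2 + ln \<rho> + ln (x + 1)"
  proof -
    have "2 * ln (1 + \<rho>) = ln ((1 + \<rho>)\<^sup>2)" using ln_realpow[of "1 + \<rho>" 2] assms(5) by simp
    also have "\<dots> = ln 2 + ln \<rho> + ln (x + 1)" unfolding \<rho> using assms by (simp add: ln_mult)
    finally show ?thesis .
  qed
  have "(w + 1) * (w - 1) = (1 + t) / (x - t)"
  proof -
    have "(w + 1) * (w - 1) = w\<^sup>2 - 1" by (simp add: power2_eq_square algebra_simps)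
    then show ?thesis unfolding w using assms by (simp add: field_simps)
  qed
  then have "ln ((w + 1) * (w - 1)) = ln ((1 + t) / (x - t))" by simp
  then have 3: "ln (w + 1) + ln (w - 1) = ln (1 + t) - ln (x - t)"
    using assms by (simp add: ln_mult ln_div)
  have 4: "ln ((w + 1) / (w - 1)) = ln (w + 1) - ln (w - 1)" "ln ((1 + w) / 2) = ln (w + 1) - ln 2"
    using assms by (simp_all add: ln_div add.commute)
  have nz: "1 + t \<noteq> 0" "x - t \<noteq> 0" "(w + 1) / (w - 1) \<noteq> 0" "(1 + w) / 2 \<noteq> 0" "w \<noteq> 0" "(2::real) \<noteq> 0" "\<rho> \<noteq> 0" "1 + \<rho> \<noteq> 0"
    using assms by auto
  define lw lw1 lw2 lt lx lr lr1 lx1 l2 where "lw = ln w" and "lw1 = ln (w + 1)" and "lw2 = ln (w - 1)" and "lt = ln (1 + t)"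
    and "lx = ln (x - t)" and "lr = ln \<rho>" and "lr1 = ln (1 + \<rho>)" and "lx1 = ln (x + 1)" and "l2 = ln (2::real)"
  have lw: "lw = (lx1 - lx) / 2" using 1 by (simp add: lw_def lx1_def lx_def)
  have lr1: "lr1 = (l2 + lr + lx1) / 2" using 2 by (simp add: lr1_def l2_def lr_def lx1_def)
  have lw1: "lw1 = lt - lx - lw2" using 3 by (simp add: lw1_def lw2_def lt_def lx_def)
  have "(- \<beta> / 2) * lt - ((\<alpha> + m + 1) / 2) * lx + ((- \<beta> / 2) * (lw1 - lw2) + (\<beta> * (lw1 - l2) + (- (\<alpha> + m + \<beta> + 1)) * lw)) =
     ((\<alpha> + m + 1 - \<beta>) / 2) * l2 + (((\<alpha> + \<beta> + 1 + m) / 2) * lr + (- (\<alpha> + m + \<beta> + 1)) * lr1)"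
    unfolding lw lr1 lw1 by (simp add: field_simps)
  then show ?thesis
    unfolding powr_def if_not_P[OF nz(1)] if_not_P[OF nz(2)] if_not_P[OF nz(3)] if_not_P[OF nz(4)] if_not_P[OF nz(5)]
      if_not_P[OF nz(6)] if_not_P[OF nz(7)] if_not_P[OF nz(8)] 4 exp_add[symmetric] exp_diff[symmetric]
    by (simp only: lw_def lw1_def lw2_def lt_def lx_def lr_def lr1_def lx1_def l2_def)
qed

lemma szego_of_real_tendsto_0: "((\<lambda>x. szego (of_real x)) \<longlongrightarrow> 0) at_top"
proof (rule Lim_null_comparison)
  show "((\<lambda>x::real. 1 / x) \<longlongrightarrow> 0) at_top" by (rule tendsto_divide_0[OF tendsto_const filterlim_at_top_imp_at_infinity]) (rule filterlim_ident)
  show "\<forall>\<^sub>F x in at_top. norm (szego (of_real x)) \<le> 1 / x"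
    using eventually_gt_at_top[of 1]
  proof eventually_elim
    case (elim x)
    obtain \<rho> where \<rho>: "szego (of_real x) = of_real \<rho>" "0 < \<rho>" "\<rho> < 1" "(1 + \<rho>)\<^sup>2 = 2 * \<rho> * (x + 1)"
      using szego_of_real[OF elim] by blast
    have "\<rho> * \<rho> \<le> 1" using mult_mono[of \<rho> 1 \<rho> 1] \<rho> by simp
    then have "\<rho> * x \<le> 1" using \<rho>(4) by (simp add: power2_eq_square algebra_simps)
    then show ?case using elim \<rho> by (simp add: field_simps)
  qed
qed

text \<open>
  For large real \<open>z\<close> the argument \<open>w\<close> of the Legendre function is close to \<open>1\<close>, so the quadratic
  transformation applies at \<open>(1 - w) / 2\<close>, and the new hypergeometric argument is
  \<open>1 - 1 / w\<^sup>2 = (1 + t) / (z + 1)\<close>. All bases of powers are positive here, so no branch has to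
  be followed.
\<close>
lemma jacobi_gen_fun_at_large_real:
  fixes \<alpha> \<beta> t :: real and m :: nat
  assumes \<beta>: "\<beta> > -1" and t: "-1 < t"
  defines "l \<equiv> complex_of_real (\<alpha> + m + \<beta> + 1)"
  shows "eventually (\<lambda>x. jacobi_gen_fun m \<alpha> \<beta> (of_real x) (of_real t) =
    of_real (2 powr ((\<alpha> + m + 1 - \<beta>) / 2) / Gamma (\<beta> + 1)) * szego (of_real x) powr of_real ((\<alpha> + \<beta> + 1 + m) / 2) *
    ((1 + szego (of_real x)) powr (- l) *
      hyp2F1 (l / 2) ((l + 1) / 2) (of_real \<beta> + 1)
        (4 * ((1 + of_real t) / 2) * (szego (of_real x) * (1 + szego (of_real x)) powr (- 2))))) at_top"
proof -
  define b where "b = complex_of_real \<beta> + 1"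
  have b: "b \<notin> \<int>\<^sub>\<le>\<^sub>0"
    unfolding b_def by (rule of_real_plus_one_notin_nonpos_Ints[OF \<beta>])
  define w where "w x = sqrt (1 + (1 + t) / (- t + x))" for x
  have "filterlim (\<lambda>x. - t + x) at_top at_top"
    by (rule filterlim_tendsto_add_at_top[OF tendsto_const filterlim_ident])
  then have "((\<lambda>x. (1 + t) / (- t + x)) \<longlongrightarrow> 0) at_top"
    by (intro tendsto_divide_0[OF tendsto_const] filterlim_at_top_imp_at_infinity)
  then have "(w \<longlongrightarrow> sqrt (1 + 0)) at_top"
    unfolding w_def by (intro tendsto_intros)
  then have "(w \<longlongrightarrow> 1) at_top" by simp
  then have "((\<lambda>x. (1 - complex_of_real (w x)) / 2) \<longlongrightarrow> (1 - of_real 1) / 2) at_top"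
    by (intro tendsto_intros) auto
  then have lim: "filterlim (\<lambda>x. (1 - complex_of_real (w x)) / 2) (nhds 0) at_top" by simp
  have "eventually (\<lambda>y. gauss_series (- of_real (\<alpha> + m)) (of_real (\<alpha> + m) + 1) b y =
    (1 - y) powr of_real \<beta> * (1 - 2 * y) powr (- l) *
    gauss_series (l / 2) ((l + 1) / 2) b (4 * (y * (y - 1)) * (inverse (1 - 2 * y) * inverse (1 - 2 * y)))) (nhds 0)"
    using gauss_series_quadratic_transformation[of "of_real \<beta>" "of_real (\<alpha> + m)"] b
    by (simp add: l_def b_def)
  moreover have "eventually (\<lambda>y::complex. y \<in> ball 0 1) (nhds 0)" by (intro eventually_nhds_in_open) auto
  ultimately have "eventually (\<lambda>y. hyp2F1 (- of_real (\<alpha> + m)) (of_real (\<alpha> + m) + 1) b y =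
    (1 - y) powr of_real \<beta> * (1 - 2 * y) powr (- l) *
    gauss_series (l / 2) ((l + 1) / 2) b (4 * (y * (y - 1)) * (inverse (1 - 2 * y) * inverse (1 - 2 * y)))) (nhds 0)"
    by eventually_elim (simp add: hyp2F1_cut_plane(2)[OF b])
  from eventually_compose_filterlim[OF this lim] eventually_gt_at_top[of 1] eventually_gt_at_top[of t]
  show ?thesis
  proof eventually_elim
    case (elim x)
    define Y where "Y = (1 - complex_of_real (w x)) / 2"
    obtain \<rho> where \<rho>: "szego (of_real x) = of_real \<rho>" "0 < \<rho>" "\<rho> < 1" "(1 + \<rho>)\<^sup>2 = 2 * \<rho> * (x + 1)"
      using szego_of_real[OF elim(2)] by blast
    have xt: "x - t > 0" using elim by simp
    have w2: "(w x)\<^sup>2 = (x + 1) / (x - t)" using xt t by (simp add: w_def field_simps)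
    have w1: "w x > 1" using xt t by (simp add: w_def field_simps)
    have sq: "csqrt (of_real (2 * \<rho> * (x - t))) = of_real (sqrt (2 * \<rho> * (x - t)))"
      by (rule of_real_sqrt[symmetric]) (use \<rho> xt in simp)
    have "(1 + \<rho>) / sqrt (2 * \<rho> * (x - t)) = w x"
    proof (rule power2_eq_imp_eq)
      show "((1 + \<rho>) / sqrt (2 * \<rho> * (x - t)))\<^sup>2 = (w x)\<^sup>2"
        using \<rho> xt by (simp add: power_divide w2)
    qed (use \<rho> xt w1 in auto)
    then have quot: "of_real (1 + \<rho>) / of_real (sqrt (2 * \<rho> * (x - t))) = complex_of_real (w x)"
      by (simp only: of_real_divide[symmetric])
    have e1: "of_real x - sqrt_sq_minus_one (of_real x) = of_real \<rho>" using \<rho>(1) by (simp add: szego_def)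
    have e2: "1 + of_real x - sqrt_sq_minus_one (of_real x) = of_real (1 + \<rho>)"
      using e1 by (simp add: add_diff_eq[symmetric])
    have e3: "2 * complex_of_real \<rho> * (of_real x - of_real t) = of_real (2 * \<rho> * (x - t))" by simp
    have arg: "(1 + of_real x - sqrt_sq_minus_one (of_real x)) / csqrt (2 * (of_real x - sqrt_sq_minus_one (of_real x)) * (of_real x - of_real t)) = of_real (w x)"
      unfolding e2 e1 e3 sq by (rule quot)
    have Z: "4 * (Y * (Y - 1)) * (inverse (1 - 2 * Y) * inverse (1 - 2 * Y)) = of_real ((1 + t) / (x + 1))"
    proof -
      have "4 * (Y * (Y - 1)) * (inverse (1 - 2 * Y) * inverse (1 - 2 * Y)) = of_real (((w x)\<^sup>2 - 1) / (w x)\<^sup>2)"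
        using w1 by (simp add: Y_def field_simps power2_eq_square)
      also have "((w x)\<^sup>2 - 1) / (w x)\<^sup>2 = (1 + t) / (x + 1)"
      proof -
        have "(u / v - 1) / (u / v) = (u - v) / u" if "u \<noteq> 0" "v \<noteq> 0" for u v :: real
          using that by (simp add: field_simps)
        from this[of "x + 1" "x - t"] show ?thesis unfolding w2 using xt elim(2) by simp
      qed
      finally show ?thesis .
    qed
    have Z': "4 * ((1 + of_real t) / 2) * (szego (of_real x) * (1 + szego (of_real x)) powr (- 2)) = of_real ((1 + t) / (x + 1))"
    proof -
      have "(1 + complex_of_real \<rho>) powr (- 2) = of_real (inverse ((1 + \<rho>)\<^sup>2))"
        using powr_nat'[of "1 + complex_of_real \<rho>" 2] by (simp add: powr_minus)
      then have "4 * ((1 + of_real t) / 2) * (szego (of_real x) * (1 + szego (of_real x)) powr (- 2)) = of_real (2 * (1 + t) * \<rho> * inverse ((1 + \<rho>)\<^sup>2))"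
        unfolding \<rho>(1) by simp
      also have "2 * (1 + t) * \<rho> * inverse ((1 + \<rho>)\<^sup>2) = (1 + t) / (x + 1)"
      proof -
        have *: "2 * u * v * inverse (2 * v * y) = u / y" if "v \<noteq> 0" "y \<noteq> 0" for u v y :: real
          using that by (simp add: field_simps)
        show ?thesis unfolding \<rho>(4) by (rule *) (use \<rho>(2) elim(2) in auto)
      qed
      finally show ?thesis .
    qed
    define G where "G = gauss_series (l / 2) ((l + 1) / 2) b (of_real ((1 + t) / (x + 1)))"
    have G: "hyp2F1 (l / 2) ((l + 1) / 2) b (of_real ((1 + t) / (x + 1))) = G"
      unfolding G_def by (rule hyp2F1_cut_plane(2)[OF b]) (use t elim in \<open>simp add: norm_divide del: of_real_divide\<close>)
    have h: "hyp2F1 (- of_real (\<alpha> + m)) (of_real (\<alpha> + m) + 1) b Y = of_real (((1 + w x) / 2) powr \<beta>) * of_real (w x powr (- (\<alpha> + m + \<beta> + 1))) * G"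
    proof -
      have Y: "1 - Y = of_real ((1 + w x) / 2)" "1 - 2 * Y = of_real (w x)" by (simp_all add: Y_def field_simps)
      have p: "of_real ((1 + w x) / 2) powr of_real \<beta> = complex_of_real (((1 + w x) / 2) powr \<beta>)"
        "of_real (w x) powr (- l) = complex_of_real (w x powr (- (\<alpha> + m + \<beta> + 1)))"
        unfolding l_def of_real_minus[symmetric] using w1 by (intro powr_of_real; simp)+
      have "hyp2F1 (- of_real (\<alpha> + m)) (of_real (\<alpha> + m) + 1) b Y = (1 - Y) powr of_real \<beta> * (1 - 2 * Y) powr (- l) * G"
        unfolding elim(1)[folded Y_def] Z G_def ..
      then show ?thesis unfolding Y p .
    qed
    have P: "legendre_P (of_real (\<alpha> + m)) (of_real (- \<beta>)) (of_real (w x)) =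
      of_real (1 / Gamma (\<beta> + 1)) * of_real (((w x + 1) / (w x - 1)) powr (- \<beta> / 2)) *
        (of_real (((1 + w x) / 2) powr \<beta>) * of_real (w x powr (- (\<alpha> + m + \<beta> + 1))) * G)"
    proof -
      have "(complex_of_real (w x) + 1) / (of_real (w x) - 1) = of_real ((w x + 1) / (w x - 1))" by simp
      moreover have "complex_of_real ((w x + 1) / (w x - 1)) powr (of_real (- \<beta>) / 2) = of_real (((w x + 1) / (w x - 1)) powr (- \<beta> / 2))"
      proof -
        have half: "complex_of_real (- \<beta>) / 2 = of_real (- \<beta> / 2)" by simp
        show ?thesis unfolding half by (rule powr_of_real) (use w1 in simp)
      qed
      moreover have "1 - complex_of_real (- \<beta>) = b" "Gamma b = of_real (Gamma (\<beta> + 1))"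
        by (simp_all add: b_def Gamma_complex_of_real[symmetric])
      ultimately show ?thesis
        unfolding legendre_P_def Y_def[symmetric] by (simp only: h) simp
    qed
    define a1 a2 where "a1 = (1 + t) powr (- \<beta> / 2)" and "a2 = (x - t) powr ((\<alpha> + m + 1) / 2)"
    define a3 a4 a5 where "a3 = ((w x + 1) / (w x - 1)) powr (- \<beta> / 2)" and "a4 = ((1 + w x) / 2) powr \<beta>" and "a5 = w x powr (- (\<alpha> + m + \<beta> + 1))"
    define k b1 b2 where "k = 2 powr ((\<alpha> + m + 1 - \<beta>) / 2)" and "b1 = \<rho> powr ((\<alpha> + \<beta> + 1 + m) / 2)" and "b2 = (1 + \<rho>) powr (- (\<alpha> + m + \<beta> + 1))"
    have id: "a1 / a2 * (a3 * (a4 * a5)) = k * (b1 * b2)"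
      unfolding a1_def a2_def a3_def a4_def a5_def k_def b1_def b2_def
      by (rule jacobi_gen_fun_real_powers[OF t elim(3,2) w1 \<rho>(2) w2 \<rho>(4)])
    have c1: "(1 + complex_of_real t) powr of_real (- \<beta> / 2) = of_real a1"
      using powr_of_real[of "1 + t" "- \<beta> / 2"] t by (simp add: a1_def)
    have c2: "(complex_of_real x - of_real t) powr of_real ((\<alpha> + m + 1) / 2) = of_real a2"
      using powr_of_real[of "x - t" "(\<alpha> + m + 1) / 2"] xt by (simp add: a2_def)
    have c3: "complex_of_real \<rho> powr of_real ((\<alpha> + \<beta> + 1 + m) / 2) = of_real b1"
      unfolding b1_def by (rule powr_of_real) (use \<rho> in auto)
    have c4: "(1 + complex_of_real \<rho>) powr (- l) = of_real b2"
      using powr_of_real[of "1 + \<rho>" "- (\<alpha> + m + \<beta> + 1)"] \<rho> by (simp add: b2_def l_def)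
    have "jacobi_gen_fun m \<alpha> \<beta> (of_real x) (of_real t) = of_real a1 / of_real a2 * (of_real (1 / Gamma (\<beta> + 1)) * of_real a3 * (of_real a4 * of_real a5 * G))"
      unfolding jacobi_gen_fun_def arg c1 c2 P a3_def a4_def a5_def ..
    also have "\<dots> = of_real (a1 / a2 * (a3 * (a4 * a5))) * of_real (1 / Gamma (\<beta> + 1)) * G" by simp
    also have "\<dots> = of_real (k / Gamma (\<beta> + 1)) * of_real b1 * (of_real b2 * G)" unfolding id by simp
    finally show ?case
      unfolding Z' b_def[symmetric] G unfolding \<rho>(1) c3 c4 k_def .
  qed
qed

text \<open>
  Both sides are holomorphic in \<open>z\<close> on the slit plane, so it suffices to compare them for large
  real \<open>z\<close>. There \<open>szego z\<close> is close to \<open>0\<close>, where the generating function and the sum of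
  the terms have the same Taylor coefficients.
\<close>
lemma jacobi_gen_fun_eq_sum:
  fixes \<alpha> \<beta> t :: real and m :: nat and z :: complex
  assumes \<beta>: "\<beta> > -1" and g: "\<alpha> + \<beta> + 1 > -1" "\<alpha> + \<beta> + 1 \<noteq> 0" and t: "-1 < t" "t \<le> 1"
    and z: "z \<notin> complex_of_real ` {..1}"
  shows "jacobi_gen_fun m \<alpha> \<beta> z (of_real t) =
    of_real (2 powr ((\<alpha> + m + 1 - \<beta>) / 2) / Gamma (\<beta> + 1)) * szego z powr of_real ((\<alpha> + \<beta> + 1 + m) / 2) *
    (\<Sum>n. jacobi_gf_term m (\<alpha> + \<beta> + 1) (of_real \<beta> + 1) n ((1 + of_real t) / 2) (szego z))"
proof -
  let ?D = "- (complex_of_real ` {..1})"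
  define b where "b = complex_of_real \<beta> + 1"
  have b: "b \<notin> \<int>\<^sub>\<le>\<^sub>0"
    unfolding b_def by (rule of_real_plus_one_notin_nonpos_Ints[OF \<beta>])
  define B where "B r = (\<Sum>n. jacobi_gf_term m (\<alpha> + \<beta> + 1) b n ((1 + complex_of_real t) / 2) r)" for r
  define l where "l = complex_of_real (\<alpha> + m + \<beta> + 1)"
  define A where "A r = (1 + r) powr (- l) * hyp2F1 (l / 2) ((l + 1) / 2) b (4 * ((1 + of_real t) / 2) * (r * (1 + r) powr (- 2)))" for r
  define K where "K = complex_of_real (2 powr ((\<alpha> + m + 1 - \<beta>) / 2) / Gamma (\<beta> + 1))"
  define \<Delta> where "\<Delta> z = jacobi_gen_fun m \<alpha> \<beta> z (of_real t) - K * szego z powr of_real ((\<alpha> + \<beta> + 1 + m) / 2) * B (szego z)" for z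
  note gf = jacobi_gf_sum[OF g b, of t m, folded B_def[abs_def]]
  have l_eq: "complex_of_real (\<alpha> + \<beta> + 1) + of_nat m = l" by (simp add: l_def)
  have fps_B: "B has_fps_expansion Abs_fps (\<lambda>N. jacobi_gf_coeff l b N ((1 + of_real t) / 2))"
    using gf(2) t unfolding l_eq by simp
  have fps_A: "A has_fps_expansion Abs_fps (\<lambda>N. jacobi_gf_coeff l b N ((1 + of_real t) / 2))"
    unfolding A_def by (rule jacobi_gf_has_fps_expansion[OF hyp2F1_has_fps_expansion[OF b]])
  from fps_A[unfolded has_fps_expansion_def, THEN conjunct2] fps_B[unfolded has_fps_expansion_def, THEN conjunct2]
  have "eventually (\<lambda>r. A r = B r) (nhds 0)"
    by eventually_elim simp
  from eventually_compose_filterlim[OF this szego_of_real_tendsto_0]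
    jacobi_gen_fun_at_large_real[OF \<beta> t(1), of m \<alpha>] eventually_gt_at_top[of 1]
  have "eventually (\<lambda>x. \<Delta> (of_real x) = 0 \<and> x > 1) at_top"
  proof eventually_elim
    case (elim x)
    then show ?case unfolding \<Delta>_def elim(2) K_def b_def[symmetric] l_def[symmetric] A_def by simp
  qed
  then obtain X where X: "\<And>x. x \<ge> X \<Longrightarrow> \<Delta> (of_real x) = 0" "\<And>x. x \<ge> X \<Longrightarrow> x > 1"
    by (auto simp: eventually_at_top_linorder)
  have np: "z - of_real c \<notin> \<real>\<^sub>\<le>\<^sub>0" if "c \<le> 1" "z \<in> ?D" for c z
    by (rule slit_plane_minus_notin_nonpos_Reals) (use that in auto)
  have szego_holo: "szego holomorphic_on ?D"
    unfolding szego_def sqrt_sq_minus_one_def using np[of 1] np[of "-1"] by (intro holomorphic_intros) auto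
  have "(B \<circ> szego) holomorphic_on ?D"
    by (rule holomorphic_on_compose_gen[OF szego_holo gf(1)]) (use t szego_slit_plane(1) in auto)
  then have "\<Delta> holomorphic_on ?D"
    unfolding \<Delta>_def o_def using szego_slit_plane(2)
    by (intro holomorphic_intros szego_holo jacobi_gen_fun_holomorphic_on \<beta> t) auto
  then have "\<Delta> z = 0"
  proof (rule analytic_continuation[where U = "complex_of_real ` {X..}" and \<xi> = "of_real X"])
    show "open ?D"
      using closed_slot_left by (simp add: open_Compl)
    show "connected ?D" by (rule starlike_imp_connected[OF starlike_slotted_complex_plane_left])
    have "of_real x \<in> ?D" if "x \<ge> X" for x using X(2)[OF that] by auto
    then show "complex_of_real ` {X..} \<subseteq> ?D" "complex_of_real X \<in> ?D" by auto
    show "complex_of_real X islimpt complex_of_real ` {X..}"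
      unfolding islimpt_approachable
    proof (intro allI impI)
      fix e :: real assume "e > 0"
      then show "\<exists>x'\<in>complex_of_real ` {X..}. x' \<noteq> of_real X \<and> dist x' (of_real X) < e"
        by (intro bexI[of _ "of_real (X + e / 2)"] imageI) (auto simp: dist_norm)
    qed
  qed (use X z in auto)
  then show ?thesis by (simp add: \<Delta>_def K_def B_def b_def)
qed

section \<open>The expansion in the interior of the ellipse\<close>

theorem corollary2:
  fixes m :: nat and \<alpha> \<beta> s :: real and z :: complex
  assumes "\<alpha> > -1" and "\<beta> > -1"
    and "\<alpha> \<in> {-1<..<0} \<and> \<beta> \<in> {-1<..<0} \<longrightarrow> \<alpha> + \<beta> + 1 \<noteq> 0"
    and "z \<notin> complex_of_real ` {..1}"
    and "z \<in> focal_ellipse s"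
  shows "\<exists>g. g holomorphic_on focal_ellipse_interior s \<and>
             (\<forall>t\<in>{-1<..1}. g (complex_of_real t) = jacobi_gen_fun m \<alpha> \<beta> z (complex_of_real t)) \<and>
             (\<forall>x\<in>focal_ellipse_interior s.
                (\<lambda>n. jacobi_coeff n m \<alpha> \<beta> z * jacobi_P n \<alpha> \<beta> x) sums g x)"
proof -
  define g where "g = \<alpha> + \<beta> + 1"
  have g: "g > -1" "g \<noteq> 0" using assms(1-3) by (auto simp: g_def)
  define b where "b = complex_of_real \<beta> + 1"
  have b: "b \<notin> \<int>\<^sub>\<le>\<^sub>0"
    unfolding b_def by (rule of_real_plus_one_notin_nonpos_Ints[OF assms(2)])
  define r where "r = szego z"
  have r: "norm r < 1" "r \<noteq> 0" "2 * z * r = 1 + r\<^sup>2" using szego_slit_plane[OF assms(4)] by (auto simp: r_def)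
  have s: "s = norm r + 1 / norm r"
    using joukowski_foci[OF r(2,3)] assms(5) by (simp add: focal_ellipse_def)
  define T where "T n x = jacobi_gf_term m g b n ((1 + x) / 2) r" for n x
  have bound: "\<exists>M. summable M \<and> (\<forall>n x. norm (x - 1) + norm (x + 1) \<le> s0 \<longrightarrow> norm (T n x) \<le> M n)" if s0: "s0 < s" for s0
  proof -
    have "((\<lambda>u. u + 1 / u) \<longlongrightarrow> norm r + 1 / norm r) (at_right (norm r))"
      using r(2) by (intro tendsto_intros) auto
    then have "eventually (\<lambda>u. s0 < u + 1 / u) (at_right (norm r))"
      by (rule order_tendstoD) (use s0 s in simp)
    moreover have "eventually (\<lambda>u. u < 1) (at_right (norm r))"
      by (rule order_tendstoD[OF tendsto_ident_at]) (rule r(1))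
    moreover have "eventually (\<lambda>u. norm r < u) (at_right (norm r))" by (rule eventually_at_right_less)
    ultimately have "eventually (\<lambda>u. s0 < u + 1 / u \<and> u < 1 \<and> norm r < u) (at_right (norm r))"
      by eventually_elim auto
    \<comment> \<open>Since \<open>u + 1 / u\<close> decreases on \<open>(0, 1]\<close>, points with sum of focal distances at most \<open>s0\<close> have a Joukowski variable of modulus at least \<open>e0\<close>.\<close>
    then obtain e0 where e0: "s0 < e0 + 1 / e0" "e0 < 1" "norm r < e0"
      using eventually_happens trivial_limit_at_right_real by (metis (mono_tags, lifting))
    obtain M where M: "summable M" "\<And>n e u. norm u \<le> norm r \<Longrightarrow> e0 \<le> norm e \<Longrightarrow> norm e \<le> 1 \<Longrightarrow> norm (jacobi_gf_term m g b n ((1 + e)\<^sup>2 / (4 * e)) u) \<le> M n"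
      using jacobi_gf_term_bound[OF g(1) b norm_ge_zero e0(3) less_imp_le[OF e0(2)]] by blast
    have "norm (T n x) \<le> M n" if x: "norm (x - 1) + norm (x + 1) \<le> s0" for n x
    proof -
      obtain e where e: "e \<noteq> 0" "norm e \<le> 1" "2 * x * e = 1 + e\<^sup>2" "(1 + x) / 2 = (1 + e)\<^sup>2 / (4 * e)"
        by (rule joukowski_surj)
      have h: "norm e + 1 / norm e < e0 + 1 / e0" using joukowski_foci[OF e(1,3)] x e0(1) by simp
      have "e0 \<le> norm e"
      proof (rule ccontr)
        assume "\<not> e0 \<le> norm e"
        then have lt: "0 < norm e" "norm e < e0" using e(1) by auto
        then have "norm e * e0 \<le> 1" using e(2) e0(2) mult_mono[of "norm e" 1 e0 1] by linarith
        then have "0 \<le> (e0 - norm e) * (1 - norm e * e0)" using lt by (intro mult_nonneg_nonneg) auto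
        have id: "u + 1 / u - (v + 1 / v) = (v - u) * (1 - u * v) / (u * v)" if "u \<noteq> 0" "v \<noteq> 0" for u v :: real
          using that by (simp add: field_simps)
        have "norm e + 1 / norm e - (e0 + 1 / e0) = (e0 - norm e) * (1 - norm e * e0) / (norm e * e0)"
          by (rule id) (use lt in linarith)+
        also have "\<dots> \<ge> 0"
          by (rule divide_nonneg_nonneg[OF \<open>0 \<le> (e0 - norm e) * (1 - norm e * e0)\<close>]) (rule mult_nonneg_nonneg; use lt in linarith)
        finally have "0 \<le> norm e + 1 / norm e - (e0 + 1 / e0)" .
        with h show False by simp
      qed
      then show ?thesis unfolding T_def e(4) by (intro M(2)) (use e in auto)
    qed
    with M(1) show ?thesis by blast
  qed
  define K where "K = of_real (2 powr ((\<alpha> + m + 1 - \<beta>) / 2) / Gamma (\<beta> + 1)) * r powr of_real ((g + m) / 2)"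
  have T: "jacobi_coeff n m \<alpha> \<beta> z * jacobi_P n \<alpha> \<beta> x = K * T n x" for n x
    using jacobi_coeff_mult_jacobi_P[OF assms(1,2) _ _ assms(4), of n m x] g
    unfolding K_def T_def r_def b_def g_def by simp
  define F where "F x = (\<Sum>n. T n x)" for x
  have int: "focal_ellipse_interior s = {w. norm (w - 1) + norm (w + 1) < s}" by (simp add: focal_ellipse_interior_def)
  have opn: "open (focal_ellipse_interior s)"
    unfolding int by (intro open_Collect_less continuous_intros)
  have "F holomorphic_on focal_ellipse_interior s"
  proof (rule holomorphic_uniform_sequence[OF opn])
    show "(\<lambda>x. \<Sum>i<n. T i x) holomorphic_on focal_ellipse_interior s" for n
      unfolding T_def jacobi_gf_term_def jacobi_gf_coeff_def by (intro holomorphic_intros) auto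
    fix x assume "x \<in> focal_ellipse_interior s"
    then obtain d where d: "d > 0" "cball x d \<subseteq> focal_ellipse_interior s"
      using opn open_contains_cball by blast
    have "\<exists>u\<in>cball x d. \<forall>v\<in>cball x d. norm (v - 1) + norm (v + 1) \<le> norm (u - 1) + norm (u + 1)"
      using d(1) by (intro continuous_attains_sup continuous_intros) auto
    then obtain u where u: "u \<in> cball x d" "\<And>v. v \<in> cball x d \<Longrightarrow> norm (v - 1) + norm (v + 1) \<le> norm (u - 1) + norm (u + 1)" by blast
    then have "norm (u - 1) + norm (u + 1) < s" using d(2) by (auto simp: int)
    from bound[OF this] obtain M where M: "summable M" "\<And>n x. norm (x - 1) + norm (x + 1) \<le> norm (u - 1) + norm (u + 1) \<Longrightarrow> norm (T n x) \<le> M n"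
      by blast
    have "uniform_limit (cball x d) (\<lambda>n x. \<Sum>i<n. T i x) F sequentially"
      unfolding F_def by (rule Weierstrass_m_test[OF M(2) M(1)]) (rule u(2))
    with d show "\<exists>d>0. cball x d \<subseteq> focal_ellipse_interior s \<and> uniform_limit (cball x d) (\<lambda>n x. \<Sum>i<n. T i x) F sequentially"
      by blast
  qed
  then have "(\<lambda>x. K * F x) holomorphic_on focal_ellipse_interior s"
    by (intro holomorphic_intros)
  moreover have "\<forall>t\<in>{-1<..1}. K * F (complex_of_real t) = jacobi_gen_fun m \<alpha> \<beta> z (complex_of_real t)"
    using jacobi_gen_fun_eq_sum[OF assms(2) _ _ _ _ assms(4), of \<alpha> _ m] g
    by (simp add: K_def F_def T_def g_def r_def b_def)
  moreover have "\<forall>x\<in>focal_ellipse_interior s. (\<lambda>n. jacobi_coeff n m \<alpha> \<beta> z * jacobi_P n \<alpha> \<beta> x) sums (K * F x)"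
  proof
    fix x assume "x \<in> focal_ellipse_interior s"
    then have "norm (x - 1) + norm (x + 1) < s" by (simp add: int)
    from bound[OF this] obtain M where M: "summable M" "\<And>n. norm (T n x) \<le> M n" by blast
    have "summable (\<lambda>n. T n x)" by (rule summable_comparison_test'[OF M])
    then show "(\<lambda>n. jacobi_coeff n m \<alpha> \<beta> z * jacobi_P n \<alpha> \<beta> x) sums (K * F x)"
      unfolding T F_def by (intro sums_mult summable_sums)
  qed
  ultimately show ?thesis by blast
qed

end
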